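(* Let $m$ and $d$ be non-negative integers with $d\le 2m+1$, and let $\mathcal{L}=\mathcal{L}_{3,d}(m^9)$ be the linear system of surfaces of degree $d$ in $\mathbb{P}^3$ with multiplicity at least $m$ at each of nine points in general position; let $Q$ be the unique quadric surface through these nine points. Then the Laface-Ugaglia Conjecture holds for $\mathcal{L}$. That is, if $\mathcal{L}$ is Cremona reduced, then: (1) if $q(\mathcal{L})\le 0$, then $\dim(\mathcal{L})=\dim(\mathcal{L}-Q)$; (2) if $q(\mathcal{L})>0$, then $\mathcal{L}$ is linearly non-special.
   Context: We work over the complex numbers. Dimensions are affine (vector space) dimensions. For $\mathcal{L}=\mathcal{L}_{3,d}(m_1,\dots,m_9)$, the system of degree $d$ surfaces in $\mathbb{P}^3$ with multiplicity at least $m_i$ at $p_i$ for nine points in general position, with $d\ge m_1\ge\dots\ge m_9\ge0$ (here all $m_i=m$): - $\mathcal{L}$ is Cremona reduced if $m_1+m_2+m_3+m_4\le 2d$. - $q(\mathcal{L})=\chi(\mathcal{L}|_Q)=(d+1)^2-\sum_{i=1}^9\binom{m_i+1}{2}$. - $\mathcal{L}-Q$ is the residual system $\mathcal{L}_{3,d-2}(m_1-1,\dots,m_9-1)$ with respect to $Q$, based at the same points (a multiplicity $-1$ imposes no condition; the system is zero if $d<2$). - $\operatorname{vdim}(\mathcal{L})=\chi(\mathcal{L})=\binom{d+3}{3}-\sum_{i=1}^9\binom{m_i+2}{3}$. - A Cremona reduced system $\mathcal{L}$ is linearly non-special if its dimension equals its linear expected dimension, i.e. if $$\dim(\mathcal{L})=\max\Big(0,\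 \chi(\mathcal{L})+\sum_{i<j,\ m_i+m_j-d\ge 2}\binom{m_i+m_j-d+1}{3}\Big).$$ *)

theory Defs
  imports "HOL-Analysis.Analysis" "HOL-Library.Poly_Mapping"
begin

section \<open>Complex polynomials in finitely many variables\<close>

text \<open>A monomial in variables indexed by \<open>'v\<close> is its exponent vector.\<close>

type_synonym 'v cpoly = "('v \<Rightarrow>\<^sub>0 nat) \<Rightarrow>\<^sub>0 complex"

definition cpoly_scale :: "complex \<Rightarrow> 'v cpoly \<Rightarrow> 'v cpoly" where
  "cpoly_scale c F = Poly_Mapping.map ((*) c) F"

lemma lookup_cpoly_scale [simp]:
  "Poly_Mapping.lookup (cpoly_scale c F) \<beta> = c * Poly_Mapping.lookup F \<beta>"
  unfolding cpoly_scale_def by transfer (simp add: when_def)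

interpretation cpoly: vector_space cpoly_scale
  by standard (auto intro!: poly_mapping_eqI simp: lookup_add algebra_simps)

definition cpoly_eval :: "('v::finite) cpoly \<Rightarrow> ('v \<Rightarrow> complex) \<Rightarrow> complex" where
  "cpoly_eval F x = (\<Sum>\<beta>\<in>Poly_Mapping.keys F.
     Poly_Mapping.lookup F \<beta> * (\<Prod>v\<in>UNIV. x v ^ Poly_Mapping.lookup \<beta> v))"

text \<open>Exponents are subtracted in \<open>nat\<close>; where this truncates, the factor \<open>of_nat\<close> is zero.\<close>

definition cpoly_pderiv :: "'v \<Rightarrow> 'v cpoly \<Rightarrow> 'v cpoly" where
  "cpoly_pderiv v F = (\<Sum>\<beta>\<in>Poly_Mapping.keys F.
     Poly_Mapping.single (\<beta> - Poly_Mapping.single v 1)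
       (of_nat (Poly_Mapping.lookup \<beta> v) * Poly_Mapping.lookup F \<beta>))"

definition homogeneous :: "int \<Rightarrow> ('v::finite) cpoly \<Rightarrow> bool" where
  "homogeneous d F \<longleftrightarrow>
     (\<forall>\<beta>\<in>Poly_Mapping.keys F. int (\<Sum>v\<in>UNIV. Poly_Mapping.lookup \<beta> v) = d)"


section \<open>Nine general points of projective 3-space\<close>

text \<open>A nine-tuple of points of $\mathbb{P}^3$ is given by homogeneous coordinates, that is, by nine
  nonzero vectors; the points are indexed by the nine-element type \<open>9\<close>, whose elements are
  $0 < 1 < \dots < 8$. The Zariski closed subsets of $(\mathbb{P}^3)^9$ are the zero loci of sets
  of multihomogeneous polynomials in the \<open>9 \<times> 4\<close> coordinates, and a property holds in general
  position if it holds on a nonempty Zariski open subset.\<close>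

type_synonym points = "9 \<Rightarrow> complex ^ 4"

definition multihomogeneous :: "(9 \<times> 4) cpoly \<Rightarrow> bool" where
  "multihomogeneous F \<longleftrightarrow> (\<exists>e :: 9 \<Rightarrow> nat. \<forall>\<beta>\<in>Poly_Mapping.keys F. \<forall>i.
     (\<Sum>k\<in>UNIV. Poly_Mapping.lookup \<beta> (i, k)) = e i)"

definition zariski_open :: "points set \<Rightarrow> bool" where
  "zariski_open U \<longleftrightarrow> (\<exists>S. (\<forall>F\<in>S. multihomogeneous F) \<and>
     U = {p. (\<forall>i. p i \<noteq> 0) \<and> (\<exists>F\<in>S. cpoly_eval F (\<lambda>(i, k). p i $ k) \<noteq> 0)})"

definition in_general_position :: "(points \<Rightarrow> bool) \<Rightarrow> bool" where
  "in_general_position P \<longleftrightarrow> (\<exists>U. zariski_open U \<and> U \<noteq> {} \<and> (\<forall>p\<in>U. P p))"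


section \<open>Linear systems of surfaces\<close>

text \<open>\<open>F\<close> has multiplicity at least \<open>m\<close> at the point with homogeneous coordinates \<open>x\<close> if all
  its partial derivatives of order less than \<open>m\<close> vanish at \<open>x\<close>. There is no condition
  if \<open>m \<le> 0\<close>.\<close>

definition mult_ge :: "int \<Rightarrow> 4 cpoly \<Rightarrow> complex ^ 4 \<Rightarrow> bool" where
  "mult_ge m F x \<longleftrightarrow>
     (\<forall>vs. int (length vs) < m \<longrightarrow> cpoly_eval (fold cpoly_pderiv vs F) (($) x) = 0)"

text \<open>The system $\mathcal{L}_{3,d}(m_1,\dots,m_9)$ based at \<open>p\<close>, as the vector space of the
  defining forms and zero. It is the zero space if \<open>d < 0\<close>. The multiplicities are
  \<open>m 0, \<dots>, m 8\<close>.\<close>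

definition linear_system :: "int \<Rightarrow> (9 \<Rightarrow> int) \<Rightarrow> points \<Rightarrow> 4 cpoly set" where
  "linear_system d m p = {F. homogeneous d F \<and> (\<forall>i. mult_ge (m i) F (p i))}"

text \<open>The residual system $\mathcal{L} - Q$ with respect to the quadric through the points.\<close>

definition residual_system :: "int \<Rightarrow> (9 \<Rightarrow> int) \<Rightarrow> points \<Rightarrow> 4 cpoly set" where
  "residual_system d m p = linear_system (d - 2) (\<lambda>i. m i - 1) p"

text \<open>The following numerical notions are meant for \<open>d \<ge> m 0 \<ge> \<dots> \<ge> m 8 \<ge> 0\<close>.\<close>

definition cremona_reduced :: "int \<Rightarrow> (9 \<Rightarrow> int) \<Rightarrow> bool" where
  "cremona_reduced d m \<longleftrightarrow> m 0 + m 1 + m 2 + m 3 \<le> 2 * d"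

abbreviation int_binom :: "int \<Rightarrow> nat \<Rightarrow> int" where
  "int_binom a k \<equiv> int (nat a choose k)"

text \<open>$q(\mathcal{L}) = \chi(\mathcal{L}|_Q)$ and $\chi(\mathcal{L})$:\<close>

definition q_system :: "int \<Rightarrow> (9 \<Rightarrow> int) \<Rightarrow> int" where
  "q_system d m = (d + 1) ^ 2 - (\<Sum>i\<in>UNIV. int_binom (m i + 1) 2)"

definition chi_system :: "int \<Rightarrow> (9 \<Rightarrow> int) \<Rightarrow> int" where
  "chi_system d m = int_binom (d + 3) 3 - (\<Sum>i\<in>UNIV. int_binom (m i + 2) 3)"

definition linear_expected_dim :: "int \<Rightarrow> (9 \<Rightarrow> int) \<Rightarrow> int" where
  "linear_expected_dim d m = max 0 (chi_system d m +
     (\<Sum>(i, j)\<in>{(i, j). i < j \<and> m i + m j - d \<ge> 2}. int_binom (m i + m j - d + 1) 3))"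

definition linearly_nonspecial :: "int \<Rightarrow> (9 \<Rightarrow> int) \<Rightarrow> points \<Rightarrow> bool" where
  "linearly_nonspecial d m p \<longleftrightarrow>
     int (cpoly.dim (linear_system d m p)) = linear_expected_dim d m"

end

theory Submission
  imports Defs "HOL-Library.Multiset"
begin

text \<open>Being Cremona reduced forces \<open>d \<in> {2 * m, 2 * m + 1}\<close>. Dimensions are upper semicontinuous, so it
  suffices to bound them from above for one nine-tuple of points, chosen on the quadric
  \<open>X0 * X3 = X1 * X2\<close>. Restriction to it has kernel the residual system, hence by induction on \<open>m\<close>
  everything reduces to curves of bidegree \<open>(d, d)\<close> with nine points of multiplicity \<open>m\<close> on
  $\mathbb{P}^1 \times \mathbb{P}^1$: there are none if \<open>d = 2 * m > 0\<close>, and they form a space of dimension at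
  most \<open>max 0 ((m + 1) * (8 - m) / 2)\<close> if \<open>d = 2 * m + 1\<close>. A polynomial vanishes to order \<open>m\<close> at a point
  of the torus iff its weighted coefficients annihilate all polynomials of degree less than \<open>m\<close> in the
  exponents. Letting the nine points tend to infinity in the torus at different rates, the claim
  follows from a subdivision of the lattice square by successive straight cuts into nine pieces (up
  to the expected number of omitted lattice points), such that no nonzero function on a piece
  annihilates the polynomials of degree less than \<open>m\<close>; the latter is seen by covering the piece with
  lines. Lower bounds come from counting conditions and from multiplication by the quadric.\<close>

section \<open>Functions annihilating polynomials of low degree\<close>

text \<open>Both dimensions in (1) are computed, not compared by an exact sequence: for
  \<open>d = 2 * m\<close> the dimension is always 1, and for \<open>d = 2 * m + 1\<close> it is the
  sum of the positive values of q over the multiplicities up to \<open>m\<close>, which stays at 60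
  from \<open>m = 7\<close> on. Here q = (m + 1) (8 - m) / 2 is the excess of the (2 m + 2)^2
  lattice points over nine times m (m + 1) / 2, and a piece can hold at most m (m + 1) / 2 points,
  the dimension of the polynomials tested. In odd degree with 1 <= m <= 8 every piece must therefore
  be filled exactly; this is why small \<open>m\<close> needs special subdivisions, whereas for
  large \<open>m\<close> the slack grows quadratically. The induction passes through all smaller
  multiplicities at the same points, so one nine-tuple has to serve several subdivisions at once.
  Semicontinuity enters three times through the same elimination lemma: for points tending to
  infinity, along a line of tuples, and on the space of all nine-tuples.\<close>

definition annihilates :: "('a \<Rightarrow> complex) set \<Rightarrow> nat \<Rightarrow> 'a set \<Rightarrow> ('a \<Rightarrow> complex) \<Rightarrow> bool" where
  "annihilates L m S c \<longleftrightarrow>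
     (\<forall>ls. set ls \<subseteq> L \<and> length ls < m \<longrightarrow> (\<Sum>s\<in>S. c s * (\<Prod>l\<leftarrow>ls. l s)) = 0)"

lemma annihilatesD:
  "annihilates L m S c \<Longrightarrow> set ls \<subseteq> L \<Longrightarrow> length ls < m \<Longrightarrow> (\<Sum>s\<in>S. c s * (\<Prod>l\<leftarrow>ls. l s)) = 0"
  by (auto simp: annihilates_def)

lemma annihilates_mono: "annihilates L m S c \<Longrightarrow> n \<le> m \<Longrightarrow> annihilates L n S c"
  by (auto simp: annihilates_def)

lemma annihilates_mult:
  assumes "annihilates L (Suc m) S c" "l \<in> L"
  shows "annihilates L m S (\<lambda>s. l s * c s)"
  unfolding annihilates_def
proof (intro allI impI)
  fix ls assume ls: "set ls \<subseteq> L \<and> length ls < m"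
  have "(\<Sum>s\<in>S. c s * (\<Prod>l\<leftarrow>l # ls. l s)) = 0"
    by (rule annihilatesD[OF assms(1)]) (use ls assms(2) in auto)
  then show "(\<Sum>s\<in>S. l s * c s * (\<Prod>l\<leftarrow>ls. l s)) = 0"
    by (simp add: mult_ac)
qed

lemma annihilates_subset:
  assumes "finite T" "S \<subseteq> T" "\<And>s. s \<in> T - S \<Longrightarrow> c s = 0"
  shows "annihilates L m T c \<longleftrightarrow> annihilates L m S c"
proof -
  have "(\<Sum>s\<in>T. c s * (\<Prod>l\<leftarrow>ls. l s)) = (\<Sum>s\<in>S. c s * (\<Prod>l\<leftarrow>ls. l s))" for ls
    by (rule sum.mono_neutral_right) (use assms in auto)
  then show ?thesis by (simp add: annihilates_def)
qed

text \<open>Constants are included, so products of fewer than \<open>m\<close> members span the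
  polynomials of degree below \<open>m\<close> in the exponents; testing such products replaces
  testing polynomials.\<close>

definition affine2 :: "(nat \<times> nat \<Rightarrow> complex) set" where
  "affine2 = {l. \<exists>a b e. \<forall>x y. l (x, y) = a * of_nat x + b * of_nat y + e}"

lemma affine2I: "(\<And>x y. l (x, y) = a * of_nat x + b * of_nat y + e) \<Longrightarrow> l \<in> affine2"
  unfolding affine2_def by blast

definition determining :: "nat \<Rightarrow> (nat \<times> nat) set \<Rightarrow> bool" where
  "determining m S \<longleftrightarrow> (\<forall>c. annihilates affine2 m S c \<longrightarrow> (\<forall>s\<in>S. c s = 0))"

lemma determining_mono: "determining n S \<Longrightarrow> n \<le> m \<Longrightarrow> determining m S"
  using annihilates_mono unfolding determining_def by blast

text \<open>A product of lines through the other points isolates the value at \<open>s0\<close>;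
  there are at most \<open>m - 1\<close> of them, which the degree bound allows.\<close>

lemma determining_card_le:
  assumes "finite S" "card S \<le> m"
  shows "determining m S"
  unfolding determining_def
proof (intro allI impI ballI)
  fix c s0 assume c: "annihilates affine2 m S c" and s0: "s0 \<in> S"
  \<comment> \<open>Through \<open>s\<close> goes the vertical line, or the horizontal one when
    \<open>s\<close> lies in the column of \<open>s0\<close>, so that the line misses
    \<open>s0\<close>.\<close>
  define f :: "nat \<times> nat \<Rightarrow> nat \<times> nat \<Rightarrow> complex" where
    "f = (\<lambda>s. if fst s \<noteq> fst s0 then (\<lambda>z. of_nat (fst z) - of_nat (fst s))
              else (\<lambda>z. of_nat (snd z) - of_nat (snd s)))"
  obtain xs where xs: "set xs = S - {s0}" "distinct xs"
    using assms(1) finite_distinct_list[of "S - {s0}"] by auto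
  have len: "length (map f xs) < m"
  proof -
    have "length xs = card S - 1"
      using distinct_card[OF xs(2)] xs(1) s0 by (simp add: card_Diff_singleton)
    moreover have "card S > 0" using s0 assms(1) card_gt_0_iff by blast
    ultimately show ?thesis using assms(2) by simp
  qed
  have aff: "set (map f xs) \<subseteq> affine2"
  proof -
    have "f s \<in> affine2" for s
      by (cases "fst s \<noteq> fst s0")
        (auto simp: f_def intro: affine2I[where a=1 and b=0 and e="- of_nat (fst s)"]
           affine2I[where a=0 and b=1 and e="- of_nat (snd s)"])
    then show ?thesis by auto
  qed
  have zero: "(\<Prod>l\<leftarrow>map f xs. l s) = 0" if "s \<in> S - {s0}" for s
  proof -
    have "f s s = 0" by (simp add: f_def)
    then show ?thesis using that xs(1) by (force simp: prod_list_zero_iff)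
  qed
  have nz: "(\<Prod>l\<leftarrow>map f xs. l s0) \<noteq> 0"
  proof -
    have "f s s0 \<noteq> 0" if "s \<noteq> s0" for s
      using that by (cases s, cases s0) (auto simp: f_def)
    then show ?thesis using xs(1) by (force simp: prod_list_zero_iff)
  qed
  have "0 = (\<Sum>s\<in>S. c s * (\<Prod>l\<leftarrow>map f xs. l s))"
    using annihilatesD[OF c aff len] by simp
  also have "\<dots> = (\<Sum>s\<in>{s0}. c s * (\<Prod>l\<leftarrow>map f xs. l s))"
    by (rule sum.mono_neutral_right) (use assms(1) s0 zero in auto)
  finally show "c s0 = 0" using nz by simp
qed

text \<open>A Bezout-type step: multiplying by \<open>l\<close> kills the points on the line and
  costs one degree, so \<open>c\<close> vanishes off the line; the at most \<open>m + 1\<close>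
  points left on it are separated by degree \<open>m\<close>.\<close>

lemma determining_peel:
  assumes "finite S" "l \<in> affine2" "card {s \<in> S. l s = 0} \<le> Suc m" "determining m {s \<in> S. l s \<noteq> 0}"
  shows "determining (Suc m) S"
  unfolding determining_def
proof (intro allI impI)
  fix c assume c: "annihilates affine2 (Suc m) S c"
  have "annihilates affine2 m S (\<lambda>s. l s * c s)"
    by (rule annihilates_mult[OF c assms(2)])
  then have "annihilates affine2 m {s \<in> S. l s \<noteq> 0} (\<lambda>s. l s * c s)"
    by (subst (asm) annihilates_subset[where S="{s \<in> S. l s \<noteq> 0}"]) (use assms(1) in auto)
  then have off: "c s = 0" if "s \<in> S" "l s \<noteq> 0" for s
    using assms(4) that unfolding determining_def by fastforce
  have "annihilates affine2 (Suc m) {s \<in> S. l s = 0} c"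
    using c by (subst (asm) annihilates_subset[where S="{s \<in> S. l s = 0}"]) (use assms(1) off in auto)
  then have "\<forall>s\<in>{s \<in> S. l s = 0}. c s = 0"
    using determining_card_le[OF _ assms(3)] assms(1) by (auto simp: determining_def)
  then show "\<forall>s\<in>S. c s = 0" using off by blast
qed

text \<open>Parallel lines are peeled off in order of decreasing \<open>r\<close>. Nonempty fibres
  have different bounds between 1 and \<open>m\<close>, so at most one has bound \<open>m\<close>,
  and after its removal the rest satisfies the hypotheses one degree lower.\<close>

lemma determining_fibres:
  fixes h r :: "nat \<times> nat \<Rightarrow> nat"
  assumes "finite S"
    and aff: "\<And>n. (\<lambda>s. of_nat (h s) - of_nat n) \<in> affine2"
    and "\<And>s. s \<in> S \<Longrightarrow> r s \<le> m \<and> card {s' \<in> S. h s' = h s} \<le> r s"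
    and "\<And>s s'. s \<in> S \<Longrightarrow> s' \<in> S \<Longrightarrow> r s = r s' \<Longrightarrow> h s = h s'"
  shows "determining m S"
  using assms(1,3,4)
proof (induction m arbitrary: S)
  case 0
  have "S = {}"
  proof (rule ccontr)
    assume "S \<noteq> {}"
    then obtain s where s: "s \<in> S" by blast
    then have "card {s' \<in> S. h s' = h s} = 0" using 0(2)[OF s] by linarith
    then have "{s' \<in> S. h s' = h s} = {}" using 0(1) by simp
    then show False using s by blast
  qed
  then show ?case by (simp add: determining_def)
next
  case (Suc m)
  show ?case
  proof (cases "\<exists>s\<in>S. r s = Suc m")
    case True
    then obtain s0 where s0: "s0 \<in> S" "r s0 = Suc m" by blast
    let ?T = "{s \<in> S. h s \<noteq> h s0}"
    have T: "determining m ?T"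
    proof (rule Suc.IH)
      show "finite ?T" using Suc.prems(1) by simp
    next
      fix s assume s: "s \<in> ?T"
      then have "r s \<noteq> Suc m" using Suc.prems(3)[of s s0] s0 by auto
      moreover have "card {s' \<in> ?T. h s' = h s} \<le> card {s' \<in> S. h s' = h s}"
        by (rule card_mono) (use Suc.prems(1) in auto)
      ultimately show "r s \<le> m \<and> card {s' \<in> ?T. h s' = h s} \<le> r s"
        using Suc.prems(2)[of s] s by auto
    next
      fix s s' assume "s \<in> ?T" "s' \<in> ?T" "r s = r s'"
      then show "h s = h s'" using Suc.prems(3)[of s s'] by simp
    qed
    show ?thesis
    proof (rule determining_peel[OF Suc.prems(1) aff[of "h s0"]])
      show "card {s \<in> S. (of_nat (h s) :: complex) - of_nat (h s0) = 0} \<le> Suc m"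
        using Suc.prems(2)[OF s0(1)] s0(2) by simp
      show "determining m {s \<in> S. (of_nat (h s) :: complex) - of_nat (h s0) \<noteq> 0}"
        using T by simp
    qed
  next
    case False
    have "determining m S"
    proof (rule Suc.IH[OF Suc.prems(1) _ Suc.prems(3)])
      fix s assume s: "s \<in> S"
      then have "r s \<noteq> Suc m" using False by blast
      then show "r s \<le> m \<and> card {s' \<in> S. h s' = h s} \<le> r s"
        using Suc.prems(2)[OF s] by simp
    qed
    then show ?thesis by (rule determining_mono) simp
  qed
qed

text \<open>Here \<open>r\<close> bounds the row lengths from above; it is integer-valued, which
  turns its injectivity and all inequalities about it into linear arithmetic.\<close>

lemma determining_rows:
  fixes lo r :: "int \<Rightarrow> int"
  assumes "finite S"
    and row: "\<And>x y. (x, y) \<in> S \<Longrightarrow>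
      lo (int y) \<le> int x \<and> int x < lo (int y) + r (int y) \<and> r (int y) \<le> int m"
    and inj: "inj r"
  shows "determining m S"
proof (rule determining_fibres[where h = snd and r = "\<lambda>s. nat (r (int (snd s)))"])
  show "(\<lambda>s. of_nat (snd s) - of_nat n) \<in> affine2" for n
    by (rule affine2I[where a=0 and b=1 and e="- of_nat n"]) simp
  fix s assume s: "s \<in> S"
  obtain x y where xy: "s = (x, y)" by (cases s)
  have "card {s' \<in> S. snd s' = snd s} \<le> card {lo (int y)..<lo (int y) + r (int y)}"
    by (rule card_inj_on_le[where f = "\<lambda>s. int (fst s)"]) (auto simp: inj_on_def xy dest: row)
  then show "nat (r (int (snd s))) \<le> m \<and> card {s' \<in> S. snd s' = snd s} \<le> nat (r (int (snd s)))"
    using row[of x y] s xy by auto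
next
  fix s s' assume s: "s \<in> S" "s' \<in> S" and eq: "nat (r (int (snd s))) = nat (r (int (snd s')))"
  obtain x y x' y' where xy: "s = (x, y)" "s' = (x', y')" by (cases s, cases s')
  \<comment> \<open>Rows that meet \<open>S\<close> have positive \<open>r\<close>, so passing to
    \<open>nat\<close> identifies none of them.\<close>
  have "r (int y) > 0" "r (int y') > 0" using row[of x y] row[of x' y'] s xy by auto
  then have "r (int y) = r (int y')" using eq xy by simp
  then show "snd s = snd s'" using injD[OF inj] xy by force
qed (use assms(1) in auto)

lemma determining_columns:
  fixes lo r :: "int \<Rightarrow> int"
  assumes "finite S"
    and col: "\<And>x y. (x, y) \<in> S \<Longrightarrow>
      lo (int x) \<le> int y \<and> int y < lo (int x) + r (int x) \<and> r (int x) \<le> int m"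
    and inj: "inj r"
  shows "determining m S"
proof (rule determining_fibres[where h = fst and r = "\<lambda>s. nat (r (int (fst s)))"])
  show "(\<lambda>s. of_nat (fst s) - of_nat n) \<in> affine2" for n
    by (rule affine2I[where a=1 and b=0 and e="- of_nat n"]) simp
  fix s assume s: "s \<in> S"
  obtain x y where xy: "s = (x, y)" by (cases s)
  have "card {s' \<in> S. fst s' = fst s} \<le> card {lo (int x)..<lo (int x) + r (int x)}"
    by (rule card_inj_on_le[where f = "\<lambda>s. int (snd s)"]) (auto simp: inj_on_def xy dest: col)
  then show "nat (r (int (fst s))) \<le> m \<and> card {s' \<in> S. fst s' = fst s} \<le> nat (r (int (fst s)))"
    using col[of x y] s xy by auto
next
  fix s s' assume s: "s \<in> S" "s' \<in> S" and eq: "nat (r (int (fst s))) = nat (r (int (fst s')))"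
  obtain x y x' y' where xy: "s = (x, y)" "s' = (x', y')" by (cases s, cases s')
  have "r (int x) > 0" "r (int x') > 0" using col[of x y] col[of x' y'] s xy by auto
  then have "r (int x) = r (int x')" using eq xy by simp
  then show "fst s = fst s'" using injD[OF inj] xy by force
qed (use assms(1) in auto)

text \<open>Half-planes are cut off one at a time, each only from what the earlier cuts left; this
  order lets the points be sent to infinity one after the other.\<close>

fun tileable :: "nat \<Rightarrow> nat \<Rightarrow> (nat \<times> nat) set \<Rightarrow> bool" where
  "tileable m 0 S \<longleftrightarrow> S = {}"
| "tileable m (Suc n) S \<longleftrightarrow> (\<exists>a b k :: int.
     determining m {(x, y). (x, y) \<in> S \<and> a * int x + b * int y < k} \<and>
     tileable m n {(x, y). (x, y) \<in> S \<and> a * int x + b * int y \<ge> k})"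

lemma tileable_cut:
  assumes "determining m {(x, y). (x, y) \<in> S \<and> a * int x + b * int y < k}"
    and "tileable m n {(x, y). (x, y) \<in> S \<and> a * int x + b * int y \<ge> k}"
  shows "tileable m (Suc n) S"
  using assms by auto

lemma tileable_last: "determining m S \<Longrightarrow> tileable m (Suc 0) S"
  by (simp only: tileable.simps, intro exI[of _ 0] exI[of _ 1]) simp

text \<open>Lattice points on a cutting line can be shared out between its two sides: on a finite
  set, a lexicographic comparison by two functionals is a comparison by a single one, in which the
  first is scaled by a large \<open>K\<close>.\<close>

lemma tileable_lex_cut:
  fixes a b a' b' k k' :: int
  assumes "finite S"
    and "determining m {(x, y). (x, y) \<in> S \<and> (a * int x + b * int y < k \<or>
           a * int x + b * int y = k \<and> a' * int x + b' * int y < k')}"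
    and "tileable m n {(x, y). (x, y) \<in> S \<and> \<not> (a * int x + b * int y < k \<or>
           a * int x + b * int y = k \<and> a' * int x + b' * int y < k')}"
  shows "tileable m (Suc n) S"
proof -
  define f where "f = (\<lambda>(x, y). \<bar>a' * int x + b' * int y - k'\<bar>)"
  \<comment> \<open>\<open>K\<close> exceeds every absolute value of the tie-breaking term on
    \<open>S\<close>, so one integral step of the first functional outweighs it.\<close>
  define K where "K = 1 + (\<Sum>s\<in>S. f s)"
  have K: "f s < K" if "s \<in> S" for s
    using member_le_sum[of s S f] that assms(1) by (auto simp: K_def f_def split: prod.splits)
  have iff: "(K * a + a') * int x + (K * b + b') * int y < K * k + k' \<longleftrightarrow>
      a * int x + b * int y < k \<or> a * int x + b * int y = k \<and> a' * int x + b' * int y < k'"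
    if "(x, y) \<in> S" for x y
  proof -
    define d e where "d = a * int x + b * int y - k" and "e = a' * int x + b' * int y - k'"
    have "\<bar>e\<bar> < K" using K[OF that] by (simp add: f_def e_def)
    then have "K * d + e < 0 \<longleftrightarrow> d < 0 \<or> d = 0 \<and> e < 0"
    proof -
      have "K * d \<le> K * (-1)" if "d < 0"
        by (rule mult_left_mono) (use that \<open>\<bar>e\<bar> < K\<close> in auto)
      moreover have "K * d \<ge> K * 1" if "d > 0"
        by (rule mult_left_mono) (use that \<open>\<bar>e\<bar> < K\<close> in auto)
      ultimately show ?thesis using \<open>\<bar>e\<bar> < K\<close>
        by (cases d "0::int" rule: linorder_cases) auto
    qed
    moreover have "(K * a + a') * int x + (K * b + b') * int y - (K * k + k') = K * d + e"
      by (simp add: d_def e_def algebra_simps)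
    ultimately show ?thesis by (auto simp: d_def e_def)
  qed
  show ?thesis
  proof (rule tileable_cut[where a = "K * a + a'" and b = "K * b + b'" and k = "K * k + k'"])
    have "{(x, y). (x, y) \<in> S \<and> (K * a + a') * int x + (K * b + b') * int y < K * k + k'} =
       {(x, y). (x, y) \<in> S \<and> (a * int x + b * int y < k \<or>
           a * int x + b * int y = k \<and> a' * int x + b' * int y < k')}"
      using iff by blast
    then show "determining m {(x, y). (x, y) \<in> S \<and> (K * a + a') * int x + (K * b + b') * int y < K * k + k'}"
      using assms(2) by (simp only:)
    have "{(x, y). (x, y) \<in> S \<and> (K * a + a') * int x + (K * b + b') * int y \<ge> K * k + k'} =
       {(x, y). (x, y) \<in> S \<and> \<not> (a * int x + b * int y < k \<or>
           a * int x + b * int y = k \<and> a' * int x + b' * int y < k')}"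
      using iff linorder_not_less by blast
    then show "tileable m n {(x, y). (x, y) \<in> S \<and> (K * a + a') * int x + (K * b + b') * int y \<ge> K * k + k'}"
      using assms(3) by (simp only:)
  qed
qed

text \<open>Upper semicontinuity of the solution space by Gaussian elimination: the pivot column is cleared
  without division, so the entries stay in the graded class \<open>C\<close>, and each row stays homogeneous.\<close>

lemma injective_open:
  fixes C :: "'e::ab_semigroup_add \<Rightarrow> ('p \<Rightarrow> complex) set" and M :: "'r \<Rightarrow> 's \<Rightarrow> 'p \<Rightarrow> complex"
  assumes "finite S"
    and mult: "\<And>e e' f g. f \<in> C e \<Longrightarrow> g \<in> C e' \<Longrightarrow> (\<lambda>p. f p * g p) \<in> C (e + e')"
    and diff: "\<And>e f g. f \<in> C e \<Longrightarrow> g \<in> C e \<Longrightarrow> (\<lambda>p. f p - g p) \<in> C e"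
    and one: "(\<lambda>p. 1) \<in> C deg_one"
    and "\<And>r s. r \<in> R \<Longrightarrow> s \<in> S \<Longrightarrow> M r s \<in> C (deg r)"
    and "\<And>f. (\<And>r. r \<in> R \<Longrightarrow> (\<Sum>s\<in>S. M r s p0 * f s) = 0) \<Longrightarrow> \<forall>s\<in>S. f s = 0"
  shows "\<exists>e. \<exists>G\<in>C e. G p0 \<noteq> 0 \<and> (\<forall>p f. G p \<noteq> 0 \<longrightarrow>
     (\<forall>r\<in>R. (\<Sum>s\<in>S. M r s p * f s) = 0) \<longrightarrow> (\<forall>s\<in>S. f s = 0))"
  using assms(1,5,6)
proof (induction S arbitrary: M deg rule: finite_induct)
  case empty
  show ?case by (rule exI[of _ deg_one], rule bexI[OF _ one]) simp
next
  case (insert s0 S)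
  \<comment> \<open>Otherwise the unit vector at \<open>s0\<close> would lie in the kernel at
    \<open>p0\<close>.\<close>
  have "\<exists>r0\<in>R. M r0 s0 p0 \<noteq> 0"
  proof (rule ccontr)
    assume "\<not> (\<exists>r0\<in>R. M r0 s0 p0 \<noteq> 0)"
    then have z: "M r s0 p0 = 0" if "r \<in> R" for r using that by blast
    have "(\<Sum>s\<in>insert s0 S. M r s p0 * (if s = s0 then 1 else 0)) = 0" if "r \<in> R" for r
      using z[OF that] insert.hyps by (auto intro!: sum.neutral)
    from insert.prems(2)[OF this] show False by auto
  qed
  then obtain r0 where r0: "r0 \<in> R" "M r0 s0 p0 \<noteq> 0" by blast
  define M' where "M' = (\<lambda>r s p. M r0 s0 p * M r s p - M r s0 p * M r0 s p)"
  have sum_M': "(\<Sum>s\<in>S. M' r s p * f s) =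
      M r0 s0 p * (\<Sum>s\<in>S. M r s p * f s) - M r s0 p * (\<Sum>s\<in>S. M r0 s p * f s)" for r p f
    by (simp add: M'_def sum_distrib_left sum_subtractf[symmetric] algebra_simps)
  have "\<exists>e. \<exists>G\<in>C e. G p0 \<noteq> 0 \<and> (\<forall>p f. G p \<noteq> 0 \<longrightarrow>
     (\<forall>r\<in>R. (\<Sum>s\<in>S. M' r s p * f s) = 0) \<longrightarrow> (\<forall>s\<in>S. f s = 0))"
  proof (rule insert.IH)
    fix r s assume rs: "r \<in> R" "s \<in> S"
    have "(\<lambda>p. M r s0 p * M r0 s p) \<in> C (deg r0 + deg r)"
      using mult[OF insert.prems(1)[OF rs(1), of s0] insert.prems(1)[OF r0(1), of s]] rs
      by (simp add: add.commute)
    with mult[OF insert.prems(1)[OF r0(1), of s0] insert.prems(1)[OF rs(1), of s]] rs(2)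
    show "M' r s \<in> C (deg r0 + deg r)"
      unfolding M'_def by (intro diff) simp_all
  next
    fix f assume f: "\<And>r. r \<in> R \<Longrightarrow> (\<Sum>s\<in>S. M' r s p0 * f s) = 0"
    \<comment> \<open>Extends \<open>f\<close> by the value at \<open>s0\<close> that solves the
      pivot row, so that injectivity on \<open>insert s0 S\<close> applies.\<close>
    define f' where "f' = f(s0 := - (\<Sum>s\<in>S. M r0 s p0 * f s) / M r0 s0 p0)"
    have f': "(\<Sum>s\<in>S. M r s p0 * f' s) = (\<Sum>s\<in>S. M r s p0 * f s)" for r
      by (rule sum.cong) (use insert.hyps in \<open>auto simp: f'_def\<close>)
    have "\<forall>s\<in>insert s0 S. f' s = 0"
    proof (rule insert.prems(2))
      fix r assume "r \<in> R"
      from f[OF this] have e: "M r0 s0 p0 * (\<Sum>s\<in>S. M r s p0 * f s) = M r s0 p0 * (\<Sum>s\<in>S. M r0 s p0 * f s)"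
        by (simp add: sum_M')
      have "(\<Sum>s\<in>insert s0 S. M r s p0 * f' s) = M r s0 p0 * f' s0 + (\<Sum>s\<in>S. M r s p0 * f s)"
        by (subst sum.insert[OF insert.hyps(1,2)]) (simp only: f')
      also have "\<dots> = 0" using e r0(2) unfolding f'_def by (simp add: field_simps)
      finally show "(\<Sum>s\<in>insert s0 S. M r s p0 * f' s) = 0" .
    qed
    then show "\<forall>s\<in>S. f s = 0" using insert.hyps(2) by (metis f'_def fun_upd_other insertCI)
  qed
  then obtain e G where G: "G \<in> C e" "G p0 \<noteq> 0"
    "\<And>p f. G p \<noteq> 0 \<Longrightarrow> (\<forall>r\<in>R. (\<Sum>s\<in>S. M' r s p * f s) = 0) \<Longrightarrow> \<forall>s\<in>S. f s = 0" by blast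
  \<comment> \<open>The witness is the product of the pivots; wherever it is nonzero the same
    elimination can be carried out.\<close>
  have "(\<lambda>p. M r0 s0 p * G p) \<in> C (deg r0 + e)"
    by (rule mult[OF insert.prems(1)[OF r0(1)] G(1)]) simp
  moreover have "\<forall>s\<in>insert s0 S. f s = 0"
    if nz: "M r0 s0 p * G p \<noteq> 0" and f: "\<forall>r\<in>R. (\<Sum>s\<in>insert s0 S. M r s p * f s) = 0" for p f
  proof -
    have eq: "(\<Sum>s\<in>S. M r s p * f s) = - (M r s0 p * f s0)" if "r \<in> R" for r
      using f[rule_format, OF that] insert.hyps(1,2) by (simp add: eq_neg_iff_add_eq_0 add.commute)
    have "\<forall>s\<in>S. f s = 0"
    proof (rule G(3)[of p])
      show "G p \<noteq> 0" using nz by simp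
      show "\<forall>r\<in>R. (\<Sum>s\<in>S. M' r s p * f s) = 0"
        using eq r0(1) by (simp add: sum_M')
    qed
    moreover from this have "f s0 = 0" using eq[OF r0(1)] nz by simp
    ultimately show ?thesis by blast
  qed
  moreover have "M r0 s0 p0 * G p0 \<noteq> 0" using r0(2) G(2) by simp
  ultimately show ?case by (intro exI[of _ "deg r0 + e"] bexI[of _ "\<lambda>p. M r0 s0 p * G p"] conjI allI impI) assumption+
qed

section \<open>Independent conditions imposed by points of the torus\<close>

definition torus_weight :: "complex \<times> complex \<Rightarrow> nat \<times> nat \<Rightarrow> complex" where
  "torus_weight q s = fst q ^ fst s * snd q ^ snd s"

text \<open>For points with nonzero coordinates this says that zero is the only polynomial with
  exponents in \<open>S\<close> that has multiplicity at least \<open>m\<close> at every point of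
  \<open>Z\<close>.\<close>

definition imposes_independent :: "nat \<Rightarrow> (complex \<times> complex) set \<Rightarrow> (nat \<times> nat) set \<Rightarrow> bool" where
  "imposes_independent m Z S \<longleftrightarrow>
     (\<forall>f. (\<forall>q\<in>Z. annihilates affine2 m S (\<lambda>s. f s * torus_weight q s)) \<longrightarrow> (\<forall>s\<in>S. f s = 0))"

lemma tendsto_exp_neg_mult:
  assumes "h > 0"
  shows "((\<lambda>\<tau>. complex_of_real (exp (- (\<tau> * h))) * g) \<longlongrightarrow> 0) at_top"
proof -
  have "filterlim (\<lambda>\<tau>. h * \<tau>) at_top at_top"
    by (rule filterlim_tendsto_pos_mult_at_top[OF tendsto_const assms filterlim_ident])
  then have "((\<lambda>\<tau>. exp (- (\<tau> * h))) \<longlongrightarrow> 0) at_top"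
    using filterlim_compose[OF exp_at_bot filterlim_compose[OF filterlim_uminus_at_bot_at_top]]
    by (simp add: mult.commute)
  then have "((\<lambda>\<tau>. complex_of_real (exp (- (\<tau> * h))) * g) \<longlongrightarrow> complex_of_real 0 * g) at_top"
    by (intro tendsto_intros)
  then show ?thesis by simp
qed

text \<open>As \<open>\<tau> \<rightarrow> \<infinity>\<close> the point \<open>(exp (- \<tau> a), exp (- \<tau> b))\<close> only sees the monomials on its side of the
  cutting line, while the other points only see the remaining ones.\<close>

lemma tileable_imposes_independent:
  assumes "finite S" "tileable m n S"
  shows "\<exists>qs. length qs = n \<and> imposes_independent m (set qs) S"
  using assms
proof (induction n arbitrary: S)
  case 0
  then show ?case by (auto simp: imposes_independent_def)
next
  case (Suc n)
  then obtain a b k :: int where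
    S1: "determining m {(x, y). (x, y) \<in> S \<and> a * int x + b * int y < k}" and
    S2: "tileable m n {(x, y). (x, y) \<in> S \<and> a * int x + b * int y \<ge> k}" by auto
  \<comment> \<open>The shift by 1/2 keeps all lattice points off the cut, so every exponential rate
    below is strictly positive or strictly negative.\<close>
  define h :: "nat \<times> nat \<Rightarrow> real" where
    "h = (\<lambda>(x, y). of_int (a * int x + b * int y - k) + 1 / 2)"
  define A B where "A = {s \<in> S. h s < 0}" and "B = {s \<in> S. h s > 0}"
  have hneg: "h (x, y) < 0 \<longleftrightarrow> a * int x + b * int y < k"
    and hpos: "h (x, y) > 0 \<longleftrightarrow> a * int x + b * int y \<ge> k" for x y
  proof -
    define e where "e = a * int x + b * int y - k"
    have "real_of_int e + 1 / 2 < 0 \<longleftrightarrow> e < 0" "0 < real_of_int e + 1 / 2 \<longleftrightarrow> 0 \<le> e" by linarith+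
    then show "h (x, y) < 0 \<longleftrightarrow> a * int x + b * int y < k" "h (x, y) > 0 \<longleftrightarrow> a * int x + b * int y \<ge> k"
      unfolding h_def e_def by auto
  qed
  have AB: "determining m A" "tileable m n B"
  proof -
    have "A = {(x, y). (x, y) \<in> S \<and> a * int x + b * int y < k}"
      "B = {(x, y). (x, y) \<in> S \<and> a * int x + b * int y \<ge> k}"
      unfolding A_def B_def using hneg hpos by auto
    then show "determining m A" "tileable m n B" using S1 S2 by simp_all
  qed
  have h0: "h s \<noteq> 0" for s
    using hneg[of "fst s" "snd s"] hpos[of "fst s" "snd s"] by force
  then have SAB: "S = A \<union> B" "A \<inter> B = {}"
    unfolding A_def B_def using linorder_neqE_linordered_idom by fastforce+
  have notA: "h s > 0" if "s \<in> S" "s \<notin> A" for s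
    using that h0[of s] unfolding A_def by auto
  have notB: "h s < 0" if "s \<in> S" "s \<notin> B" for s
    using that h0[of s] unfolding B_def by auto
  have fin: "finite A" "finite B" using Suc.prems(1) by (auto simp: A_def B_def)
  obtain qs where qs: "length qs = n" "imposes_independent m (set qs) B"
    using Suc.IH[OF fin(2) AB(2)] by blast
  define R :: "((complex \<times> complex) option \<times> (nat \<times> nat \<Rightarrow> complex) list) set" where
    "R = {(r, ls). set ls \<subseteq> affine2 \<and> length ls < m \<and> (\<forall>q. r = Some q \<longrightarrow> q \<in> set qs)}"
  \<comment> \<open>The conditions at the new and the old points after rescaling: the rows of the
    new point by a common factor, the columns in \<open>A\<close> by
    \<open>exp (\<tau> * h s)\<close>. All entries then converge, and the limit matrix is block
    diagonal with blocks for \<open>A\<close> and \<open>B\<close>.\<close>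
  define M :: "(complex \<times> complex) option \<times> (nat \<times> nat \<Rightarrow> complex) list \<Rightarrow> nat \<times> nat \<Rightarrow> real option \<Rightarrow> complex" where
    "M = (\<lambda>(r, ls) s p. (\<Prod>l\<leftarrow>ls. l s) * (case r of
      None \<Rightarrow> if s \<in> A then 1 else (case p of None \<Rightarrow> 0 | Some \<tau> \<Rightarrow> complex_of_real (exp (- (\<tau> * h s))))
    | Some q \<Rightarrow> torus_weight q s *
       (if s \<in> B then 1 else (case p of None \<Rightarrow> 0 | Some \<tau> \<Rightarrow> complex_of_real (exp (\<tau> * h s))))))"
  \<comment> \<open>\<open>None\<close> stands for \<tau> = infinity; the class consists of the
    functions that are continuous there.\<close>
  define C :: "nat \<Rightarrow> (real option \<Rightarrow> complex) set" where
    "C = (\<lambda>_. {F. ((\<lambda>\<tau>. F (Some \<tau>)) \<longlongrightarrow> F None) at_top})"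
  have "\<exists>e. \<exists>G\<in>C e. G None \<noteq> 0 \<and> (\<forall>p f. G p \<noteq> 0 \<longrightarrow>
     (\<forall>r\<in>R. (\<Sum>s\<in>S. M r s p * f s) = 0) \<longrightarrow> (\<forall>s\<in>S. f s = 0))"
  proof (rule injective_open[where C = C and M = M and deg = "\<lambda>_. 0" and deg_one = 0, OF Suc.prems(1)])
    fix r s assume rs: "r \<in> R" "s \<in> S"
    obtain q ls where r: "r = (q, ls)" by (cases r)
    show "M r s \<in> C 0"
    proof (cases q)
      case None
      show ?thesis
      proof (cases "s \<in> A")
        case False
        have "h s > 0" using notA[OF rs(2) False] .
        from tendsto_exp_neg_mult[OF this, of "\<Prod>l\<leftarrow>ls. l s"]
        show ?thesis by (simp add: C_def M_def r None False mult.commute)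
      qed (simp add: C_def M_def r None)
    next
      case (Some q')
      show ?thesis
      proof (cases "s \<in> B")
        case False
        have "- h s > 0" using notB[OF rs(2) False] by simp
        from tendsto_exp_neg_mult[OF this, of "(\<Prod>l\<leftarrow>ls. l s) * torus_weight q' s"]
        show ?thesis by (simp add: C_def M_def r Some False mult_ac)
      qed (simp add: C_def M_def r Some)
    qed
  next
    fix f assume f: "\<And>r. r \<in> R \<Longrightarrow> (\<Sum>s\<in>S. M r s None * f s) = 0"
    have "annihilates affine2 m A f"
      unfolding annihilates_def
    proof (intro allI impI)
      fix ls assume ls: "set ls \<subseteq> affine2 \<and> length ls < m"
      have "(\<Sum>s\<in>S. M (None, ls) s None * f s) = (\<Sum>s\<in>A. f s * (\<Prod>l\<leftarrow>ls. l s))"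
        by (rule sum.mono_neutral_cong_right) (use Suc.prems(1) in \<open>auto simp: M_def A_def\<close>)
      then show "(\<Sum>s\<in>A. f s * (\<Prod>l\<leftarrow>ls. l s)) = 0"
        using f[of "(None, ls)"] ls by (simp add: R_def)
    qed
    then have 1: "\<forall>s\<in>A. f s = 0" using AB(1) by (simp add: determining_def)
    have "annihilates affine2 m B (\<lambda>s. f s * torus_weight q s)" if q: "q \<in> set qs" for q
      unfolding annihilates_def
    proof (intro allI impI)
      fix ls assume ls: "set ls \<subseteq> affine2 \<and> length ls < m"
      have "(\<Sum>s\<in>S. M (Some q, ls) s None * f s) = (\<Sum>s\<in>B. f s * torus_weight q s * (\<Prod>l\<leftarrow>ls. l s))"
        by (rule sum.mono_neutral_cong_right) (use Suc.prems(1) in \<open>auto simp: M_def B_def\<close>)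
      moreover have "(Some q, ls) \<in> R" using ls q unfolding R_def by blast
      ultimately show "(\<Sum>s\<in>B. f s * torus_weight q s * (\<Prod>l\<leftarrow>ls. l s)) = 0"
        using f by metis
    qed
    then have "\<forall>s\<in>B. f s = 0" using qs(2) by (simp add: imposes_independent_def)
    with 1 show "\<forall>s\<in>S. f s = 0" using SAB by blast
  qed (auto simp: C_def intro: tendsto_mult tendsto_diff)
  then obtain e G where "G \<in> C e" "G None \<noteq> 0"
    and G3: "\<And>p f. G p \<noteq> 0 \<Longrightarrow> \<forall>r\<in>R. (\<Sum>s\<in>S. M r s p * f s) = 0 \<Longrightarrow> \<forall>s\<in>S. f s = 0"
    by blast
  then have G: "((\<lambda>\<tau>. G (Some \<tau>)) \<longlongrightarrow> G None) at_top" "G None \<noteq> 0"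
    by (simp_all add: C_def)
  have "eventually (\<lambda>\<tau>. G (Some \<tau>) \<noteq> 0) at_top"
    using tendsto_imp_eventually_ne[OF G(1,2)] .
  then obtain \<tau> :: real where \<tau>: "G (Some \<tau>) \<noteq> 0"
    using eventually_happens'[OF trivial_limit_at_top_linorder] by blast
  define q0 where "q0 = (complex_of_real (exp (- (\<tau> * a))), complex_of_real (exp (- (\<tau> * b))))"
  \<comment> \<open>Up to a factor independent of \<open>s\<close>, the weights at \<open>q0\<close>
    are the exponentials of \<open>h\<close>.\<close>
  have wt: "torus_weight q0 s * complex_of_real (exp (\<tau> * (k - 1 / 2))) = complex_of_real (exp (- (\<tau> * h s)))" for s
  proof -
    obtain x y where s: "s = (x, y)" by (cases s)
    have "exp (- (\<tau> * a)) ^ x * exp (- (\<tau> * b)) ^ y * exp (\<tau> * (k - 1 / 2)) = exp (- (\<tau> * h s))"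
      unfolding exp_of_nat_mult[symmetric] exp_add[symmetric] s h_def by (simp add: algebra_simps)
    then show ?thesis
      unfolding torus_weight_def q0_def s
      by (simp only: of_real_power[symmetric] of_real_mult[symmetric] fst_conv snd_conv)
  qed
  have "imposes_independent m (set (q0 # qs)) S"
    unfolding imposes_independent_def
  proof (intro allI impI)
    fix f assume f: "\<forall>q\<in>set (q0 # qs). annihilates affine2 m S (\<lambda>s. f s * torus_weight q s)"
    \<comment> \<open>Compensates the rescaling of the columns in \<open>A\<close>.\<close>
    define f' where "f' = (\<lambda>s. if s \<in> A then f s * complex_of_real (exp (- (\<tau> * h s))) else f s)"
    have "\<forall>s\<in>S. f' s = 0"
    proof (rule G3[OF \<tau>], rule ballI)
      fix r assume r: "r \<in> R"
      obtain q ls where rq: "r = (q, ls)" by (cases r)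
      have ls: "set ls \<subseteq> affine2" "length ls < m" using r rq by (auto simp: R_def)
      show "(\<Sum>s\<in>S. M r s (Some \<tau>) * f' s) = 0"
      proof (cases q)
        case None
        have "(\<Sum>s\<in>S. M r s (Some \<tau>) * f' s) =
          (\<Sum>s\<in>S. f s * torus_weight q0 s * (\<Prod>l\<leftarrow>ls. l s) * complex_of_real (exp (\<tau> * (k - 1 / 2))))"
          by (rule sum.cong) (auto simp: M_def rq None f'_def wt[symmetric] mult_ac)
        also have "\<dots> = 0"
          using annihilatesD[OF _ ls, of S "\<lambda>s. f s * torus_weight q0 s"] f
          by (simp add: sum_distrib_right[symmetric])
        finally show ?thesis .
      next
        case (Some q')
        have "(\<Sum>s\<in>S. M r s (Some \<tau>) * f' s) = (\<Sum>s\<in>S. f s * torus_weight q' s * (\<Prod>l\<leftarrow>ls. l s))"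
        proof (rule sum.cong)
          fix s assume "s \<in> S"
          show "M r s (Some \<tau>) * f' s = f s * torus_weight q' s * (\<Prod>l\<leftarrow>ls. l s)"
          proof (cases "s \<in> A")
            case True
            then have "s \<notin> B" using SAB by blast
            then show ?thesis using True
              by (simp add: M_def rq Some f'_def exp_minus field_simps)
          next
            case False
            then have "s \<in> B" using SAB \<open>s \<in> S\<close> by blast
            then show ?thesis using False by (simp add: M_def rq Some f'_def mult_ac)
          qed
        qed simp
        also have "\<dots> = 0"
        proof (rule annihilatesD[OF _ ls])
          have "q' \<in> set qs" using r rq Some unfolding R_def by blast
          then show "annihilates affine2 m S (\<lambda>s. f s * torus_weight q' s)" using f by (metis list.set_intros(2))
        qed
        finally show ?thesis .
      qed
    qed
    then show "\<forall>s\<in>S. f s = 0" by (auto simp: f'_def split: if_splits)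
  qed
  then show ?case using qs(1) by (intro exI[of _ "q0 # qs"]) simp
qed

section \<open>One tuple of points for finitely many exponent sets\<close>

definition line_through :: "('i \<Rightarrow> complex \<times> complex) \<Rightarrow> ('i \<Rightarrow> complex \<times> complex) \<Rightarrow> complex \<Rightarrow> 'i \<Rightarrow> complex \<times> complex" where
  "line_through P P' t = (\<lambda>i. (fst (P i) + t * (fst (P' i) - fst (P i)), snd (P i) + t * (snd (P' i) - snd (P i))))"

lemma line_through_swap: "line_through P P' t = line_through P' P (1 - t)"
  by (rule ext) (simp add: line_through_def algebra_simps)

text \<open>Along the line the conditions are polynomial in \<open>t\<close>; elimination yields one
  polynomial, nonzero at \<open>t = 0\<close>, and independence persists away from its
  roots.\<close>

lemma finite_dependent_on_line:
  fixes P P' :: "'i \<Rightarrow> complex \<times> complex"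
  assumes "finite S" "imposes_independent m (range P) S"
  shows "finite {t. \<not> imposes_independent m (range (line_through P P' t)) S}"
proof -
  define R :: "('i \<times> (nat \<times> nat \<Rightarrow> complex) list) set" where
    "R = {(i, ls). set ls \<subseteq> affine2 \<and> length ls < m}"
  define M :: "'i \<times> (nat \<times> nat \<Rightarrow> complex) list \<Rightarrow> nat \<times> nat \<Rightarrow> complex \<Rightarrow> complex" where
    "M = (\<lambda>(i, ls) s t. torus_weight (line_through P P' t i) s * (\<Prod>l\<leftarrow>ls. l s))"
  have M: "(\<forall>r\<in>R. (\<Sum>s\<in>S. M r s t * f s) = 0) \<longleftrightarrow>
      (\<forall>q\<in>range (line_through P P' t). annihilates affine2 m S (\<lambda>s. f s * torus_weight q s))" for f t
    by (auto simp: R_def M_def annihilates_def mult_ac)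
  define C :: "nat \<Rightarrow> (complex \<Rightarrow> complex) set" where "C = (\<lambda>_. range poly)"
  have "\<exists>e. \<exists>G\<in>C e. G 0 \<noteq> 0 \<and> (\<forall>p f. G p \<noteq> 0 \<longrightarrow>
     (\<forall>r\<in>R. (\<Sum>s\<in>S. M r s p * f s) = 0) \<longrightarrow> (\<forall>s\<in>S. f s = 0))"
  proof (rule injective_open[where C = C and M = M and deg = "\<lambda>_. 0" and deg_one = 0, OF assms(1)])
    fix f g :: "complex \<Rightarrow> complex" and e e' :: nat assume "f \<in> C e" "g \<in> C e'"
    then obtain p q where "f = poly p" "g = poly q" by (auto simp: C_def)
    then have "(\<lambda>t. f t * g t) = poly (p * q)" by auto
    then show "(\<lambda>t. f t * g t) \<in> C (e + e')" by (auto simp: C_def)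
  next
    fix f g :: "complex \<Rightarrow> complex" and e :: nat assume "f \<in> C e" "g \<in> C e"
    then obtain p q where "f = poly p" "g = poly q" by (auto simp: C_def)
    then have "(\<lambda>t. f t - g t) = poly (p - q)" by auto
    then show "(\<lambda>t. f t - g t) \<in> C e" by (auto simp: C_def)
  next
    have "(\<lambda>t. 1) = poly (1 :: complex poly)" by auto
    then show "(\<lambda>t. 1) \<in> C 0" by (auto simp: C_def)
  next
    fix r :: "'i \<times> (nat \<times> nat \<Rightarrow> complex) list" and s
    obtain i ls where r: "r = (i, ls)" by (cases r)
    have "M r s = poly ([:fst (P i), fst (P' i) - fst (P i):] ^ fst s *
        [:snd (P i), snd (P' i) - snd (P i):] ^ snd s * [:\<Prod>l\<leftarrow>ls. l s:])"
      by (rule ext) (simp add: M_def r torus_weight_def line_through_def)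
    then show "M r s \<in> C 0" by (auto simp: C_def)
  next
    fix f assume "\<And>r. r \<in> R \<Longrightarrow> (\<Sum>s\<in>S. M r s 0 * f s) = 0"
    then have "\<forall>q\<in>range (line_through P P' 0). annihilates affine2 m S (\<lambda>s. f s * torus_weight q s)"
      using M[of 0 f] by blast
    then show "\<forall>s\<in>S. f s = 0"
      using assms(2) by (simp add: imposes_independent_def line_through_def)
  qed
  then obtain p where p: "poly p 0 \<noteq> 0" and
    *: "\<And>t f. poly p t \<noteq> 0 \<Longrightarrow> \<forall>r\<in>R. (\<Sum>s\<in>S. M r s t * f s) = 0 \<Longrightarrow> \<forall>s\<in>S. f s = 0"
    unfolding C_def by blast
  have "imposes_independent m (range (line_through P P' t)) S" if "poly p t \<noteq> 0" for t
    unfolding imposes_independent_def using *[OF that] M[of t] by blast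
  then have "{t. \<not> imposes_independent m (range (line_through P P' t)) S} \<subseteq> {t. poly p t = 0}" by blast
  moreover have "p \<noteq> 0" using p by auto
  ultimately show ?thesis using poly_roots_finite finite_subset by blast
qed

text \<open>On the line joining a tuple good for \<open>J\<close> to one good for \<open>j\<close>,
  each of the finitely many requirements excludes only finitely many parameters. Nonvanishing
  coordinates are included because division by the quadric will need them.\<close>

lemma common_independent_points:
  fixes m :: "'j \<Rightarrow> nat" and S :: "'j \<Rightarrow> (nat \<times> nat) set"
  assumes "finite J" "\<And>j. j \<in> J \<Longrightarrow> finite (S j)"
    and "\<And>j. j \<in> J \<Longrightarrow> \<exists>P :: 'i::finite \<Rightarrow> complex \<times> complex. imposes_independent (m j) (range P) (S j)"
  shows "\<exists>P :: 'i \<Rightarrow> complex \<times> complex. (\<forall>i. fst (P i) \<noteq> 0 \<and> snd (P i) \<noteq> 0) \<and>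
    (\<forall>j\<in>J. imposes_independent (m j) (range P) (S j))"
  using assms
proof (induction J rule: finite_induct)
  case empty
  show ?case by (rule exI[of _ "\<lambda>_. (1, 1)"]) simp
next
  case (insert j J)
  obtain P :: "'i \<Rightarrow> complex \<times> complex" where P: "\<And>i. fst (P i) \<noteq> 0" "\<And>i. snd (P i) \<noteq> 0"
    "\<And>j. j \<in> J \<Longrightarrow> imposes_independent (m j) (range P) (S j)"
    using insert.IH insert.prems by (metis insertCI)
  obtain P' :: "'i \<Rightarrow> complex \<times> complex" where P': "imposes_independent (m j) (range P') (S j)"
    using insert.prems(2) by blast
  let ?L = "line_through P P'"
  define Bad where "Bad = (\<Union>i. {t. fst (?L t i) = 0}) \<union> (\<Union>i. {t. snd (?L t i) = 0}) \<union>
    (\<Union>j\<in>J. {t. \<not> imposes_independent (m j) (range (?L t)) (S j)}) \<union>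
    {t. \<not> imposes_independent (m j) (range (?L t)) (S j)}"
  have lin: "finite {t. a + t * b = 0}" if "a \<noteq> 0" for a b :: complex
  proof (rule finite_subset)
    show "{t. a + t * b = 0} \<subseteq> {- a / b}"
      using that by (auto simp: eq_neg_iff_add_eq_0[symmetric] field_simps)
  qed simp
  \<comment> \<open>The line is read from its other end, where the tuple good for \<open>j\<close>
    sits at parameter 0.\<close>
  have swap: "finite {t. \<not> imposes_independent (m j) (range (?L t)) (S j)}"
  proof -
    have "{t. \<not> imposes_independent (m j) (range (?L t)) (S j)} =
       (\<lambda>t. 1 - t) -` {t. \<not> imposes_independent (m j) (range (line_through P' P t)) (S j)}"
      by (auto simp: line_through_swap[of P P'])
    moreover have "finite \<dots>"
      by (rule finite_vimageI[OF finite_dependent_on_line[OF _ P']])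
        (use insert.prems(1) in \<open>auto simp: inj_on_def\<close>)
    ultimately show ?thesis by simp
  qed
  have "finite Bad"
    unfolding Bad_def
  proof (intro finite_UnI finite_UN_I)
    show "finite {t. fst (?L t i) = 0}" "finite {t. snd (?L t i) = 0}" for i
      using lin P(1,2) by (simp_all add: line_through_def)
    show "finite {t. \<not> imposes_independent (m j') (range (?L t)) (S j')}" if "j' \<in> J" for j'
      by (rule finite_dependent_on_line[OF _ P(3)[OF that]]) (use insert.prems(1) that in auto)
  qed (use insert.hyps swap in auto)
  then obtain t where "t \<notin> Bad"
    using ex_new_if_finite[OF infinite_UNIV_char_0] by blast
  then show ?case by (intro exI[of _ "?L t"]) (auto simp: Bad_def)
qed

lemma tileable_imposes_independent_nine:
  assumes "finite S" "tileable m 9 S"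
  shows "\<exists>P :: 9 \<Rightarrow> complex \<times> complex. imposes_independent m (range P) S"
proof -
  obtain qs where qs: "length qs = 9" "imposes_independent m (set qs) S"
    using tileable_imposes_independent[OF assms] by blast
  obtain h :: "9 \<Rightarrow> nat" where h: "bij_betw h UNIV {0..<9}"
    using ex_bij_betw_finite_nat[of "UNIV :: 9 set"] by auto
  have "range (\<lambda>i. qs ! h i) = (!) qs ` (h ` UNIV)" by (simp add: image_image)
  also have "h ` UNIV = {0..<length qs}" using h qs(1) by (simp add: bij_betw_def)
  also have "(!) qs ` {0..<length qs} = set qs" using nth_image[of "length qs" qs] by (simp add: atLeast0LessThan)
  finally have "range (\<lambda>i. qs ! h i) = set qs" .
  then show ?thesis using qs(2) by metis
qed

section \<open>Subdivisions of lattice squares\<close>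

definition square :: "nat \<Rightarrow> (nat \<times> nat) set" where
  "square d = {..d} \<times> {..d}"

lemma finite_square [simp]: "finite (square d)"
  by (simp add: square_def)

lemma mem_square: "(x, y) \<in> square d \<longleftrightarrow> x \<le> d \<and> y \<le> d"
  by (simp add: square_def)

lemma finite_filter: "finite S \<Longrightarrow> finite {(x, y). (x, y) \<in> S \<and> P x y}"
  by (rule finite_subset[of _ S]) auto

lemma determining_rows_filter:
  fixes lo r :: "int \<Rightarrow> int"
  assumes "finite S"
    and "\<And>x y. (x, y) \<in> S \<Longrightarrow> P x y \<Longrightarrow>
      lo (int y) \<le> int x \<and> int x < lo (int y) + r (int y) \<and> r (int y) \<le> int m"
    and "inj r"
  shows "determining m {(x, y). (x, y) \<in> S \<and> P x y}"
  by (rule determining_rows[where lo = lo and r = r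
      , OF finite_filter[OF assms(1)] _ assms(3)]) (use assms(2) in auto)

text \<open>The first four pieces are the corner triangles. The rows of each further piece have pairwise distinct
  lengths at most \<open>m\<close>: the lengths of the rows on the two sides of its longest row have opposite
  parities and decrease in steps of two. In each case \<open>lo\<close> is the left end of a row and \<open>r\<close> (a bound
  for) its length.\<close>

lemma tileable_even_square:
  assumes "m \<ge> 1"
  shows "tileable m 9 (square (2 * m))"
proof -
  define S0 where "S0 = square (2 * m)"
  define S1 where "S1 = {(x, y). (x, y) \<in> S0 \<and> 1 * int x + 1 * int y \<ge> int m}"
  define S2 where "S2 = {(x, y). (x, y) \<in> S1 \<and> (-1) * int x + (-1) * int y \<ge> - 3 * int m}"
  define S3 where "S3 = {(x, y). (x, y) \<in> S2 \<and> (-1) * int x + 1 * int y \<ge> - int m}"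
  define S4 where "S4 = {(x, y). (x, y) \<in> S3 \<and> 1 * int x + (-1) * int y \<ge> - int m}"
  \<comment> \<open>The four corners leave the diamond around \<open>(m, m)\<close>. Its cuts are
    symmetric under the half-turn about the centre: two lines of slope 1/3, then the diagonal, whose
    upper half goes to one piece and whose lower half to the other. Each of the eight pieces so far
    has exactly m (m + 1) / 2 points.\<close>
  define S5 where "S5 = {(x, y). (x, y) \<in> S4 \<and> 1 * int x + (-3) * int y \<ge> - 3 * int m}"
  define S6 where "S6 = {(x, y). (x, y) \<in> S5 \<and> (-1) * int x + 3 * int y \<ge> int m}"
  define S7 where "S7 = {(x, y). (x, y) \<in> S6 \<and> \<not> (1 * int x + (-1) * int y < 0 \<or>
      1 * int x + (-1) * int y = 0 \<and> 0 * int x + (-1) * int y < - int m)}"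
  define S8 where "S8 = {(x, y). (x, y) \<in> S7 \<and> \<not> ((-1) * int x + 1 * int y < 0 \<or>
      (-1) * int x + 1 * int y = 0 \<and> 0 * int x + 1 * int y < int m)}"
  note defs = S0_def S1_def S2_def S3_def S4_def S5_def S6_def S7_def S8_def mem_square
  have fin0: "finite S0" by (simp add: S0_def)
  have fin1: "finite S1" unfolding S1_def by (rule finite_filter[OF fin0])
  have fin2: "finite S2" unfolding S2_def by (rule finite_filter[OF fin1])
  have fin3: "finite S3" unfolding S3_def by (rule finite_filter[OF fin2])
  have fin4: "finite S4" unfolding S4_def by (rule finite_filter[OF fin3])
  have fin5: "finite S5" unfolding S5_def by (rule finite_filter[OF fin4])
  have fin6: "finite S6" unfolding S6_def by (rule finite_filter[OF fin5])
  have fin7: "finite S7" unfolding S7_def by (rule finite_filter[OF fin6])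
  have fin8: "finite S8" unfolding S8_def by (rule finite_filter[OF fin7])
  \<comment> \<open>Each \<open>B\<close> lists the inequalities accumulated by the cuts so far;
    together with the next cut they imply the row bounds.\<close>
  have B0: "int x \<le> 2 * int m \<and> int y \<le> 2 * int m" if "(x, y) \<in> S0" for x y
    using that by (auto simp: S0_def mem_square)
  have B1: "(int x \<le> 2 * int m \<and> int y \<le> 2 * int m) \<and> 1 * int x + 1 * int y \<ge> int m"
    if "(x, y) \<in> S1" for x y
    using B0[of x y] that unfolding S1_def by auto
  have B2: "(int x \<le> 2 * int m \<and> int y \<le> 2 * int m) \<and>
      1 * int x + 1 * int y \<ge> int m \<and> (-1) * int x + (-1) * int y \<ge> - 3 * int m"
    if "(x, y) \<in> S2" for x y
    using B1[of x y] that unfolding S2_def by auto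
  have B3: "(int x \<le> 2 * int m \<and> int y \<le> 2 * int m) \<and>
      1 * int x + 1 * int y \<ge> int m \<and> (-1) * int x + (-1) * int y \<ge> - 3 * int m \<and>
      (-1) * int x + 1 * int y \<ge> - int m"
    if "(x, y) \<in> S3" for x y
    using B2[of x y] that unfolding S3_def by auto
  have B4: "(int x \<le> 2 * int m \<and> int y \<le> 2 * int m) \<and>
      1 * int x + 1 * int y \<ge> int m \<and> (-1) * int x + (-1) * int y \<ge> - 3 * int m \<and>
      (-1) * int x + 1 * int y \<ge> - int m \<and> 1 * int x + (-1) * int y \<ge> - int m"
    if "(x, y) \<in> S4" for x y
    using B3[of x y] that unfolding S4_def by auto
  have B5: "(int x \<le> 2 * int m \<and> int y \<le> 2 * int m) \<and>
      1 * int x + 1 * int y \<ge> int m \<and> (-1) * int x + (-1) * int y \<ge> - 3 * int m \<and>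
      (-1) * int x + 1 * int y \<ge> - int m \<and> 1 * int x + (-1) * int y \<ge> - int m \<and>
      1 * int x + (-3) * int y \<ge> - 3 * int m"
    if "(x, y) \<in> S5" for x y
    using B4[of x y] that unfolding S5_def by auto
  have B6: "(int x \<le> 2 * int m \<and> int y \<le> 2 * int m) \<and>
      1 * int x + 1 * int y \<ge> int m \<and> (-1) * int x + (-1) * int y \<ge> - 3 * int m \<and>
      (-1) * int x + 1 * int y \<ge> - int m \<and> 1 * int x + (-1) * int y \<ge> - int m \<and>
      1 * int x + (-3) * int y \<ge> - 3 * int m \<and> (-1) * int x + 3 * int y \<ge> int m"
    if "(x, y) \<in> S6" for x y
    using B5[of x y] that unfolding S6_def by auto
  have B7: "(int x \<le> 2 * int m \<and> int y \<le> 2 * int m) \<and>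
      1 * int x + 1 * int y \<ge> int m \<and> (-1) * int x + (-1) * int y \<ge> - 3 * int m \<and>
      (-1) * int x + 1 * int y \<ge> - int m \<and> 1 * int x + (-1) * int y \<ge> - int m \<and>
      1 * int x + (-3) * int y \<ge> - 3 * int m \<and> (-1) * int x + 3 * int y \<ge> int m \<and>
      (1 * int x + (-1) * int y > 0 \<or> 1 * int x + (-1) * int y = 0 \<and>
      0 * int x + (-1) * int y \<ge> - int m)"
    if "(x, y) \<in> S7" for x y
    using B6[of x y] that unfolding S7_def by auto
  have D0: "determining m {(x, y). (x, y) \<in> S0 \<and> 1 * int x + 1 * int y < int m}"
  proof (rule determining_rows_filter[where lo="\<lambda>y. 0" and r="\<lambda>y. int m - y", OF fin0])
    fix x y assume "(x, y) \<in> S0" and c: "1 * int x + 1 * int y < int m"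
    from B0[OF this(1)] c show "(0) \<le> int x \<and> int x < (0) + (int m - int y) \<and>
        (int m - int y) \<le> int m"
      by (elim conjE disjE; simp split: if_splits; linarith)
  qed (unfold inj_def, presburger)
  have D1: "determining m {(x, y). (x, y) \<in> S1 \<and> (-1) * int x + (-1) * int y < - 3 * int m}"
  proof (rule determining_rows_filter[where lo="\<lambda>y. 3 * int m + 1 - y"
      and r="\<lambda>y. y - int m", OF fin1])
    fix x y assume "(x, y) \<in> S1" and c: "(-1) * int x + (-1) * int y < - 3 * int m"
    from B1[OF this(1)] c show "(3 * int m + 1 - int y) \<le> int x \<and>
        int x < (3 * int m + 1 - int y) + (int y - int m) \<and> (int y - int m) \<le> int m"
      by (elim conjE disjE; simp split: if_splits; linarith)
  qed (unfold inj_def, presburger)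
  have D2: "determining m {(x, y). (x, y) \<in> S2 \<and> (-1) * int x + 1 * int y < - int m}"
  proof (rule determining_rows_filter[where lo="\<lambda>y. int m + 1 + y" and r="\<lambda>y. int m - y"
      , OF fin2])
    fix x y assume "(x, y) \<in> S2" and c: "(-1) * int x + 1 * int y < - int m"
    from B2[OF this(1)] c show "(int m + 1 + int y) \<le> int x \<and>
        int x < (int m + 1 + int y) + (int m - int y) \<and> (int m - int y) \<le> int m"
      by (elim conjE disjE; simp split: if_splits; linarith)
  qed (unfold inj_def, presburger)
  have D3: "determining m {(x, y). (x, y) \<in> S3 \<and> 1 * int x + (-1) * int y < - int m}"
  proof (rule determining_rows_filter[where lo="\<lambda>y. 0" and r="\<lambda>y. y - int m", OF fin3])
    fix x y assume "(x, y) \<in> S3" and c: "1 * int x + (-1) * int y < - int m"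
    from B3[OF this(1)] c show "(0) \<le> int x \<and> int x < (0) + (int y - int m) \<and>
        (int y - int m) \<le> int m"
      by (elim conjE disjE; simp split: if_splits; linarith)
  qed (unfold inj_def, presburger)
  have D4: "determining m {(x, y). (x, y) \<in> S4 \<and> 1 * int x + (-3) * int y < - 3 * int m}"
  proof (rule determining_rows_filter[where lo="\<lambda>y. y - int m"
      and r="\<lambda>y. if 4 * y \<le> 6 * int m + 1 then 2 * y - 2 * int m else 4 * int m + 1 - 2 * y"
      , OF fin4])
    fix x y assume "(x, y) \<in> S4" and c: "1 * int x + (-3) * int y < - 3 * int m"
    from B4[OF this(1)] c show "(int y - int m) \<le> int x \<and>
        int x < (int y - int m) + (if 4 * int y \<le> 6 * int m + 1 then 2 * int y - 2 * int m
        else 4 * int m + 1 - 2 * int y) \<and> (if 4 * int y \<le> 6 * int m + 1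
        then 2 * int y - 2 * int m else 4 * int m + 1 - 2 * int y) \<le> int m"
      by (elim conjE disjE; simp split: if_splits; linarith)
  qed (unfold inj_def, presburger)
  have D5: "determining m {(x, y). (x, y) \<in> S5 \<and> (-1) * int x + 3 * int y < int m}"
  proof (rule determining_rows_filter[where lo="\<lambda>y. if 2 * int m \<le> 4 * y + 1
      then 3 * y - int m + 1 else int m - y" and r="\<lambda>y. if 2 * int m \<le> 4 * y + 1
      then 2 * int m - 2 * y else 2 * y + 1", OF fin5])
    fix x y assume "(x, y) \<in> S5" and c: "(-1) * int x + 3 * int y < int m"
    from B5[OF this(1)] c show "(if 2 * int m \<le> 4 * int y + 1 then 3 * int y - int m + 1
        else int m - int y) \<le> int x \<and> int x < (if 2 * int m \<le> 4 * int y + 1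
        then 3 * int y - int m + 1 else int m - int y) + (if 2 * int m \<le> 4 * int y + 1
        then 2 * int m - 2 * int y else 2 * int y + 1) \<and> (if 2 * int m \<le> 4 * int y + 1
        then 2 * int m - 2 * int y else 2 * int y + 1) \<le> int m"
      by (elim conjE disjE; simp split: if_splits; linarith)
  qed (unfold inj_def, presburger)
  have D6: "determining m {(x, y). (x, y) \<in> S6 \<and> (1 * int x + (-1) * int y < 0 \<or>
      1 * int x + (-1) * int y = 0 \<and> 0 * int x + (-1) * int y < - int m)}"
  proof (rule determining_rows_filter[where lo="\<lambda>y. if y > int m then 3 * y - 3 * int m
      else int m - y" and r="\<lambda>y. if y > int m then 3 * int m + 1 - 2 * y else 2 * y - int m", OF fin6])
    fix x y assume "(x, y) \<in> S6" and c: "(1 * int x + (-1) * int y < 0 \<or>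
        1 * int x + (-1) * int y = 0 \<and> 0 * int x + (-1) * int y < - int m)"
    from B6[OF this(1)] c show "(if int y > int m then 3 * int y - 3 * int m
        else int m - int y) \<le> int x \<and> int x < (if int y > int m then 3 * int y - 3 * int m
        else int m - int y) + (if int y > int m then 3 * int m + 1 - 2 * int y else 2 * int y - int m) \<and>
        (if int y > int m then 3 * int m + 1 - 2 * int y else 2 * int y - int m) \<le> int m"
      by (elim conjE disjE; simp split: if_splits; linarith)
  qed (unfold inj_def, presburger)
  have D7: "determining m {(x, y). (x, y) \<in> S7 \<and> ((-1) * int x + 1 * int y < 0 \<or>
      (-1) * int x + 1 * int y = 0 \<and> 0 * int x + 1 * int y < int m)}"
  proof (rule determining_rows_filter[where lo="\<lambda>y. if y < int m then y else y + 1"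
      and r="\<lambda>y. if y < int m then 2 * y - int m + 1 else 3 * int m - 2 * y", OF fin7])
    fix x y assume "(x, y) \<in> S7" and c: "((-1) * int x + 1 * int y < 0 \<or>
        (-1) * int x + 1 * int y = 0 \<and> 0 * int x + 1 * int y < int m)"
    from B7[OF this(1)] c show "(if int y < int m then int y else int y + 1) \<le> int x \<and>
        int x < (if int y < int m then int y else int y + 1) + (if int y < int m
        then 2 * int y - int m + 1 else 3 * int m - 2 * int y) \<and> (if int y < int m
        then 2 * int y - int m + 1 else 3 * int m - 2 * int y) \<le> int m"
      by (elim conjE disjE; simp split: if_splits; linarith)
  qed (unfold inj_def, presburger)
  \<comment> \<open>The ninth piece is at most the centre of the square, since (2 m + 1)^2 - 1 is
    eight times m (m + 1) / 2.\<close>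
  have "S8 \<subseteq> {(m, m)}" by (auto simp: defs)
  then have "card S8 \<le> m" using assms card_mono[of "{(m, m)}" S8] by simp
  then have T8: "tileable m (Suc 0) S8"
    by (intro tileable_last determining_card_le fin8)
  have T7: "tileable m (Suc (Suc 0)) S7"
    by (rule tileable_lex_cut[OF fin7 D7 T8[unfolded S8_def]])
  have T6: "tileable m (Suc (Suc (Suc 0))) S6"
    by (rule tileable_lex_cut[OF fin6 D6 T7[unfolded S7_def]])
  have T5: "tileable m (Suc (Suc (Suc (Suc 0)))) S5"
    by (rule tileable_cut[OF D5 T6[unfolded S6_def]])
  have T4: "tileable m (Suc (Suc (Suc (Suc (Suc 0))))) S4"
    by (rule tileable_cut[OF D4 T5[unfolded S5_def]])
  have T3: "tileable m (Suc (Suc (Suc (Suc (Suc (Suc 0)))))) S3"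
    by (rule tileable_cut[OF D3 T4[unfolded S4_def]])
  have T2: "tileable m (Suc (Suc (Suc (Suc (Suc (Suc (Suc 0))))))) S2"
    by (rule tileable_cut[OF D2 T3[unfolded S3_def]])
  have T1: "tileable m (Suc (Suc (Suc (Suc (Suc (Suc (Suc (Suc 0)))))))) S1"
    by (rule tileable_cut[OF D1 T2[unfolded S2_def]])
  have T0: "tileable m (Suc (Suc (Suc (Suc (Suc (Suc (Suc (Suc (Suc 0))))))))) S0"
    by (rule tileable_cut[OF D0 T1[unfolded S1_def]])
  have "9 = (Suc (Suc (Suc (Suc (Suc (Suc (Suc (Suc (Suc 0)))))))))" by simp
  with T0 show ?thesis by (simp only: S0_def)
qed

text \<open>For odd degree, seven pieces are cut off in the same way; \<open>remainder\<close> is what they leave for the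
  last two.\<close>

definition in_remainder :: "nat \<Rightarrow> nat \<Rightarrow> nat \<Rightarrow> bool" where
  "in_remainder m x y \<longleftrightarrow> m \<le> x + y \<and> x + y \<le> 3 * m + 2 \<and>
     x \<le> y + m + 1 \<and> y \<le> x + m + 1 \<and> 3 * y \<le> x + 3 * m + 4 \<and>
     (y \<le> x + 1 \<or> y = x + 2 \<and> y \<le> m) \<and>
     (3 * y < x + m + 5 \<or> 3 * y = x + m + 5 \<and> y \<le> m)"

definition remainder :: "nat \<Rightarrow> (nat \<times> nat) set" where
  "remainder m = {(x, y). x \<le> 2 * m + 1 \<and> y \<le> 2 * m + 1 \<and> in_remainder m x y}"

text \<open>The omitted points are removed from the square at the outset. They lie in the remainder,
  which the first seven pieces avoid, so only the last two pieces depend on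
  \<open>W\<close>.\<close>

lemma tileable_odd_square:
  assumes "m \<ge> 1" "W \<subseteq> remainder m" "tileable m 2 W"
  shows "tileable m 9 (square (2 * m + 1) - (remainder m - W))"
proof -
  define S0 where "S0 = square (2 * m + 1) - (remainder m - W)"
  define S1 where "S1 = {(x, y). (x, y) \<in> S0 \<and> 1 * int x + 1 * int y \<ge> int m}"
  define S2 where "S2 = {(x, y). (x, y) \<in> S1 \<and> (-1) * int x + (-1) * int y \<ge> - 3 * int m - 2}"
  define S3 where "S3 = {(x, y). (x, y) \<in> S2 \<and> (-1) * int x + 1 * int y \<ge> - int m - 1}"
  define S4 where "S4 = {(x, y). (x, y) \<in> S3 \<and> 1 * int x + (-1) * int y \<ge> - int m - 1}"
  define S5 where "S5 = {(x, y). (x, y) \<in> S4 \<and> 1 * int x + (-3) * int y \<ge> - 3 * int m - 4}"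
  define S6 where "S6 = {(x, y). (x, y) \<in> S5 \<and> \<not> (1 * int x + (-1) * int y < (-2) \<or>
      1 * int x + (-1) * int y = (-2) \<and> 0 * int x + (-1) * int y < - int m)}"
  define S7 where "S7 = {(x, y). (x, y) \<in> S6 \<and> \<not> (1 * int x + (-3) * int y < - int m - 5 \<or>
      1 * int x + (-3) * int y = - int m - 5 \<and> 0 * int x + (-1) * int y < - int m)}"
  note defs = S0_def S1_def S2_def S3_def S4_def S5_def S6_def S7_def mem_square
  have fin0: "finite S0" by (simp add: S0_def)
  have fin1: "finite S1" unfolding S1_def by (rule finite_filter[OF fin0])
  have fin2: "finite S2" unfolding S2_def by (rule finite_filter[OF fin1])
  have fin3: "finite S3" unfolding S3_def by (rule finite_filter[OF fin2])
  have fin4: "finite S4" unfolding S4_def by (rule finite_filter[OF fin3])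
  have fin5: "finite S5" unfolding S5_def by (rule finite_filter[OF fin4])
  have fin6: "finite S6" unfolding S6_def by (rule finite_filter[OF fin5])
  have fin7: "finite S7" unfolding S7_def by (rule finite_filter[OF fin6])
  have B0: "int x \<le> 2 * int m + 1 \<and> int y \<le> 2 * int m + 1" if "(x, y) \<in> S0" for x y
    using that by (auto simp: S0_def mem_square)
  have B1: "(int x \<le> 2 * int m + 1 \<and> int y \<le> 2 * int m + 1) \<and>
      1 * int x + 1 * int y \<ge> int m"
    if "(x, y) \<in> S1" for x y
    using B0[of x y] that unfolding S1_def by auto
  have B2: "(int x \<le> 2 * int m + 1 \<and> int y \<le> 2 * int m + 1) \<and>
      1 * int x + 1 * int y \<ge> int m \<and> (-1) * int x + (-1) * int y \<ge> - 3 * int m - 2"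
    if "(x, y) \<in> S2" for x y
    using B1[of x y] that unfolding S2_def by auto
  have B3: "(int x \<le> 2 * int m + 1 \<and> int y \<le> 2 * int m + 1) \<and>
      1 * int x + 1 * int y \<ge> int m \<and> (-1) * int x + (-1) * int y \<ge> - 3 * int m - 2 \<and>
      (-1) * int x + 1 * int y \<ge> - int m - 1"
    if "(x, y) \<in> S3" for x y
    using B2[of x y] that unfolding S3_def by auto
  have B4: "(int x \<le> 2 * int m + 1 \<and> int y \<le> 2 * int m + 1) \<and>
      1 * int x + 1 * int y \<ge> int m \<and> (-1) * int x + (-1) * int y \<ge> - 3 * int m - 2 \<and>
      (-1) * int x + 1 * int y \<ge> - int m - 1 \<and> 1 * int x + (-1) * int y \<ge> - int m - 1"
    if "(x, y) \<in> S4" for x y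
    using B3[of x y] that unfolding S4_def by auto
  have B5: "(int x \<le> 2 * int m + 1 \<and> int y \<le> 2 * int m + 1) \<and>
      1 * int x + 1 * int y \<ge> int m \<and> (-1) * int x + (-1) * int y \<ge> - 3 * int m - 2 \<and>
      (-1) * int x + 1 * int y \<ge> - int m - 1 \<and> 1 * int x + (-1) * int y \<ge> - int m - 1 \<and>
      1 * int x + (-3) * int y \<ge> - 3 * int m - 4"
    if "(x, y) \<in> S5" for x y
    using B4[of x y] that unfolding S5_def by auto
  have B6: "(int x \<le> 2 * int m + 1 \<and> int y \<le> 2 * int m + 1) \<and>
      1 * int x + 1 * int y \<ge> int m \<and> (-1) * int x + (-1) * int y \<ge> - 3 * int m - 2 \<and>
      (-1) * int x + 1 * int y \<ge> - int m - 1 \<and> 1 * int x + (-1) * int y \<ge> - int m - 1 \<and>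
      1 * int x + (-3) * int y \<ge> - 3 * int m - 4 \<and> (1 * int x + (-1) * int y > (-2) \<or>
      1 * int x + (-1) * int y = (-2) \<and> 0 * int x + (-1) * int y \<ge> - int m)"
    if "(x, y) \<in> S6" for x y
    using B5[of x y] that unfolding S6_def by auto
  have B7: "(int x \<le> 2 * int m + 1 \<and> int y \<le> 2 * int m + 1) \<and>
      1 * int x + 1 * int y \<ge> int m \<and> (-1) * int x + (-1) * int y \<ge> - 3 * int m - 2 \<and>
      (-1) * int x + 1 * int y \<ge> - int m - 1 \<and> 1 * int x + (-1) * int y \<ge> - int m - 1 \<and>
      1 * int x + (-3) * int y \<ge> - 3 * int m - 4 \<and> (1 * int x + (-1) * int y > (-2) \<or>
      1 * int x + (-1) * int y = (-2) \<and> 0 * int x + (-1) * int y \<ge> - int m) \<and>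
      (1 * int x + (-3) * int y > - int m - 5 \<or> 1 * int x + (-3) * int y = - int m - 5 \<and>
      0 * int x + (-1) * int y \<ge> - int m)"
    if "(x, y) \<in> S7" for x y
    using B6[of x y] that unfolding S7_def by auto
  have D0: "determining m {(x, y). (x, y) \<in> S0 \<and> 1 * int x + 1 * int y < int m}"
  proof (rule determining_rows_filter[where lo="\<lambda>y. 0" and r="\<lambda>y. int m - y", OF fin0])
    fix x y assume "(x, y) \<in> S0" and c: "1 * int x + 1 * int y < int m"
    from B0[OF this(1)] c show "(0) \<le> int x \<and> int x < (0) + (int m - int y) \<and>
        (int m - int y) \<le> int m"
      by (elim conjE disjE; simp split: if_splits; linarith)
  qed (unfold inj_def, presburger)
  have D1: "determining m {(x, y). (x, y) \<in> S1 \<and> (-1) * int x + (-1) * int y < - 3 * int m - 2}"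
  proof (rule determining_rows_filter[where lo="\<lambda>y. 3 * int m + 3 - y"
      and r="\<lambda>y. y - int m - 1", OF fin1])
    fix x y assume "(x, y) \<in> S1" and c: "(-1) * int x + (-1) * int y < - 3 * int m - 2"
    from B1[OF this(1)] c show "(3 * int m + 3 - int y) \<le> int x \<and>
        int x < (3 * int m + 3 - int y) + (int y - int m - 1) \<and> (int y - int m - 1) \<le> int m"
      by (elim conjE disjE; simp split: if_splits; linarith)
  qed (unfold inj_def, presburger)
  have D2: "determining m {(x, y). (x, y) \<in> S2 \<and> (-1) * int x + 1 * int y < - int m - 1}"
  proof (rule determining_rows_filter[where lo="\<lambda>y. int m + 2 + y" and r="\<lambda>y. int m - y"
      , OF fin2])
    fix x y assume "(x, y) \<in> S2" and c: "(-1) * int x + 1 * int y < - int m - 1"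
    from B2[OF this(1)] c show "(int m + 2 + int y) \<le> int x \<and>
        int x < (int m + 2 + int y) + (int m - int y) \<and> (int m - int y) \<le> int m"
      by (elim conjE disjE; simp split: if_splits; linarith)
  qed (unfold inj_def, presburger)
  have D3: "determining m {(x, y). (x, y) \<in> S3 \<and> 1 * int x + (-1) * int y < - int m - 1}"
  proof (rule determining_rows_filter[where lo="\<lambda>y. 0" and r="\<lambda>y. y - int m - 1", OF fin3])
    fix x y assume "(x, y) \<in> S3" and c: "1 * int x + (-1) * int y < - int m - 1"
    from B3[OF this(1)] c show "(0) \<le> int x \<and> int x < (0) + (int y - int m - 1) \<and>
        (int y - int m - 1) \<le> int m"
      by (elim conjE disjE; simp split: if_splits; linarith)
  qed (unfold inj_def, presburger)
  have D4: "determining m {(x, y). (x, y) \<in> S4 \<and> 1 * int x + (-3) * int y < - 3 * int m - 4}"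
  proof (rule determining_rows_filter[where lo="\<lambda>y. y - int m - 1"
      and r="\<lambda>y. if 4 * y \<le> 6 * int m + 7 then 2 * y - 2 * int m - 3
      else 4 * int m + 4 - 2 * y", OF fin4])
    fix x y assume "(x, y) \<in> S4" and c: "1 * int x + (-3) * int y < - 3 * int m - 4"
    from B4[OF this(1)] c show "(int y - int m - 1) \<le> int x \<and>
        int x < (int y - int m - 1) + (if 4 * int y \<le> 6 * int m + 7 then 2 * int y - 2 * int m - 3
        else 4 * int m + 4 - 2 * int y) \<and> (if 4 * int y \<le> 6 * int m + 7
        then 2 * int y - 2 * int m - 3 else 4 * int m + 4 - 2 * int y) \<le> int m"
      by (elim conjE disjE; simp split: if_splits; linarith)
  qed (unfold inj_def, presburger)
  \<comment> \<open>In row \<open>m + 1\<close> the formula for the rows above it would start at -1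
    with length \<open>m + 1\<close>; the border of the square leaves length \<open>m\<close>, so
    this row is a case of its own.\<close>
  have D5: "determining m {(x, y). (x, y) \<in> S5 \<and> (1 * int x + (-1) * int y < (-2) \<or>
      1 * int x + (-1) * int y = (-2) \<and> 0 * int x + (-1) * int y < - int m)}"
  proof (rule determining_rows_filter[where lo="\<lambda>y. if y = int m + 1 then 0 else if y > int m
      then 3 * y - 3 * int m - 4 else int m - y" and r="\<lambda>y. if y = int m + 1 then int m
      else if y > int m then 3 * int m + 3 - 2 * y else 2 * y - 2 - int m", OF fin5])
    fix x y assume "(x, y) \<in> S5" and c: "(1 * int x + (-1) * int y < (-2) \<or>
        1 * int x + (-1) * int y = (-2) \<and> 0 * int x + (-1) * int y < - int m)"
    from B5[OF this(1)] c show "(if int y = int m + 1 then 0 else if int y > int m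
        then 3 * int y - 3 * int m - 4 else int m - int y) \<le> int x \<and>
        int x < (if int y = int m + 1 then 0 else if int y > int m then 3 * int y - 3 * int m - 4
        else int m - int y) + (if int y = int m + 1 then int m else if int y > int m
        then 3 * int m + 3 - 2 * int y else 2 * int y - 2 - int m) \<and> (if int y = int m + 1
        then int m else if int y > int m then 3 * int m + 3 - 2 * int y else 2 * int y - 2 - int m) \<le> int m"
      by (elim conjE disjE; simp split: if_splits; linarith)
  qed (unfold inj_def, presburger)
  have D6: "determining m {(x, y). (x, y) \<in> S6 \<and> (1 * int x + (-3) * int y < - int m - 5 \<or>
      1 * int x + (-3) * int y = - int m - 5 \<and> 0 * int x + (-1) * int y < - int m)}"
  proof (rule determining_rows_filter[where lo="\<lambda>y. if y > int m then y - 1 else y - 2"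
      and r="\<lambda>y. if y > int m + 1 then 3 * int m + 4 - 2 * y else 2 * y - int m - 3", OF fin6])
    fix x y assume "(x, y) \<in> S6" and c: "(1 * int x + (-3) * int y < - int m - 5 \<or>
        1 * int x + (-3) * int y = - int m - 5 \<and> 0 * int x + (-1) * int y < - int m)"
    from B6[OF this(1)] c show "(if int y > int m then int y - 1 else int y - 2) \<le> int x \<and>
        int x < (if int y > int m then int y - 1 else int y - 2) + (if int y > int m + 1
        then 3 * int m + 4 - 2 * int y else 2 * int y - int m - 3) \<and> (if int y > int m + 1
        then 3 * int m + 4 - 2 * int y else 2 * int y - int m - 3) \<le> int m"
      by (elim conjE disjE; simp split: if_splits; linarith)
  qed (unfold inj_def, presburger)
  have "S7 = W"
  proof -
    have "(x, y) \<in> S7 \<longleftrightarrow> (x, y) \<in> W" for x y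
    proof
      assume h: "(x, y) \<in> S7"
      from B7[OF h] have "(x, y) \<in> remainder m"
        unfolding remainder_def in_remainder_def mem_Collect_eq prod.case by (elim conjE disjE; auto)
      moreover have "(x, y) \<in> S0"
        using h unfolding S1_def S2_def S3_def S4_def S5_def S6_def S7_def by blast
      ultimately show "(x, y) \<in> W" by (simp add: S0_def)
    next
      assume h: "(x, y) \<in> W"
      then have r: "(x, y) \<in> remainder m" using assms(2) by blast
      then have "(x, y) \<in> S0" using h by (auto simp: S0_def remainder_def mem_square)
      with r show "(x, y) \<in> S7"
        unfolding S1_def S2_def S3_def S4_def S5_def S6_def S7_def remainder_def in_remainder_def mem_Collect_eq prod.case
        by (elim conjE disjE; simp)
    qed
    then show ?thesis by auto
  qed
  moreover have "2 = Suc (Suc 0)" by simp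
  ultimately have T7: "tileable m (Suc (Suc 0)) S7" using assms(3) by (simp only:)
  have T6: "tileable m (Suc (Suc (Suc 0))) S6"
    by (rule tileable_lex_cut[OF fin6 D6 T7[unfolded S7_def]])
  have T5: "tileable m (Suc (Suc (Suc (Suc 0)))) S5"
    by (rule tileable_lex_cut[OF fin5 D5 T6[unfolded S6_def]])
  have T4: "tileable m (Suc (Suc (Suc (Suc (Suc 0))))) S4"
    by (rule tileable_cut[OF D4 T5[unfolded S5_def]])
  have T3: "tileable m (Suc (Suc (Suc (Suc (Suc (Suc 0)))))) S3"
    by (rule tileable_cut[OF D3 T4[unfolded S4_def]])
  have T2: "tileable m (Suc (Suc (Suc (Suc (Suc (Suc (Suc 0))))))) S2"
    by (rule tileable_cut[OF D2 T3[unfolded S3_def]])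
  have T1: "tileable m (Suc (Suc (Suc (Suc (Suc (Suc (Suc (Suc 0)))))))) S1"
    by (rule tileable_cut[OF D1 T2[unfolded S2_def]])
  have T0: "tileable m (Suc (Suc (Suc (Suc (Suc (Suc (Suc (Suc (Suc 0))))))))) S0"
    by (rule tileable_cut[OF D0 T1[unfolded S1_def]])
  have "9 = (Suc (Suc (Suc (Suc (Suc (Suc (Suc (Suc (Suc 0)))))))))" by simp
  with T0 show ?thesis by (simp only: S0_def)
qed

text \<open>Nine full pieces have room for (m + 1) (m - 8) / 2 more points than the square contains,
  so for large \<open>m\<close> crude bounds suffice: rows of length at most \<open>y - 1\<close> on
  the right of a vertical cut, columns of length at most \<open>x - 2\<close> on its left.\<close>

lemma tileable_remainder_large:
  assumes "m \<ge> 14"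
  shows "tileable m 2 (remainder m)"
proof -
  define A where "A = {(x, y). (x, y) \<in> remainder m \<and> (-1) * int x + 0 * int y < - int m - 2}"
  define B where "B = {(x, y). (x, y) \<in> remainder m \<and> (-1) * int x + 0 * int y \<ge> - int m - 2}"
  have fin: "finite (remainder m)" "finite B"
    by (rule finite_subset[OF _ finite_square[of "2 * m + 1"]], auto simp: B_def remainder_def mem_square)+
  have "determining m A"
    unfolding A_def
    by (rule determining_rows_filter[where lo="\<lambda>y. int m + 3" and r="\<lambda>y. y - 1", OF fin(1)])
      (auto simp: remainder_def in_remainder_def inj_def)
  moreover have "determining m B"
    by (rule determining_columns[where lo="\<lambda>x. if x \<le> int m then int m - x
        else x - int m - 1" and r="\<lambda>x. x - 2", OF fin(2)])
      (use assms in \<open>auto simp: remainder_def in_remainder_def B_def inj_def\<close>)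
  ultimately have "tileable m (Suc (Suc 0)) (remainder m)"
    unfolding A_def B_def by (intro tileable_cut tileable_last)
  then show ?thesis by (simp only: numeral_2_eq_2)
qed

text \<open>A triple \<open>(a, b, k)\<close> stands for the line \<open>a * x + b * y = k\<close>. For \<open>m \<le> 13\<close> the splitting of the
  remainder was found by computer search; a first coordinate of order 1000 in the cutting functional
  breaks ties among the points on a line.\<close>

fun peels :: "nat \<Rightarrow> (int \<times> int \<times> int) list \<Rightarrow> (nat \<times> nat) list \<Rightarrow> bool" where
  "peels m [] ps \<longleftrightarrow> ps = []"
| "peels m ((a, b, k) # ls) ps \<longleftrightarrow> (case m of 0 \<Rightarrow> False | Suc m' \<Rightarrow>
     length (filter (\<lambda>(x, y). a * int x + b * int y = k) ps) \<le> m \<and>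
     peels m' ls (filter (\<lambda>(x, y). a * int x + b * int y \<noteq> k) ps))"

lemma determining_peels: "peels m ls ps \<Longrightarrow> determining m (set ps)"
proof (induction m ls ps rule: peels.induct)
  case (1 m ps)
  then show ?case by (simp add: determining_def)
next
  case (2 m a b k ls ps)
  then obtain m' where m: "m = Suc m'" by (cases m) auto
  define l :: "nat \<times> nat \<Rightarrow> complex" where "l = (\<lambda>(x, y). of_int a * of_nat x + of_int b * of_nat y - of_int k)"
  have l: "l (x, y) = 0 \<longleftrightarrow> a * int x + b * int y = k" for x y
  proof -
    have "l (x, y) = of_int (a * int x + b * int y - k)" by (simp add: l_def)
    then show ?thesis by (simp only: of_int_eq_0_iff) simp
  qed
  have on: "{s \<in> set ps. l s = 0} = set (filter (\<lambda>(x, y). a * int x + b * int y = k) ps)"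
    and off: "{s \<in> set ps. l s \<noteq> 0} = set (filter (\<lambda>(x, y). a * int x + b * int y \<noteq> k) ps)"
    by (auto simp: l)
  show ?case
    unfolding m
  proof (rule determining_peel[where l = l])
    show "l \<in> affine2"
      by (rule affine2I[where a = "of_int a" and b = "of_int b" and e = "- of_int k"]) (simp add: l_def)
    show "card {s \<in> set ps. l s = 0} \<le> Suc m'"
      unfolding on by (rule order.trans[OF card_length]) (use 2 m in auto)
    show "determining m' {s \<in> set ps. l s \<noteq> 0}"
      unfolding off by (rule "2.IH"[OF m]) (use 2 m in auto)
  qed simp
qed

definition remainder_list :: "nat \<Rightarrow> (nat \<times> nat) list" where
  "remainder_list m = filter (\<lambda>(x, y). in_remainder m x y)
     (List.product [0..<2 * m + 2] [0..<2 * m + 2])"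

lemma set_remainder_list: "set (remainder_list m) = remainder m"
  by (auto simp: remainder_list_def remainder_def)

text \<open>The strip between the parallel cuts \<open>k\<close> and \<open>k'\<close> is what gets
  omitted. In the instances below \<open>q\<close> is (m + 1) (8 - m) / 2 for \<open>m <= 8\<close>
  and 0 beyond; where it is 0, the two cuts coincide.\<close>

definition splits_remainder :: "nat \<Rightarrow> nat \<Rightarrow> int \<times> int \<times> int \<times> int \<Rightarrow>
    (int \<times> int \<times> int) list \<Rightarrow> (int \<times> int \<times> int) list \<Rightarrow> bool" where
  "splits_remainder m q = (\<lambda>(a, b, k, k') ls ls'. let ps = remainder_list m in
     k \<le> k' \<and> peels m ls (filter (\<lambda>(x, y). a * int x + b * int y < k) ps) \<and>
     peels m ls' (filter (\<lambda>(x, y). a * int x + b * int y \<ge> k') ps) \<and>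
     length (filter (\<lambda>(x, y). k \<le> a * int x + b * int y \<and>
         a * int x + b * int y < k') ps) \<le> q)"

lemma splits_remainderD:
  assumes "splits_remainder m q (a, b, k, k') ls ls'"
  shows "\<exists>W\<subseteq>remainder m. tileable m 2 W \<and> card (remainder m - W) \<le> q"
proof -
  let ?f = "\<lambda>x y. a * int x + b * int y"
  let ?W = "{(x, y). (x, y) \<in> remainder m \<and> (?f x y < k \<or> ?f x y \<ge> k')}"
  let ?ps = "remainder_list m"
  have s: "k \<le> k'" "peels m ls (filter (\<lambda>(x, y). ?f x y < k) ?ps)"
    "peels m ls' (filter (\<lambda>(x, y). ?f x y \<ge> k') ?ps)"
    "length (filter (\<lambda>(x, y). k \<le> ?f x y \<and> ?f x y < k') ?ps) \<le> q"
    using assms by (auto simp: splits_remainder_def Let_def)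
  have "{(x, y). (x, y) \<in> ?W \<and> ?f x y < k} = set (filter (\<lambda>(x, y). ?f x y < k) ?ps)"
    "{(x, y). (x, y) \<in> ?W \<and> ?f x y \<ge> k} = set (filter (\<lambda>(x, y). ?f x y \<ge> k') ?ps)"
    using s(1) by (auto simp: set_remainder_list)
  then have "tileable m (Suc (Suc 0)) ?W"
    using determining_peels[OF s(2)] determining_peels[OF s(3)]
    by (intro tileable_cut[where a = a and b = b and k = k] tileable_last) simp_all
  moreover have "remainder m - ?W = set (filter (\<lambda>(x, y). k \<le> ?f x y \<and> ?f x y < k') ?ps)"
    by (auto simp: set_remainder_list)
  then have "card (remainder m - ?W) \<le> q"
    using order.trans[OF card_length s(4)] by simp
  ultimately show ?thesis by (intro exI[of _ ?W]) (auto simp: numeral_2_eq_2 simp del: tileable.simps)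
qed

lemma splits_remainder_1: "splits_remainder 1 7 (-1000, -1, -3001, -1)
  [(0, 1, 2)]
  [(0, 1, 1)]"
  by code_simp

lemma splits_remainder_2: "splits_remainder 2 9 (-1000, -1, -4002, -1002)
  [(0, 1, 3), (0, 1, 2)]
  [(0, 1, 2), (0, 1, 1)]"
  by code_simp

lemma splits_remainder_3: "splits_remainder 3 10 (-1000, -1, -5003, -3000)
  [(0, 1, 4), (0, 1, 3), (0, 1, 2)]
  [(1, 0, 2), (1, 0, 1), (0, 1, 0)]"
  by code_simp

lemma splits_remainder_4: "splits_remainder 4 10 (-1000, -1, -6003, -4002)
  [(0, 1, 4), (0, 1, 5), (0, 1, 3), (0, 1, 2)]
  [(1, 0, 3), (1, 0, 4), (0, 1, 3), (0, 1, 2)]"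
  by code_simp

lemma splits_remainder_5: "splits_remainder 5 9 (-3001, -997, -23998, -18993)
  [(0, 1, 5), (0, 1, 4), (0, 1, 6), (0, 1, 3), (0, 1, 2)]
  [(1, 0, 5), (1, 0, 4), (1, 0, 3), (1, 0, 2), (0, 1, 0)]"
  by code_simp

lemma splits_remainder_6: "splits_remainder 6 7 (-1000, -1, -8003, -7002)
  [(0, 1, 6), (0, 1, 5), (0, 1, 4), (0, 1, 7), (0, 1, 3), (0, 1, 2)]
  [(1, 0, 6), (1, 0, 5), (1, 0, 4), (1, 0, 7), (0, 1, 4), (0, 1, 3)]"
  by code_simp

lemma splits_remainder_7: "splits_remainder 7 4 (-2001, -998, -21996, -20000)
  [(0, 1, 7), (0, 1, 6), (0, 1, 5), (0, 1, 4), (0, 1, 8), (0, 1, 3), (0, 1, 2)]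
  [(1, 0, 7), (1, 0, 6), (1, 0, 8), (1, 0, 5), (1, 0, 4), (1, 0, 3), (0, 1, 1)]"
  by code_simp

lemma splits_remainder_8: "splits_remainder 8 0 (-2001, -998, -23997, -23997)
  [(0, 1, 7), (0, 1, 8), (0, 1, 6), (0, 1, 5), (0, 1, 4), (0, 1, 9), (0, 1, 3), (0, 1, 2)]
  [(1, 0, 8), (1, 0, 9), (1, 0, 7), (1, 0, 6), (1, 0, 5), (1, 0, 10), (0, 1, 5), (0, 1, 4)]"
  by code_simp

lemma splits_remainder_9: "splits_remainder 9 0 (-1000, -1, -11005, -11005)
  [(0, 1, 8), (0, 1, 7), (0, 1, 9), (0, 1, 6), (0, 1, 5), (0, 1, 4), (0, 1, 10), (0, 1, 3), (0, 1, 2)]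
  [(1, 0, 10), (1, 0, 9), (1, 0, 8), (1, 0, 7), (1, 0, 11), (1, 0, 6), (1, 0, 5), (1, 0, 4)]"
  by code_simp

lemma splits_remainder_10: "splits_remainder 10 0 (-1000, -1, -12007, -12007)
  [(0, 1, 9), (0, 1, 8), (0, 1, 10), (0, 1, 7), (0, 1, 6), (0, 1, 5), (0, 1, 11), (0, 1, 4), (0, 1, 3), (0, 1, 2)]
  [(0, 1, 6), (0, 1, 5), (0, 1, 4), (0, 1, 7), (0, 1, 3), (0, 1, 2), (0, 1, 1), (0, 1, 8), (0, 1, 0)]"
  by code_simp

lemma splits_remainder_11: "splits_remainder 11 0 (-1, 0, -13, -13)
  [(1, -1, 11), (1, -1, 12), (1, -1, 10), (1, -1, 9), (1, -1, 8), (1, -1, 7), (1, -1, 6), (0, 1, 10), (0, 1, 9)]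
  [(1, 0, 12), (1, 0, 11), (1, 0, 13), (1, 0, 10), (1, 0, 9), (1, 0, 8), (1, 0, 7), (1, 0, 6), (1, 0, 5)]"
  by code_simp

lemma splits_remainder_12: "splits_remainder 12 0 (-1, 0, -14, -14)
  [(1, -1, 12), (1, -1, 13), (1, -1, 11), (1, -1, 10), (1, -1, 9), (1, -1, 8), (1, -1, 7), (1, -1, 6), (1, -1, 5)]
  [(1, 0, 13), (1, 0, 12), (1, 0, 14), (1, 0, 11), (1, 0, 10), (1, 0, 9), (1, 0, 8), (1, 0, 7), (0, 1, 7), (0, 1, 6)]"
  by code_simp

lemma splits_remainder_13: "splits_remainder 13 0 (-1, 0, -16, -16)
  [(1, -1, 14), (1, -1, 13), (1, -1, 12), (1, -1, 11), (1, -1, 10), (1, -1, 9), (1, -1, 8), (1, -1, 7), (1, -1, 6)]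
  [(0, 1, 8), (0, 1, 7), (0, 1, 6), (0, 1, 5), (0, 1, 4), (0, 1, 9), (0, 1, 3), (0, 1, 2), (0, 1, 10), (0, 1, 1), (0, 1, 11), (0, 1, 0)]"
  by code_simp

text \<open>The bound is q of the system for \<open>d = 2 * m + 1\<close>; truncated subtraction
  makes it 0 from \<open>m = 8\<close> on, which covers negative q.\<close>

lemma tileable_odd_square_minus:
  assumes "m \<ge> 1"
  shows "\<exists>N\<subseteq>square (2 * m + 1). card N \<le> (m + 1) * (8 - m) div 2 \<and>
      tileable m 9 (square (2 * m + 1) - N)"
proof -
  have "\<exists>W\<subseteq>remainder m. tileable m 2 W \<and>
      card (remainder m - W) \<le> (m + 1) * (8 - m) div 2"
  proof (cases "m \<ge> 14")
    case True
    then show ?thesis using tileable_remainder_large[OF True] by (intro exI[of _ "remainder m"]) simp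
  next
    case False
    then have "m \<in> {1, 2, 3, 4, 5, 6, 7, 8, 9, 10, 11, 12, 13}" using assms by simp presburger
    then show ?thesis
      using splits_remainder_1[THEN splits_remainderD] splits_remainder_2[THEN splits_remainderD] splits_remainder_3[THEN splits_remainderD] splits_remainder_4[THEN splits_remainderD] splits_remainder_5[THEN splits_remainderD] splits_remainder_6[THEN splits_remainderD] splits_remainder_7[THEN splits_remainderD] splits_remainder_8[THEN splits_remainderD] splits_remainder_9[THEN splits_remainderD] splits_remainder_10[THEN splits_remainderD] splits_remainder_11[THEN splits_remainderD] splits_remainder_12[THEN splits_remainderD] splits_remainder_13[THEN splits_remainderD]
      by (elim insertE) (simp_all del: tileable.simps)
  qed
  then obtain W where W: "W \<subseteq> remainder m" "tileable m 2 W" "card (remainder m - W) \<le> (m + 1) * (8 - m) div 2"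
    by blast
  moreover have "remainder m - W \<subseteq> square (2 * m + 1)"
    by (auto simp: remainder_def mem_square)
  ultimately show ?thesis using tileable_odd_square[OF assms W(1,2)] by blast
qed

section \<open>Restriction to the quadric\<close>

text \<open>The inequalities make the exponents \<open>d + k - x - y\<close>, \<open>x - k\<close>,
  \<open>y - k\<close> and \<open>k\<close> non-negative. Monomials with the same
  \<open>(x, y)\<close> agree on the quadric, and raising \<open>k\<close> by one replaces a factor
  \<open>X1 * X2\<close> by \<open>X0 * X3\<close>.\<close>

definition restricted_exponents :: "nat \<Rightarrow> (nat \<times> nat \<times> nat) set" where
  "restricted_exponents d = {(x, y, k). x \<le> d \<and> y \<le> d \<and> k \<le> x \<and> k \<le> y \<and> x + y \<le> d + k}"

lemma mem_restricted_exponents: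
  "(x, y, k) \<in> restricted_exponents d \<longleftrightarrow> x \<le> d \<and> y \<le> d \<and> k \<le> x \<and> k \<le> y \<and> x + y \<le> d + k"
  by (simp add: restricted_exponents_def)

lemma finite_restricted_exponents [simp]: "finite (restricted_exponents d)"
  by (rule finite_subset[of _ "{..d} \<times> {..d} \<times> {..d}"]) (auto simp: restricted_exponents_def)

definition affine3 :: "(nat \<times> nat \<times> nat \<Rightarrow> complex) set" where
  "affine3 = {l. \<exists>a b c e. \<forall>x y k. l (x, y, k) = a * of_nat x + b * of_nat y + c * of_nat k + e}"

lemma affine3I:
  "(\<And>x y k. l (x, y, k) = a * of_nat x + b * of_nat y + c * of_nat k + e) \<Longrightarrow> l \<in> affine3"
  unfolding affine3_def by blast

definition weight3 :: "complex \<times> complex \<Rightarrow> nat \<times> nat \<times> nat \<Rightarrow> complex" where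
  "weight3 q = (\<lambda>(x, y, k). torus_weight q (x, y))"

text \<open>Coefficients of forms of degree \<open>d\<close>, indexed so that \<open>(x, y, k)\<close> stands for the monomial
  \<open>X0 ^ (d + k - x - y) * X1 ^ (x - k) * X2 ^ (y - k) * X3 ^ k\<close>, which restricts to \<open>u ^ x * v ^ y\<close> on the
  parametrized quadric \<open>(1, u, v, u * v)\<close>.\<close>

definition vanishes_on :: "nat \<Rightarrow> nat \<Rightarrow> ('i \<Rightarrow> complex \<times> complex) \<Rightarrow> (nat \<times> nat \<times> nat \<Rightarrow> complex) \<Rightarrow> bool" where
  "vanishes_on d m P c \<longleftrightarrow>
     (\<forall>i. annihilates affine3 m (restricted_exponents d) (\<lambda>t. c t * weight3 (P i) t))"

text \<open>Dimension at most \<open>n\<close>, phrased as a trivial common kernel of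
  \<open>n\<close> further functionals. In this form bounds add up under restriction, and the
  statement is an injectivity to which \<open>injective_open\<close> applies.\<close>

definition bounded_by :: "nat \<Rightarrow> nat \<Rightarrow> ('i \<Rightarrow> complex \<times> complex) \<Rightarrow> nat \<Rightarrow> bool" where
  "bounded_by d m P n \<longleftrightarrow> (\<exists>\<Lambda>. \<forall>c. vanishes_on d m P c \<longrightarrow>
     (\<forall>j<n. (\<Sum>t\<in>restricted_exponents d. c t * \<Lambda> j t) = 0) \<longrightarrow> (\<forall>t\<in>restricted_exponents d. c t = 0))"

lemma finite_enumeration:
  assumes "finite N" "card N \<le> n"
  obtains h :: "nat \<Rightarrow> 'a" where "N \<subseteq> h ` {..<n}"
proof -
  obtain h where "bij_betw h {0..<card N} N" using ex_bij_betw_nat_finite[OF assms(1)] by blast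
  then have "N = h ` {0..<card N}" by (simp add: bij_betw_def)
  also have "\<dots> \<subseteq> h ` {..<n}" using assms(2) by (intro image_mono) auto
  finally show thesis using that by blast
qed

lemma sum_mult_of_bool_single:
  fixes c :: "'a \<Rightarrow> complex"
  assumes "finite A" "t \<in> A"
  shows "(\<Sum>t'\<in>A. c t' * of_bool (t' = t)) = c t"
proof -
  have "(\<Sum>t'\<in>A. c t' * of_bool (t' = t)) = (\<Sum>t'\<in>{t}. c t' * of_bool (t' = t))"
    by (rule sum.mono_neutral_right) (use assms in auto)
  then show ?thesis by simp
qed

lemma bounded_by_card: "card (restricted_exponents d) \<le> n \<Longrightarrow> bounded_by d m P n"
proof -
  assume n: "card (restricted_exponents d) \<le> n"
  obtain h where h: "restricted_exponents d \<subseteq> h ` {..<n}"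
    using finite_enumeration[OF finite_restricted_exponents n] by blast
  show ?thesis
    unfolding bounded_by_def
  proof (intro exI[of _ "\<lambda>j t. of_bool (t = h j)"] allI impI ballI)
    fix c :: "nat \<times> nat \<times> nat \<Rightarrow> complex" and t assume c: "\<forall>j<n. (\<Sum>t\<in>restricted_exponents d. c t * of_bool (t = h j)) = 0"
      and t: "t \<in> restricted_exponents d"
    obtain j where "j < n" "t = h j" using h t by auto
    then have "(\<Sum>t'\<in>restricted_exponents d. c t' * of_bool (t' = t)) = 0" using c by simp
    then show "c t = 0" using sum_mult_of_bool_single[OF finite_restricted_exponents t, of c] by simp
  qed
qed

text \<open>Falling factorials are the basis of polynomials in \<open>k\<close> adapted to
  differences: division by the quadric is a summation along \<open>k\<close>, and the difference of
  the member of degree \<open>r + 1\<close> is a multiple of that of degree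
  \<open>r\<close>.\<close>

fun falling :: "nat \<Rightarrow> complex \<Rightarrow> complex" where
  "falling 0 z = 1"
| "falling (Suc r) z = falling r z * (z - of_nat r)"

lemma falling_Suc_plus_1: "falling (Suc r) (z + 1) = (z + 1) * falling r z"
  by (induction r) (auto simp: algebra_simps)

lemma falling_difference: "falling (Suc r) (z + 1) - falling (Suc r) z = of_nat (Suc r) * falling r z"
  unfolding falling_Suc_plus_1 by (simp add: algebra_simps)

definition falling_factors :: "nat \<Rightarrow> (nat \<times> nat \<times> nat \<Rightarrow> complex) list" where
  "falling_factors r = map (\<lambda>i (x, y, k). of_nat k - of_nat i) [0..<r]"

lemma prod_falling_factors: "(\<Prod>l\<leftarrow>falling_factors r. l (x, y, k)) = falling r (of_nat k)"
  by (induction r) (auto simp: falling_factors_def mult.commute)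

lemma falling_factors_affine: "set (falling_factors r) \<subseteq> affine3"
proof
  fix l assume "l \<in> set (falling_factors r)"
  then obtain i where "l = (\<lambda>(x, y, k). of_nat k - of_nat i)" by (auto simp: falling_factors_def)
  then show "l \<in> affine3"
    by (intro affine3I[where a = 0 and b = 0 and c = 1 and e = "- of_nat i"]) simp
qed

lemma length_falling_factors [simp]: "length (falling_factors r) = r"
  by (simp add: falling_factors_def)

text \<open>Forms vanishing on the quadric \<open>X0 * X3 = X1 * X2\<close> are multiples of its equation; on coefficients,
  division by it is the summation operator \<open>quotient_coeff\<close> along the fibres of the restriction.\<close>

context
  fixes d :: nat and c :: "nat \<times> nat \<times> nat \<Rightarrow> complex"
begin

definition quotient_coeff :: "nat \<times> nat \<times> nat \<Rightarrow> complex" where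
  "quotient_coeff = (\<lambda>(x, y, k). \<Sum>t'\<in>restricted_exponents (d + 2).
     c t' * of_bool (\<exists>k'>k. t' = (Suc x, Suc y, k')))"

definition restriction_coeff :: "nat \<times> nat \<Rightarrow> complex" where
  "restriction_coeff s = (\<Sum>t'\<in>restricted_exponents (d + 2). c t' * of_bool (\<exists>k. t' = (fst s, snd s, k)))"

lemma sum_restriction_coeff:
  "(\<Sum>s\<in>square (d + 2). restriction_coeff s * g s) =
     (\<Sum>t'\<in>restricted_exponents (d + 2). c t' * (case t' of (x, y, k) \<Rightarrow> g (x, y)))"
proof -
  have "(\<Sum>s\<in>square (d + 2). restriction_coeff s * g s) =
      (\<Sum>t'\<in>restricted_exponents (d + 2). \<Sum>s\<in>square (d + 2). c t' * of_bool (\<exists>k. t' = (fst s, snd s, k)) * g s)"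
    unfolding restriction_coeff_def sum_distrib_right by (rule sum.swap)
  also have "\<dots> = (\<Sum>t'\<in>restricted_exponents (d + 2). c t' * (case t' of (x, y, k) \<Rightarrow> g (x, y)))"
  proof (rule sum.cong)
    fix t' assume t': "t' \<in> restricted_exponents (d + 2)"
    obtain x y k where t: "t' = (x, y, k)" by (cases t')
    have "(\<Sum>s\<in>square (d + 2). c t' * of_bool (\<exists>k. t' = (fst s, snd s, k)) * g s) =
        (\<Sum>s\<in>{(x, y)}. c t' * of_bool (\<exists>k. t' = (fst s, snd s, k)) * g s)"
      by (rule sum.mono_neutral_right) (use t' in \<open>auto simp: t mem_square mem_restricted_exponents\<close>)
    then show "(\<Sum>s\<in>square (d + 2). c t' * of_bool (\<exists>k. t' = (fst s, snd s, k)) * g s) =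
        c t' * (case t' of (x, y, k) \<Rightarrow> g (x, y))" by (simp add: t)
  qed simp
  finally show ?thesis .
qed

text \<open>Summation by parts along the fibres. The boundary term depends on \<open>(x, y)\<close>
  only, so it pairs with the restricted coefficients, which vanish.\<close>

lemma sum_quotient_coeff:
  assumes "\<And>s. s \<in> square (d + 2) \<Longrightarrow> restriction_coeff s = 0"
  shows "(\<Sum>(x, y, k)\<in>restricted_exponents d. quotient_coeff (x, y, k) *
      (G (Suc x, Suc y, Suc k) - G (Suc x, Suc y, k))) =
    (\<Sum>t'\<in>restricted_exponents (d + 2). c t' * G t')"
proof -
  \<comment> \<open>The value of \<open>G\<close> at the lowest \<open>k\<close> in the fibre over
    \<open>(x, y)\<close>; truncated subtraction yields this \<open>k\<close> also when
    \<open>x + y < d + 2\<close>.\<close>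
  let ?low = "\<lambda>(x, y). G (x, y, x + y - (d + 2))"
  have inner: "(\<Sum>(x, y, k)\<in>restricted_exponents d. of_bool (\<exists>k'>k. t' = (Suc x, Suc y, k')) *
      (G (Suc x, Suc y, Suc k) - G (Suc x, Suc y, k))) =
      G t' - (case t' of (x, y, k) \<Rightarrow> ?low (x, y))"
    if t': "t' \<in> restricted_exponents (d + 2)" for t'
  proof -
    obtain x' y' k' where t: "t' = (x', y', k')" by (cases t')
    have b: "x' \<le> d + 2" "y' \<le> d + 2" "k' \<le> x'" "k' \<le> y'" "x' + y' \<le> d + 2 + k'"
      using t' by (auto simp: t mem_restricted_exponents)
    let ?L = "x' + y' - (d + 2)"
    \<comment> \<open>On the border \<open>x' = 0\<close> or \<open>y' = 0\<close> the fibre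
      consists of \<open>k' = 0\<close> alone and there is nothing to sum.\<close>
    let ?T = "if x' = 0 \<or> y' = 0 then {} else (\<lambda>k. (x' - 1, y' - 1, k)) ` {?L..<k'}"
    have "(\<Sum>(x, y, k)\<in>restricted_exponents d. of_bool (\<exists>k'>k. t' = (Suc x, Suc y, k')) *
      (G (Suc x, Suc y, Suc k) - G (Suc x, Suc y, k))) =
      (\<Sum>(x, y, k)\<in>?T. G (Suc x, Suc y, Suc k) - G (Suc x, Suc y, k))"
      by (rule sum.mono_neutral_cong_right)
        (use b in \<open>auto simp: t mem_restricted_exponents image_iff split: if_splits\<close>)
    also have "\<dots> = G t' - G (x', y', ?L)"
    proof (cases "x' = 0 \<or> y' = 0")
      case True
      then have "k' = 0" "?L = 0" using b by auto
      then show ?thesis using True by (auto simp: t)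
    next
      case False
      have "(\<Sum>(x, y, k)\<in>?T. G (Suc x, Suc y, Suc k) - G (Suc x, Suc y, k)) =
        (\<Sum>k\<in>{?L..<k'}. G (x', y', Suc k) - G (x', y', k))"
        using False by (simp add: sum.reindex inj_on_def)
      also have "\<dots> = G (x', y', k') - G (x', y', ?L)"
        using sum_Suc_diff'[of ?L k' "\<lambda>k. G (x', y', k)"] b by simp
      finally show ?thesis by (simp add: t)
    qed
    finally show ?thesis by (simp add: t)
  qed
  have "(\<Sum>(x, y, k)\<in>restricted_exponents d. quotient_coeff (x, y, k) *
      (G (Suc x, Suc y, Suc k) - G (Suc x, Suc y, k))) =
    (\<Sum>t\<in>restricted_exponents d. \<Sum>t'\<in>restricted_exponents (d + 2). c t' * (case t of (x, y, k) \<Rightarrow>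
      of_bool (\<exists>k'>k. t' = (Suc x, Suc y, k')) * (G (Suc x, Suc y, Suc k) - G (Suc x, Suc y, k))))"
    by (rule sum.cong) (simp_all only: quotient_coeff_def sum_distrib_right mult.assoc case_prod_beta fst_conv snd_conv)
  also have "\<dots> = (\<Sum>t'\<in>restricted_exponents (d + 2). c t' * (\<Sum>(x, y, k)\<in>restricted_exponents d.
      of_bool (\<exists>k'>k. t' = (Suc x, Suc y, k')) * (G (Suc x, Suc y, Suc k) - G (Suc x, Suc y, k))))"
    by (subst sum.swap) (simp add: sum_distrib_left)
  also have "\<dots> = (\<Sum>t'\<in>restricted_exponents (d + 2). c t' * G t') -
      (\<Sum>t'\<in>restricted_exponents (d + 2). c t' * (case t' of (x, y, k) \<Rightarrow> ?low (x, y)))"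
    by (simp only: sum_subtractf[symmetric] right_diff_distrib[symmetric]) (rule sum.cong, simp_all only: inner)
  also have "(\<Sum>t'\<in>restricted_exponents (d + 2). c t' * (case t' of (x, y, k) \<Rightarrow> ?low (x, y))) = 0"
    by (subst sum_restriction_coeff[symmetric]) (simp add: assms)
  finally show ?thesis by simp
qed

text \<open>Division by the quadric lowers the multiplicity by one. On coefficients: each test
  function of degree below \<open>m\<close> is a combination of differences along \<open>k\<close>
  of ones of degree below \<open>m + 1\<close>, and summation by parts transfers these to
  \<open>c\<close>. Products of a falling factorial in \<open>k\<close> with affine factors in
  \<open>x\<close>, \<open>y\<close> come first, arbitrary affine factors are reduced to
  them.\<close>

lemma quotient_vanishes:
  assumes zero: "\<And>s. s \<in> square (d + 2) \<Longrightarrow> restriction_coeff s = 0"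
    and q: "fst q \<noteq> 0" "snd q \<noteq> 0"
    and ann: "annihilates affine3 (Suc m) (restricted_exponents (d + 2)) (\<lambda>t. c t * weight3 q t)"
  shows "annihilates affine3 m (restricted_exponents d) (\<lambda>t. quotient_coeff t * weight3 q t)"
proof -
  let ?D = "\<lambda>t. quotient_coeff t * weight3 q t"
  have base: "(\<Sum>(x, y, k)\<in>restricted_exponents d. ?D (x, y, k) * falling r (of_nat k) * (\<Prod>l\<leftarrow>inv. l (x, y))) = 0"
    if inv: "set inv \<subseteq> affine2" "r + length inv < m" for r inv
  proof -
    \<comment> \<open>The arguments are shifted back by (1, 1), since the difference is taken at
      \<open>(Suc x, Suc y)\<close>; the slopes of \<open>l\<close> are read off from its values at
      0 and 1.\<close>
    define inv' :: "(nat \<times> nat \<times> nat \<Rightarrow> complex) list" where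
      "inv' = map (\<lambda>l (x, y, k). l (x, y) + (l (0, 0) - l (1, 0)) + (l (0, 0) - l (0, 1))) inv"
    have aff: "set inv' \<subseteq> affine3"
    proof
      fix l' assume "l' \<in> set inv'"
      then obtain l where l: "l \<in> affine2"
        "l' = (\<lambda>(x, y, k). l (x, y) + (l (0, 0) - l (1, 0)) + (l (0, 0) - l (0, 1)))"
        using inv(1) by (auto simp: inv'_def)
      obtain a b e where "\<And>x y. l (x, y) = a * of_nat x + b * of_nat y + e"
        using l(1) by (auto simp: affine2_def)
      then show "l' \<in> affine3"
        by (intro affine3I[where a = a and b = b and c = 0 and e = "e - a - b"]) (simp add: l(2))
    qed
    have shift: "(\<Prod>l\<leftarrow>inv'. l (Suc x, Suc y, k)) = (\<Prod>l\<leftarrow>inv. l (x, y))" for x y k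
    proof -
      have "l (Suc x, Suc y) + (l (0, 0) - l (1, 0)) + (l (0, 0) - l (0, 1)) = l (x, y)" if mem: "l \<in> set inv" for l
      proof -
        obtain a b e where "\<And>x y. l (x, y) = a * of_nat x + b * of_nat y + e"
          using mem inv(1) unfolding affine2_def by blast
        then show ?thesis by (simp add: algebra_simps)
      qed
      then show ?thesis unfolding inv'_def by (simp add: o_def cong: map_cong)
    qed
    let ?G = "\<lambda>t. weight3 q t * (\<Prod>l\<leftarrow>falling_factors (Suc r) @ inv'. l t)"
    have "(\<Sum>(x, y, k)\<in>restricted_exponents d. quotient_coeff (x, y, k) *
        (?G (Suc x, Suc y, Suc k) - ?G (Suc x, Suc y, k))) = 0"
    proof -
      have len: "length (falling_factors (Suc r) @ inv') < Suc m"
        using inv(2) by (simp add: inv'_def)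
      have "set (falling_factors (Suc r) @ inv') \<subseteq> affine3"
        using aff falling_factors_affine by auto
      from annihilatesD[OF ann this len]
      have "(\<Sum>t\<in>restricted_exponents (d + 2). c t * ?G t) = 0" by (simp only: mult.assoc)
      then show ?thesis using sum_quotient_coeff[OF zero, of ?G] by (rule trans[rotated])
    qed
    moreover have "?G (Suc x, Suc y, Suc k) - ?G (Suc x, Suc y, k) =
        weight3 q (x, y, k) * falling r (of_nat k) * (\<Prod>l\<leftarrow>inv. l (x, y)) * (fst q * snd q * of_nat (Suc r))" for x y k
    proof -
      have "?G (Suc x, Suc y, Suc k) - ?G (Suc x, Suc y, k) =
        weight3 q (x, y, k) * (fst q * snd q) * (falling (Suc r) (of_nat k + 1) - falling (Suc r) (of_nat k)) *
        (\<Prod>l\<leftarrow>inv. l (x, y))"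
        by (simp add: prod_falling_factors shift weight3_def torus_weight_def right_diff_distrib left_diff_distrib mult_ac add.commute
            del: falling.simps)
      then show ?thesis unfolding falling_difference by (simp add: mult_ac)
    qed
    ultimately have "(\<Sum>(x, y, k)\<in>restricted_exponents d. ?D (x, y, k) * falling r (of_nat k) * (\<Prod>l\<leftarrow>inv. l (x, y)) *
        (fst q * snd q * of_nat (Suc r))) = 0"
      by (simp add: mult.assoc)
    then have "(\<Sum>t\<in>restricted_exponents d. (case t of (x, y, k) \<Rightarrow> ?D (x, y, k) * falling r (of_nat k) * (\<Prod>l\<leftarrow>inv. l (x, y)))) *
        (fst q * snd q * of_nat (Suc r)) = 0"
      unfolding sum_distrib_right by (simp add: case_prod_beta)
    \<comment> \<open>The factor produced by the difference is nonzero because the point lies in the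
      torus.\<close>
    then show ?thesis using q by (simp del: of_nat_Suc)
  qed
  have gen: "(\<Sum>(x, y, k)\<in>restricted_exponents d.
      ?D (x, y, k) * falling r (of_nat k) * (\<Prod>l\<leftarrow>inv. l (x, y)) * (\<Prod>l\<leftarrow>ls. l (x, y, k))) = 0"
    if "set inv \<subseteq> affine2" "set ls \<subseteq> affine3" "r + length inv + length ls < m" for r inv ls
    using that
  proof (induction ls arbitrary: r inv)
    case Nil
    then show ?case using base[of inv r] by simp
  next
    case (Cons l ls)
    obtain a b e f where l: "\<And>x y k. l (x, y, k) = a * of_nat x + b * of_nat y + e * of_nat k + f"
      using Cons.prems(2) by (auto simp: affine3_def)
    \<comment> \<open>Writing \<open>k\<close> as \<open>(k - r) + r\<close>, the first part extends
      the falling factorial and the second joins the factors in \<open>x\<close> and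
      \<open>y\<close>.\<close>
    define l' :: "nat \<times> nat \<Rightarrow> complex" where
      "l' = (\<lambda>(x, y). a * of_nat x + b * of_nat y + (f + e * of_nat r))"
    have "l' \<in> affine2" by (rule affine2I[where a = a and b = b and e = "f + e * of_nat r"]) (simp add: l'_def)
    then have 1: "(\<Sum>(x, y, k)\<in>restricted_exponents d.
      ?D (x, y, k) * falling r (of_nat k) * (\<Prod>l\<leftarrow>l' # inv. l (x, y)) * (\<Prod>l\<leftarrow>ls. l (x, y, k))) = 0"
      using Cons.prems by (intro Cons.IH) auto
    have 2: "(\<Sum>(x, y, k)\<in>restricted_exponents d.
      ?D (x, y, k) * falling (Suc r) (of_nat k) * (\<Prod>l\<leftarrow>inv. l (x, y)) * (\<Prod>l\<leftarrow>ls. l (x, y, k))) = 0"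
      using Cons.prems by (intro Cons.IH) auto
    have split: "?D (x, y, k) * falling r (of_nat k) * (\<Prod>l\<leftarrow>inv. l (x, y)) * (\<Prod>l\<leftarrow>l # ls. l (x, y, k)) =
       ?D (x, y, k) * falling r (of_nat k) * (\<Prod>l\<leftarrow>l' # inv. l (x, y)) * (\<Prod>l\<leftarrow>ls. l (x, y, k)) +
       e * (?D (x, y, k) * falling (Suc r) (of_nat k) * (\<Prod>l\<leftarrow>inv. l (x, y)) * (\<Prod>l\<leftarrow>ls. l (x, y, k)))" for x y k
      by (simp add: l l'_def algebra_simps)
    have "(\<Sum>(x, y, k)\<in>restricted_exponents d.
        ?D (x, y, k) * falling r (of_nat k) * (\<Prod>l\<leftarrow>inv. l (x, y)) * (\<Prod>l\<leftarrow>l # ls. l (x, y, k))) =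
      (\<Sum>(x, y, k)\<in>restricted_exponents d.
        ?D (x, y, k) * falling r (of_nat k) * (\<Prod>l\<leftarrow>l' # inv. l (x, y)) * (\<Prod>l\<leftarrow>ls. l (x, y, k))) +
      e * (\<Sum>(x, y, k)\<in>restricted_exponents d.
        ?D (x, y, k) * falling (Suc r) (of_nat k) * (\<Prod>l\<leftarrow>inv. l (x, y)) * (\<Prod>l\<leftarrow>ls. l (x, y, k)))"
      unfolding sum_distrib_left sum.distrib[symmetric]
      by (rule sum.cong[OF refl], clarify) (simp only: prod.case split)
    then show ?case unfolding 1 2 by simp
  qed
  show ?thesis
    unfolding annihilates_def
  proof (intro allI impI)
    fix ls :: "(nat \<times> nat \<times> nat \<Rightarrow> complex) list" assume "set ls \<subseteq> affine3 \<and> length ls < m"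
    then show "(\<Sum>t\<in>restricted_exponents d. ?D t * (\<Prod>l\<leftarrow>ls. l t)) = 0"
      using gen[of "[]" ls 0] by (simp add: case_prod_beta)
  qed
qed

end

text \<open>Once the coefficients in \<open>N\<close> are killed, the restriction to the quadric
  vanishes by independence, and a form with zero restriction is determined by its quotient, an
  element of the residual system. Hence the two bounds add up.\<close>

lemma bounded_by_step:
  assumes bnd: "bounded_by d m P n"
    and nz: "\<And>i. fst (P i) \<noteq> 0 \<and> snd (P i) \<noteq> 0"
    and N: "N \<subseteq> square (d + 2)" "card N \<le> n'"
    and ind: "imposes_independent (Suc m) (range P) (square (d + 2) - N)"
  shows "bounded_by (d + 2) (Suc m) P (n + n')"
proof -
  let ?R = "restricted_exponents (d + 2)"
  obtain h where h: "N \<subseteq> h ` {..<n'}"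
    using finite_enumeration[OF _ N(2)] finite_subset[OF N(1)] by auto
  obtain \<Lambda> where \<Lambda>: "\<And>c. vanishes_on d m P c \<Longrightarrow>
     (\<forall>j<n. (\<Sum>t\<in>restricted_exponents d. c t * \<Lambda> j t) = 0) \<Longrightarrow> \<forall>t\<in>restricted_exponents d. c t = 0"
    using bnd unfolding bounded_by_def by blast
  \<comment> \<open>The first \<open>n\<close> functionals are those of the residual system pulled
    back along \<open>quotient_coeff\<close>; the others read the restricted coefficients at the
    points of \<open>N\<close>.\<close>
  define \<Lambda>' :: "nat \<Rightarrow> nat \<times> nat \<times> nat \<Rightarrow> complex" where
    "\<Lambda>' = (\<lambda>j t'. if j < n then \<Sum>(x, y, k)\<in>restricted_exponents d. of_bool (\<exists>k'>k. t' = (Suc x, Suc y, k')) * \<Lambda> j (x, y, k)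
       else of_bool (\<exists>k. t' = (fst (h (j - n)), snd (h (j - n)), k)))"
  show ?thesis
    unfolding bounded_by_def
  proof (intro exI[of _ \<Lambda>'] allI impI ballI)
    fix c t0 assume van: "vanishes_on (d + 2) (Suc m) P c"
      and lam: "\<forall>j<n + n'. (\<Sum>t\<in>?R. c t * \<Lambda>' j t) = 0" and t0: "t0 \<in> ?R"
    let ?r = "restriction_coeff d c" and ?q = "quotient_coeff d c"
    have rN: "?r s = 0" if mem: "s \<in> N" for s
    proof -
      obtain j where j: "j < n'" "s = h j" using h mem by blast
      have "n + j < n + n'" using j by simp
      with lam have "(\<Sum>t\<in>?R. c t * \<Lambda>' (n + j) t) = 0" by blast
      then show ?thesis by (simp add: \<Lambda>'_def restriction_coeff_def j(2))
    qed
    have "annihilates affine2 (Suc m) (square (d + 2)) (\<lambda>s. ?r s * torus_weight (P i) s)" for i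
      unfolding annihilates_def
    proof (intro allI impI)
      fix ls assume ls: "set ls \<subseteq> affine2 \<and> length ls < Suc m"
      let ?ls = "map (\<lambda>l (x, y, k). l (x, y)) ls :: (nat \<times> nat \<times> nat \<Rightarrow> complex) list"
      have aff: "set ?ls \<subseteq> affine3"
      proof
        fix l' :: "nat \<times> nat \<times> nat \<Rightarrow> complex" assume "l' \<in> set ?ls"
        then obtain l where l: "l \<in> affine2" "l' = (\<lambda>(x, y, k). l (x, y))" using ls by auto
        obtain a b e where "\<And>x y. l (x, y) = a * of_nat x + b * of_nat y + e"
          using l(1) by (auto simp: affine2_def)
        then show "l' \<in> affine3"
          by (intro affine3I[where a = a and b = b and c = 0 and e = e]) (simp add: l(2))
      qed
      have "(\<Sum>s\<in>square (d + 2). ?r s * (torus_weight (P i) s * (\<Prod>l\<leftarrow>ls. l s))) =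
        (\<Sum>t\<in>?R. c t * weight3 (P i) t * (\<Prod>l\<leftarrow>?ls. l t))"
        unfolding sum_restriction_coeff by (rule sum.cong) (auto simp: weight3_def o_def mult.assoc)
      also have "\<dots> = 0"
        by (rule annihilatesD[OF _ aff]) (use van ls in \<open>auto simp: vanishes_on_def\<close>)
      finally show "(\<Sum>s\<in>square (d + 2). ?r s * torus_weight (P i) s * (\<Prod>l\<leftarrow>ls. l s)) = 0"
        by (simp add: mult.assoc)
    qed
    then have "annihilates affine2 (Suc m) (square (d + 2) - N) (\<lambda>s. ?r s * torus_weight (P i) s)" for i
      by (subst annihilates_subset[symmetric, of "square (d + 2)"]) (auto simp: rN)
    then have "\<forall>s\<in>square (d + 2) - N. ?r s = 0"
      using ind unfolding imposes_independent_def by auto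
    then have zero: "?r s = 0" if "s \<in> square (d + 2)" for s
      using rN that by blast
    have "\<forall>t\<in>restricted_exponents d. ?q t = 0"
    proof (rule \<Lambda>)
      show "vanishes_on d m P ?q"
        unfolding vanishes_on_def using quotient_vanishes[OF zero] nz van by (auto simp: vanishes_on_def)
      show "\<forall>j<n. (\<Sum>t\<in>restricted_exponents d. ?q t * \<Lambda> j t) = 0"
      proof (intro allI impI)
        fix j assume j: "j < n"
        have "(\<Sum>t\<in>restricted_exponents d. ?q t * \<Lambda> j t) =
          (\<Sum>t\<in>restricted_exponents d. \<Sum>t'\<in>?R. c t' * (case t of (x, y, k) \<Rightarrow> of_bool (\<exists>k'>k. t' = (Suc x, Suc y, k')) * \<Lambda> j (x, y, k)))"
          by (rule sum.cong) (simp_all only: quotient_coeff_def sum_distrib_right mult.assoc case_prod_beta fst_conv snd_conv prod.collapse)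
        also have "\<dots> = (\<Sum>t'\<in>?R. c t' * \<Lambda>' j t')"
          using j by (subst sum.swap) (simp add: sum_distrib_left \<Lambda>'_def)
        also have "\<dots> = 0" using lam j by simp
        finally show "(\<Sum>t\<in>restricted_exponents d. ?q t * \<Lambda> j t) = 0" .
      qed
    qed
    \<comment> \<open>Summation by parts with the indicator function of \<open>t0\<close> recovers
      \<open>c t0\<close> from the vanishing quotient.\<close>
    then have "(\<Sum>(x, y, k)\<in>restricted_exponents d. ?q (x, y, k) *
        (of_bool ((Suc x, Suc y, Suc k) = t0) - of_bool ((Suc x, Suc y, k) = t0))) = 0"
      by (intro sum.neutral) auto
    then have "(\<Sum>t\<in>?R. c t * of_bool (t = t0)) = 0"
      using sum_quotient_coeff[OF zero, of "\<lambda>t. of_bool (t = t0)"] by simp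
    then show "c t0 = 0" using sum_mult_of_bool_single[OF finite_restricted_exponents t0, of c] by simp
  qed
qed

section \<open>Forms, derivatives and multiplicities\<close>

abbreviation lk :: "('a \<Rightarrow>\<^sub>0 'b::zero) \<Rightarrow> 'a \<Rightarrow> 'b" where "lk \<equiv> Poly_Mapping.lookup"

definition monom_at :: "('v::finite \<Rightarrow>\<^sub>0 nat) \<Rightarrow> ('v \<Rightarrow> complex) \<Rightarrow> complex" where
  "monom_at \<beta> x = (\<Prod>v\<in>UNIV. x v ^ lk \<beta> v)"

lemma monom_at_add: "monom_at (\<beta> + \<gamma>) x = monom_at \<beta> x * monom_at \<gamma> x"
  by (simp add: monom_at_def lookup_add power_add prod.distrib)

definition cpoly_pair :: "(('v \<Rightarrow>\<^sub>0 nat) \<Rightarrow> complex) \<Rightarrow> 'v cpoly \<Rightarrow> complex" where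
  "cpoly_pair h F = (\<Sum>\<beta>\<in>Poly_Mapping.keys F. lk F \<beta> * h \<beta>)"

lemma cpoly_pair_superset:
  assumes "finite K" "Poly_Mapping.keys F \<subseteq> K"
  shows "cpoly_pair h F = (\<Sum>\<beta>\<in>K. lk F \<beta> * h \<beta>)"
  unfolding cpoly_pair_def
  by (rule sum.mono_neutral_left) (use assms in \<open>auto simp: in_keys_iff\<close>)

lemma cpoly_pair_add: "cpoly_pair h (F + G) = cpoly_pair h F + cpoly_pair h G"
proof -
  let ?K = "Poly_Mapping.keys F \<union> Poly_Mapping.keys G"
  have "cpoly_pair h (F + G) = (\<Sum>\<beta>\<in>?K. lk (F + G) \<beta> * h \<beta>)"
    by (rule cpoly_pair_superset) (auto simp: in_keys_iff lookup_add)
  also have "\<dots> = (\<Sum>\<beta>\<in>?K. lk F \<beta> * h \<beta>) + (\<Sum>\<beta>\<in>?K. lk G \<beta> * h \<beta>)"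
    by (simp add: lookup_add algebra_simps sum.distrib)
  finally show ?thesis
    using cpoly_pair_superset[of ?K F h] cpoly_pair_superset[of ?K G h] by simp
qed

lemma cpoly_pair_sum: "cpoly_pair h (sum f A) = (\<Sum>a\<in>A. cpoly_pair h (f a))"
  by (induction A rule: infinite_finite_induct) (auto simp: cpoly_pair_add, simp_all add: cpoly_pair_def)

lemma cpoly_pair_single: "cpoly_pair h (Poly_Mapping.single \<beta> c) = c * h \<beta>"
  by (subst cpoly_pair_superset[of "{\<beta>}"]) auto

lemma cpoly_eval_pair: "cpoly_eval F x = cpoly_pair (\<lambda>\<beta>. monom_at \<beta> x) F"
  by (simp add: cpoly_eval_def cpoly_pair_def monom_at_def)

lemma cpoly_eval_superset:
  assumes "finite K" "Poly_Mapping.keys F \<subseteq> K"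
  shows "cpoly_eval F x = (\<Sum>\<beta>\<in>K. lk F \<beta> * monom_at \<beta> x)"
  unfolding cpoly_eval_pair by (rule cpoly_pair_superset[OF assms])

lemma cpoly_eval_add: "cpoly_eval (F + G) x = cpoly_eval F x + cpoly_eval G x"
  by (simp add: cpoly_eval_pair cpoly_pair_add)

lemma cpoly_eval_zero [simp]: "cpoly_eval 0 x = 0"
  by (simp add: cpoly_eval_def)

lemma cpoly_eval_sum: "cpoly_eval (sum f A) x = (\<Sum>a\<in>A. cpoly_eval (f a) x)"
  by (simp add: cpoly_eval_pair cpoly_pair_sum)

lemma cpoly_eval_single: "cpoly_eval (Poly_Mapping.single \<beta> c) x = c * monom_at \<beta> x"
  by (simp add: cpoly_eval_pair cpoly_pair_single)

lemma cpoly_eval_scale: "cpoly_eval (cpoly_scale c F) x = c * cpoly_eval F x"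
  by (subst cpoly_eval_superset[of "Poly_Mapping.keys F"])
    (auto simp: cpoly_eval_superset[of "Poly_Mapping.keys F" F] in_keys_iff sum_distrib_left mult_ac)

lemma cpoly_as_sum: "F = (\<Sum>\<beta>\<in>Poly_Mapping.keys F. Poly_Mapping.single \<beta> (lk F \<beta>))"
  by (rule poly_mapping_eqI)
    (auto simp: lookup_sum lookup_single when_def in_keys_iff sum.delta)

lemma cpoly_induct [case_names zero single add]:
  assumes "P 0" "\<And>\<beta> c. P (Poly_Mapping.single \<beta> c)" "\<And>F G. P F \<Longrightarrow> P G \<Longrightarrow> P (F + G)"
  shows "P (F :: 'v cpoly)"
proof -
  have "P (\<Sum>\<beta>\<in>A. Poly_Mapping.single \<beta> (lk F \<beta>))" if "finite A" for A
    using that by (induction A rule: finite_induct) (auto intro: assms)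
  from this[of "Poly_Mapping.keys F"] show ?thesis by (subst cpoly_as_sum) simp
qed

lemma cpoly_eval_mult: "cpoly_eval (F * G) x = cpoly_eval F x * cpoly_eval G x"
proof (induction F rule: cpoly_induct)
  case (single \<beta> c)
  show ?case
    by (induction G rule: cpoly_induct)
      (auto simp: mult_single cpoly_eval_single monom_at_add cpoly_eval_add algebra_simps)
qed (auto simp: cpoly_eval_add algebra_simps)

lemma lookup_pderiv:
  "lk (cpoly_pderiv v F) \<beta> = of_nat (Suc (lk \<beta> v)) * lk F (\<beta> + Poly_Mapping.single v 1)"
proof -
  let ?e = "Poly_Mapping.single v (1::nat)"
  have "lk (cpoly_pderiv v F) \<beta> =
      (\<Sum>\<kappa>\<in>Poly_Mapping.keys F. if \<kappa> = \<beta> + ?e then of_nat (Suc (lk \<beta> v)) * lk F \<kappa> else 0)"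
    unfolding cpoly_pderiv_def lookup_sum lookup_single
  proof (rule sum.cong)
    fix \<kappa>
    show "(of_nat (lk \<kappa> v) * lk F \<kappa> when \<kappa> - ?e = \<beta>) =
      (if \<kappa> = \<beta> + ?e then of_nat (Suc (lk \<beta> v)) * lk F \<kappa> else 0)"
    proof (cases "lk \<kappa> v = 0")
      case True
      then show ?thesis by (auto simp: lookup_add)
    next
      case False
      have "\<kappa> - ?e = \<beta> \<longleftrightarrow> \<kappa> = \<beta> + ?e"
      proof
        assume h: "\<kappa> - ?e = \<beta>"
        show "\<kappa> = \<beta> + ?e"
          by (rule poly_mapping_eqI) (use False in \<open>auto simp: h[symmetric] lookup_add lookup_minus lookup_single when_def\<close>)
      qed simp
      then show ?thesis by (auto simp: lookup_add)
    qed
  qed simp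
  also have "\<dots> = of_nat (Suc (lk \<beta> v)) * lk F (\<beta> + ?e)"
    by (simp add: sum.delta in_keys_iff)
  finally show ?thesis .
qed

lemma pderiv_add: "cpoly_pderiv v (F + G) = cpoly_pderiv v F + cpoly_pderiv v G"
  by (rule poly_mapping_eqI) (simp add: lookup_pderiv lookup_add algebra_simps)

lemma pderiv_scale: "cpoly_pderiv v (cpoly_scale c F) = cpoly_scale c (cpoly_pderiv v F)"
  by (rule poly_mapping_eqI) (simp add: lookup_pderiv)

lemma pderiv_zero [simp]: "cpoly_pderiv v 0 = 0"
  by (rule poly_mapping_eqI) (simp add: lookup_pderiv)

lemma pderiv_commute: "cpoly_pderiv v (cpoly_pderiv w F) = cpoly_pderiv w (cpoly_pderiv v F)"
  by (rule poly_mapping_eqI)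
    (auto simp: lookup_pderiv lookup_add lookup_single when_def ac_simps)

lemma pderiv_single:
  "cpoly_pderiv v (Poly_Mapping.single \<beta> c) =
     Poly_Mapping.single (\<beta> - Poly_Mapping.single v 1) (of_nat (lk \<beta> v) * c)"
  by (cases "c = 0") (simp_all add: cpoly_pderiv_def)

lemma pderiv_mult: "cpoly_pderiv v (F * G) = cpoly_pderiv v F * G + F * cpoly_pderiv v G"
proof (induction F rule: cpoly_induct)
  case (single \<beta> c)
  let ?e = "Poly_Mapping.single v (1::nat)"
  have minus: "\<beta> - ?e + \<gamma> = \<beta> + \<gamma> - ?e" if "lk \<beta> v > 0" for \<beta> \<gamma> :: "'a \<Rightarrow>\<^sub>0 nat"
    by (rule poly_mapping_eqI) (use that in \<open>auto simp: lookup_add lookup_minus lookup_single when_def\<close>)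
  \<comment> \<open>If \<open>lk \<beta> v = 0\<close>, the truncated exponents may differ, but then
    both coefficients are zero.\<close>
  have L: "Poly_Mapping.single (\<beta> - ?e + \<gamma>) (of_nat (lk \<beta> v) * z) =
      Poly_Mapping.single (\<beta> + \<gamma> - ?e) (of_nat (lk \<beta> v) * z :: complex)" for \<beta> \<gamma> :: "'a \<Rightarrow>\<^sub>0 nat" and z
    using minus[of \<beta> \<gamma>] by (cases "lk \<beta> v = 0") simp_all
  show ?case
  proof (induction G rule: cpoly_induct)
    case (single \<gamma> d)
    have "Poly_Mapping.single (\<beta> - ?e) (of_nat (lk \<beta> v) * c) * Poly_Mapping.single \<gamma> d =
       Poly_Mapping.single (\<beta> + \<gamma> - ?e) (of_nat (lk \<beta> v) * (c * d))"
      using L[of \<beta> \<gamma> "c * d"] by (simp add: mult_single mult.assoc)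
    moreover have "Poly_Mapping.single \<beta> c * Poly_Mapping.single (\<gamma> - ?e) (of_nat (lk \<gamma> v) * d) =
       Poly_Mapping.single (\<beta> + \<gamma> - ?e) (of_nat (lk \<gamma> v) * (c * d))"
    proof -
      have "Poly_Mapping.single \<beta> c * Poly_Mapping.single (\<gamma> - ?e) (of_nat (lk \<gamma> v) * d) =
         Poly_Mapping.single (\<gamma> - ?e + \<beta>) (of_nat (lk \<gamma> v) * (c * d))"
        unfolding mult_single by (simp only: add.commute mult.left_commute)
      also have "\<dots> = Poly_Mapping.single (\<gamma> + \<beta> - ?e) (of_nat (lk \<gamma> v) * (c * d))" by (rule L)
      finally show ?thesis by (simp only: add.commute)
    qed
    ultimately have "cpoly_pderiv v (Poly_Mapping.single \<beta> c) * Poly_Mapping.single \<gamma> d +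
        Poly_Mapping.single \<beta> c * cpoly_pderiv v (Poly_Mapping.single \<gamma> d) =
      Poly_Mapping.single (\<beta> + \<gamma> - ?e) (of_nat (lk \<beta> v) * (c * d) + of_nat (lk \<gamma> v) * (c * d))"
      by (simp only: pderiv_single single_add)
    also have "\<dots> = cpoly_pderiv v (Poly_Mapping.single \<beta> c * Poly_Mapping.single \<gamma> d)"
      by (simp only: mult_single pderiv_single lookup_add of_nat_add distrib_right)
    finally show ?case ..
  qed (simp_all add: pderiv_add algebra_simps)
qed (simp_all add: pderiv_add algebra_simps)

lemma fold_pderiv_add:
  "fold cpoly_pderiv vs (F + G) = fold cpoly_pderiv vs F + fold cpoly_pderiv vs G"
  by (induction vs arbitrary: F G) (auto simp: pderiv_add)

lemma fold_pderiv_scale: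
  "fold cpoly_pderiv vs (cpoly_scale c F) = cpoly_scale c (fold cpoly_pderiv vs F)"
  by (induction vs arbitrary: F) (auto simp: pderiv_scale)

lemma fold_pderiv_zero [simp]: "fold cpoly_pderiv vs 0 = 0"
  by (induction vs) auto

lemma fold_pderiv_sum: "fold cpoly_pderiv vs (sum f A) = (\<Sum>a\<in>A. fold cpoly_pderiv vs (f a))"
  by (induction A rule: infinite_finite_induct) (auto simp: fold_pderiv_add)

definition total_degree :: "('v::finite \<Rightarrow>\<^sub>0 nat) \<Rightarrow> nat" where
  "total_degree \<beta> = (\<Sum>v\<in>UNIV. lk \<beta> v)"

lemma total_degree_add: "total_degree (\<beta> + \<gamma>) = total_degree \<beta> + total_degree \<gamma>"
  by (simp add: total_degree_def lookup_add sum.distrib)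

lemma total_degree_single: "total_degree (Poly_Mapping.single v n) = n"
  by (simp add: total_degree_def lookup_single when_def)

lemma homogeneous_iff: "homogeneous d F \<longleftrightarrow> (\<forall>\<beta>. lk F \<beta> \<noteq> 0 \<longrightarrow> int (total_degree \<beta>) = d)"
  by (auto simp: homogeneous_def in_keys_iff total_degree_def)

lemma homogeneous_zero [simp]: "homogeneous d 0"
  by (simp add: homogeneous_iff)

lemma homogeneous_add: "homogeneous d F \<Longrightarrow> homogeneous d G \<Longrightarrow> homogeneous d (F + G)"
  unfolding homogeneous_iff lookup_add by (metis add_0)

lemma homogeneous_scale: "homogeneous d F \<Longrightarrow> homogeneous d (cpoly_scale c F)"
  by (simp add: homogeneous_iff)

lemma homogeneous_pderiv:
  assumes "homogeneous d F"
  shows "homogeneous (d - 1) (cpoly_pderiv v F)"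
  unfolding homogeneous_iff
proof (intro allI impI)
  fix \<beta> assume "lk (cpoly_pderiv v F) \<beta> \<noteq> 0"
  then have "lk F (\<beta> + Poly_Mapping.single v 1) \<noteq> 0" by (auto simp: lookup_pderiv)
  then have "int (total_degree (\<beta> + Poly_Mapping.single v 1)) = d"
    using assms by (auto simp: homogeneous_iff)
  then show "int (total_degree \<beta>) = d - 1" by (simp add: total_degree_add total_degree_single)
qed

lemma homogeneous_fold_pderiv:
  "homogeneous d F \<Longrightarrow> homogeneous (d - int (length vs)) (fold cpoly_pderiv vs F)"
proof (induction vs arbitrary: d F)
  case (Cons v vs)
  from Cons.IH[OF homogeneous_pderiv[OF Cons.prems]] show ?case by (simp add: algebra_simps)
qed simp

lemma homogeneous_mult:
  assumes "homogeneous d F" "homogeneous e G"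
  shows "homogeneous (d + e) (F * G)"
  unfolding homogeneous_def
proof
  fix \<beta> assume "\<beta> \<in> Poly_Mapping.keys (F * G)"
  then obtain a b where ab: "\<beta> = a + b" "a \<in> Poly_Mapping.keys F" "b \<in> Poly_Mapping.keys G"
    using keys_mult[of F G] by auto
  then have "int (total_degree a) = d" "int (total_degree b) = e"
    using assms by (auto simp: homogeneous_iff in_keys_iff)
  then have "int (total_degree \<beta>) = d + e" by (simp add: ab(1) total_degree_add)
  then show "int (\<Sum>v\<in>UNIV. lk \<beta> v) = d + e" by (simp add: total_degree_def)
qed

lemma euler_identity:
  assumes "homogeneous (int e) G"
  shows "(\<Sum>v\<in>UNIV. x v * cpoly_eval (cpoly_pderiv v G) x) = of_nat e * cpoly_eval G x"
proof -
  let ?K = "Poly_Mapping.keys G"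
  have mon: "x v * monom_at (\<beta> - Poly_Mapping.single v 1) x = monom_at \<beta> x" if "lk \<beta> v > 0" for \<beta> v
  proof -
    have "\<beta> = (\<beta> - Poly_Mapping.single v 1) + Poly_Mapping.single v 1"
      by (rule poly_mapping_eqI) (use that in \<open>auto simp: lookup_add lookup_minus lookup_single when_def\<close>)
    moreover have "monom_at (Poly_Mapping.single v 1) x = x v"
      by (simp add: monom_at_def lookup_single when_def prod.delta if_distrib[of "\<lambda>n. _ ^ n"] cong: if_cong)
    ultimately show ?thesis by (metis monom_at_add mult.commute)
  qed
  have "x v * cpoly_eval (cpoly_pderiv v G) x = (\<Sum>\<beta>\<in>?K. of_nat (lk \<beta> v) * (lk G \<beta> * monom_at \<beta> x))" for v
    unfolding cpoly_pderiv_def cpoly_eval_sum cpoly_eval_single sum_distrib_left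
  proof (rule sum.cong)
    fix \<beta>
    show "x v * (of_nat (lk \<beta> v) * lk G \<beta> * monom_at (\<beta> - Poly_Mapping.single v 1) x) =
      of_nat (lk \<beta> v) * (lk G \<beta> * monom_at \<beta> x)"
      by (cases "lk \<beta> v = 0") (use mon[of \<beta> v] in \<open>auto simp: mult_ac\<close>)
  qed simp
  then have "(\<Sum>v\<in>UNIV. x v * cpoly_eval (cpoly_pderiv v G) x) =
      (\<Sum>\<beta>\<in>?K. of_nat (total_degree \<beta>) * (lk G \<beta> * monom_at \<beta> x))"
    by (simp add: sum_distrib_right total_degree_def) (rule sum.swap)
  also have "\<dots> = (\<Sum>\<beta>\<in>?K. of_nat e * (lk G \<beta> * monom_at \<beta> x))"
    by (rule sum.cong) (use assms in \<open>auto simp: homogeneous_iff in_keys_iff\<close>)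
  also have "\<dots> = of_nat e * cpoly_eval G x"
    by (simp add: sum_distrib_left cpoly_eval_superset[of ?K G])
  finally show ?thesis .
qed

lemma mult_ge_nonpos: "m \<le> 0 \<Longrightarrow> mult_ge m F x"
  by (simp add: mult_ge_def)

text \<open>Splitting off the first derivative makes induction on the multiplicity possible.\<close>

lemma mult_ge_Suc:
  "mult_ge (int (Suc n)) F x \<longleftrightarrow>
     cpoly_eval F (($) x) = 0 \<and> (\<forall>v. mult_ge (int n) (cpoly_pderiv v F) x)"
proof
  assume h: "mult_ge (int (Suc n)) F x"
  have "cpoly_eval (fold cpoly_pderiv [] F) (($) x) = 0"
    using h unfolding mult_ge_def by (metis length_0_conv of_nat_0_less_iff of_nat_0 zero_less_Suc)
  moreover have "mult_ge (int n) (cpoly_pderiv v F) x" for v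
    unfolding mult_ge_def
  proof (intro allI impI)
    fix vs :: "4 list" assume "int (length vs) < int n"
    then have "cpoly_eval (fold cpoly_pderiv (v # vs) F) (($) x) = 0"
      using h unfolding mult_ge_def by (metis length_Cons of_nat_less_iff Suc_less_eq)
    then show "cpoly_eval (fold cpoly_pderiv vs (cpoly_pderiv v F)) (($) x) = 0" by simp
  qed
  ultimately show "cpoly_eval F (($) x) = 0 \<and> (\<forall>v. mult_ge (int n) (cpoly_pderiv v F) x)" by simp
next
  assume h: "cpoly_eval F (($) x) = 0 \<and> (\<forall>v. mult_ge (int n) (cpoly_pderiv v F) x)"
  show "mult_ge (int (Suc n)) F x"
    unfolding mult_ge_def
  proof (intro allI impI)
    fix vs :: "4 list" assume "int (length vs) < int (Suc n)"
    then show "cpoly_eval (fold cpoly_pderiv vs F) (($) x) = 0"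
      using h by (cases vs) (auto simp: mult_ge_def)
  qed
qed

lemma mult_ge_add: "mult_ge m F x \<Longrightarrow> mult_ge m G x \<Longrightarrow> mult_ge m (F + G) x"
  by (simp add: mult_ge_def fold_pderiv_add cpoly_eval_add)

lemma mult_ge_scale: "mult_ge m F x \<Longrightarrow> mult_ge m (cpoly_scale c F) x"
  by (simp add: mult_ge_def fold_pderiv_scale cpoly_eval_scale)

lemma mult_ge_zero [simp]: "mult_ge m 0 x"
  by (simp add: mult_ge_def)

text \<open>Induction on \<open>a + b\<close> by the product rule: each summand of a derivative
  loses one order in one factor. A factor of order 0 imposes nothing, and the loss is then charged
  to the other one.\<close>

lemma mult_ge_mult:
  "mult_ge (int a) F x \<Longrightarrow> mult_ge (int b) G x \<Longrightarrow> mult_ge (int (a + b)) (F * G) x"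
proof (induction "a + b" arbitrary: a b F G)
  case 0
  then show ?case by (simp add: mult_ge_nonpos)
next
  case (Suc n)
  have val: "cpoly_eval (F * G) (($) x) = 0"
  proof (cases a)
    case 0
    then obtain b' where "b = Suc b'" using Suc.hyps(2) by (cases b) auto
    then show ?thesis using Suc.prems(2) mult_ge_Suc cpoly_eval_mult by (metis mult_zero_right)
  next
    case (Suc a')
    then show ?thesis using Suc.prems(1) mult_ge_Suc cpoly_eval_mult by (metis mult_zero_left)
  qed
  have "mult_ge (int n) (cpoly_pderiv v (F * G)) x" for v
    unfolding pderiv_mult
  proof (rule mult_ge_add)
    have mono: "mult_ge (int k) H x" if "mult_ge (int l) H x" "k \<le> l" for k l H
      using that by (simp add: mult_ge_def)
    show "mult_ge (int n) (cpoly_pderiv v F * G) x"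
    proof (cases a)
      case 0
      then obtain b' where b: "b = Suc b'" using Suc.hyps(2) by (cases b) auto
      have "mult_ge (int (0 + b')) (cpoly_pderiv v F * G) x"
        by (rule Suc.hyps(1)) (use Suc.hyps(2) 0 b Suc.prems(2) mono[of b G b'] in \<open>auto simp: mult_ge_nonpos\<close>)
      then show ?thesis using Suc.hyps(2) 0 b by simp
    next
      case (Suc a')
      have "mult_ge (int (a' + b)) (cpoly_pderiv v F * G) x"
        by (rule Suc.hyps(1)) (use \<open>Suc n = a + b\<close> Suc Suc.prems mult_ge_Suc in auto)
      then show ?thesis using \<open>Suc n = a + b\<close> Suc by simp
    qed
    show "mult_ge (int n) (F * cpoly_pderiv v G) x"
    proof (cases b)
      case 0
      then obtain a' where a: "a = Suc a'" using Suc.hyps(2) by (cases a) auto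
      have "mult_ge (int (a' + 0)) (F * cpoly_pderiv v G) x"
        by (rule Suc.hyps(1)) (use Suc.hyps(2) 0 a Suc.prems(1) mono[of a F a'] in \<open>auto simp: mult_ge_nonpos\<close>)
      then show ?thesis using Suc.hyps(2) 0 a by simp
    next
      case (Suc b')
      have "mult_ge (int (a + b')) (F * cpoly_pderiv v G) x"
        by (rule Suc.hyps(1)) (use \<open>Suc n = a + b\<close> Suc Suc.prems mult_ge_Suc in auto)
      then show ?thesis using \<open>Suc n = a + b\<close> Suc by simp
    qed
  qed
  with val show ?case unfolding Suc.hyps(2)[symmetric] mult_ge_Suc by blast
qed

text \<open>By Euler's identity the derivatives of order exactly \<open>n\<close> control those of smaller order.\<close>

lemma mult_ge_of_top_order:
  assumes "homogeneous (int d) F" "n \<le> d"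
    and top: "\<And>vs. length vs = n \<Longrightarrow> cpoly_eval (fold cpoly_pderiv vs F) (($) x) = 0"
  shows "mult_ge (int (Suc n)) F x"
proof -
  have "cpoly_eval (fold cpoly_pderiv vs F) (($) x) = 0" if "length vs \<le> n" for vs
    using that
  proof (induction "n - length vs" arbitrary: vs)
    case 0
    then show ?case using top by simp
  next
    case (Suc k)
    let ?G = "fold cpoly_pderiv vs F"
    have "homogeneous (int (d - length vs)) ?G"
      using homogeneous_fold_pderiv[OF assms(1), of vs] Suc.hyps(2) assms(2) by (simp add: of_nat_diff)
    from euler_identity[OF this, of "($) x"]
    have "of_nat (d - length vs) * cpoly_eval ?G (($) x) = (\<Sum>v\<in>UNIV. x $ v * cpoly_eval (fold cpoly_pderiv (vs @ [v]) F) (($) x))"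
      by simp
    also have "\<dots> = 0"
      by (intro sum.neutral ballI) (use Suc.hyps(1)[of "vs @ [v]" for v] Suc.hyps(2) in \<open>auto simp del: fold_append\<close>)
    \<comment> \<open>The Euler factor is nonzero: the derivative has order below \<open>n\<close>,
      hence positive degree.\<close>
    finally show ?case using Suc.hyps(2) assms(2) by (cases "d = length vs") auto
  qed
  then show ?thesis by (auto simp: mult_ge_def)
qed

section \<open>Monomials of given degree\<close>

definition exponents :: "nat \<Rightarrow> ('v::finite \<Rightarrow>\<^sub>0 nat) set" where
  "exponents d = {\<beta>. total_degree \<beta> = d}"

text \<open>The coordinates \<open>X0\<close>, ..., \<open>X3\<close> correspond to the indices 1,
  2, 3, 4 of the type \<open>4\<close>, where 4 is another name for 0.\<close>

definition vec4 :: "nat list \<Rightarrow> (4 \<Rightarrow>\<^sub>0 nat)" where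
  "vec4 l = Poly_Mapping.single 1 (l ! 0) + Poly_Mapping.single 2 (l ! 1) +
     Poly_Mapping.single 3 (l ! 2) + Poly_Mapping.single 4 (l ! 3)"

lemma four_distinct [simp]:
  "(1::4) \<noteq> 2" "(1::4) \<noteq> 3" "(1::4) \<noteq> 4" "(2::4) \<noteq> 3" "(2::4) \<noteq> 4" "(3::4) \<noteq> 4"
  "(2::4) \<noteq> 1" "(3::4) \<noteq> 1" "(4::4) \<noteq> 1" "(3::4) \<noteq> 2" "(4::4) \<noteq> 2" "(4::4) \<noteq> 3"
  by simp_all

lemma lookup_vec4 [simp]:
  "lk (vec4 l) 1 = l ! 0" "lk (vec4 l) 2 = l ! 1" "lk (vec4 l) 3 = l ! 2" "lk (vec4 l) 4 = l ! 3"
  by (simp_all add: vec4_def lookup_add lookup_single)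

lemma total_degree_4: "total_degree (\<beta> :: 4 \<Rightarrow>\<^sub>0 nat) = lk \<beta> 1 + lk \<beta> 2 + lk \<beta> 3 + lk \<beta> 4"
  by (simp add: total_degree_def sum_4)

lemma poly_mapping_4_eqI:
  "lk \<beta> 1 = lk \<gamma> 1 \<Longrightarrow> lk \<beta> 2 = lk \<gamma> 2 \<Longrightarrow> lk \<beta> 3 = lk \<gamma> 3 \<Longrightarrow> lk \<beta> 4 = lk \<gamma> 4 \<Longrightarrow> \<beta> = \<gamma>"
  for \<beta> \<gamma> :: "4 \<Rightarrow>\<^sub>0 nat"
  by (rule poly_mapping_eqI) (metis exhaust_4)

lemma bij_betw_vec4: "bij_betw vec4 {l. length l = 4 \<and> sum_list l = d} (exponents d)"
proof (rule bij_betw_imageI)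
  have list4: "l = [l ! 0, l ! 1, l ! 2, l ! 3]" if "length l = 4" for l :: "nat list"
    using that by (auto simp: numeral_eq_Suc length_Suc_conv)
  show "inj_on vec4 {l. length l = 4 \<and> sum_list l = d}"
  proof (rule inj_onI)
    fix l l' assume h: "l \<in> {l. length l = 4 \<and> sum_list l = d}" "l' \<in> {l. length l = 4 \<and> sum_list l = d}" "vec4 l = vec4 l'"
    then have "l ! 0 = l' ! 0" "l ! 1 = l' ! 1" "l ! 2 = l' ! 2" "l ! 3 = l' ! 3"
      using lookup_vec4[of l] lookup_vec4[of l'] by simp_all
    then show "l = l'" using list4[of l] list4[of l'] h by simp
  qed
  show "vec4 ` {l. length l = 4 \<and> sum_list l = d} = exponents d"
  proof (intro equalityI subsetI)
    fix \<beta> assume "\<beta> \<in> vec4 ` {l. length l = 4 \<and> sum_list l = d}"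
    then obtain l where l: "length l = 4" "sum_list l = d" "\<beta> = vec4 l" by auto
    have "sum_list l = l ! 0 + l ! 1 + l ! 2 + l ! 3" by (subst list4[OF l(1)]) simp
    then show "\<beta> \<in> exponents d" using l by (simp add: exponents_def total_degree_4)
  next
    fix \<beta> :: "4 \<Rightarrow>\<^sub>0 nat" assume "\<beta> \<in> exponents d"
    then have "sum_list [lk \<beta> 1, lk \<beta> 2, lk \<beta> 3, lk \<beta> 4] = d"
      by (simp add: exponents_def total_degree_4)
    moreover have "\<beta> = vec4 [lk \<beta> 1, lk \<beta> 2, lk \<beta> 3, lk \<beta> 4]"
      by (rule poly_mapping_4_eqI) simp_all
    ultimately show "\<beta> \<in> vec4 ` {l. length l = 4 \<and> sum_list l = d}" by (intro image_eqI) auto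
  qed
qed

lemma card_exponents: "card (exponents d :: (4 \<Rightarrow>\<^sub>0 nat) set) = (d + 3) choose 3"
proof -
  have "card (exponents d :: (4 \<Rightarrow>\<^sub>0 nat) set) = (d + 3) choose d"
    using bij_betw_same_card[OF bij_betw_vec4[of d]] card_length_sum_list[of 4 d] by (simp add: add.commute)
  also have "\<dots> = (d + 3) choose 3" by (subst binomial_symmetric) auto
  finally show ?thesis .
qed

lemma finite_exponents: "finite (exponents d :: (4 \<Rightarrow>\<^sub>0 nat) set)"
proof -
  have "card (exponents d :: (4 \<Rightarrow>\<^sub>0 nat) set) > 0" by (simp add: card_exponents)
  then show ?thesis by (rule card_ge_0_finite)
qed

definition exponent_of :: "'v list \<Rightarrow> ('v \<Rightarrow>\<^sub>0 nat)" where
  "exponent_of vs = (\<Sum>v\<leftarrow>vs. Poly_Mapping.single v 1)"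

lemma lookup_exponent_of: "lk (exponent_of vs) v = count (mset vs) v"
  by (induction vs) (auto simp: exponent_of_def lookup_add lookup_single when_def)

lemma exponent_of_in_exponents: "exponent_of vs \<in> exponents (length vs)"
  by (induction vs)
    (simp_all add: exponent_of_def exponents_def total_degree_add total_degree_single, simp add: total_degree_def)

text \<open>Partial derivatives commute. This cuts the conditions of a given order down to one for
  each exponent vector, as the count of conditions requires.\<close>

lemma fold_pderiv_cong:
  assumes "exponent_of vs = exponent_of ws"
  shows "fold cpoly_pderiv vs F = fold cpoly_pderiv ws F"
proof -
  have "mset vs = mset ws"
    by (rule multiset_eqI) (metis assms lookup_exponent_of)
  moreover have "cpoly_pderiv v \<circ> cpoly_pderiv w = cpoly_pderiv w \<circ> cpoly_pderiv v" for v w :: 'a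
    by (rule ext) (simp add: pderiv_commute)
  ultimately show ?thesis by (metis fold_multiset_equiv)
qed

text \<open>Dimension at least \<open>n\<close>, in a form that is monotone in \<open>V\<close> and
  presupposes no finiteness of dimension.\<close>

definition independent_in :: "'v cpoly set \<Rightarrow> nat \<Rightarrow> bool" where
  "independent_in V n \<longleftrightarrow> (\<exists>B\<subseteq>V. finite B \<and> cpoly.independent B \<and> card B = n)"

lemma independent_in_mono: "independent_in V n \<Longrightarrow> V \<subseteq> W \<Longrightarrow> independent_in W n"
  unfolding independent_in_def by blast

lemma independent_in_le:
  assumes "independent_in V n" "k \<le> n"
  shows "independent_in V k"
proof -
  obtain B where B: "B \<subseteq> V" "finite B" "\<not> cpoly.dependent B" "card B = n"
    using assms(1) unfolding independent_in_def by blast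
  obtain C where C: "C \<subseteq> B" "card C = k" "finite C"
    using obtain_subset_with_card_n[of k B] assms(2) B(4) by auto
  then show ?thesis
    unfolding independent_in_def
    using B(1) cpoly.independent_mono[OF B(3) C(1)] by (intro exI[of _ C]) auto
qed

definition linear_form :: "('v cpoly \<Rightarrow> complex) \<Rightarrow> bool" where
  "linear_form f \<longleftrightarrow> (\<forall>F G. f (F + G) = f F + f G) \<and> (\<forall>c F. f (cpoly_scale c F) = c * f F)"

lemma linear_form_diff:
  assumes "linear_form f"
  shows "f (F - cpoly_scale c G) = f F - c * f G"
proof -
  have "F - cpoly_scale c G = F + cpoly_scale (- c) G"
    by (simp add: cpoly.scale_minus_left)
  also have "f \<dots> = f F + - c * f G"
    using assms unfolding linear_form_def by metis
  finally show ?thesis by simp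
qed

text \<open>One linear condition lowers the dimension by at most one: a maximal independent set
  \<open>C\<close> in the kernel, together with one vector off the kernel, spans
  \<open>B\<close>.\<close>

lemma independent_in_kernel:
  assumes V: "cpoly.subspace V" and f: "linear_form f" and ind: "independent_in V (Suc n)"
  shows "independent_in {F \<in> V. f F = 0} n"
proof -
  let ?V0 = "{F \<in> V. f F = 0}"
  obtain B where B: "B \<subseteq> V" "finite B" "\<not> cpoly.dependent B" "card B = Suc n"
    using ind unfolding independent_in_def by blast
  obtain C where C: "C \<subseteq> ?V0" "\<not> cpoly.dependent C" "?V0 \<subseteq> cpoly.span C"
    using cpoly.maximal_independent_subset by blast
  show ?thesis
  proof (cases "finite C \<and> card C < n")
    case True
    \<comment> \<open>If \<open>f\<close> vanishes on all of \<open>B\<close>, any \<open>g\<close>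
      will do; otherwise \<open>g\<close> is a vector of \<open>B\<close> off the kernel, and the
      others are moved into the kernel by subtracting multiples of it.\<close>
    have "\<exists>g. B \<subseteq> cpoly.span (insert g C)"
    proof (cases "\<forall>b\<in>B. f b = 0")
      case True
      then have "B \<subseteq> cpoly.span C" using B(1) C(3) by blast
      then show ?thesis using cpoly.span_mono[of C "insert _ C"] by blast
    next
      case False
      then obtain g where g: "g \<in> B" "f g \<noteq> 0" by blast
      have "b \<in> cpoly.span (insert g C)" if "b \<in> B" for b
      proof -
        define c where "c = f b / f g"
        have "b - cpoly_scale c g \<in> ?V0"
          using B(1) that g V
          by (auto simp: linear_form_diff[OF f] c_def intro!: cpoly.subspace_diff cpoly.subspace_scale)
        then have "b - cpoly_scale c g \<in> cpoly.span (insert g C)"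
          using C(3) cpoly.span_mono[of C "insert g C"] by blast
        moreover have "cpoly_scale c g \<in> cpoly.span (insert g C)"
          by (intro cpoly.span_scale cpoly.span_base) simp
        ultimately show ?thesis using cpoly.span_add by fastforce
      qed
      then show ?thesis by blast
    qed
    then obtain g where "B \<subseteq> cpoly.span (insert g C)" by blast
    then have "card B \<le> card (insert g C)"
      using cpoly.independent_span_bound[of "insert g C" B] B(3) True by simp
    also have "\<dots> \<le> Suc (card C)" by (simp add: True card_insert_if)
    finally show ?thesis using True B(4) by simp
  next
    case False
    have "\<exists>D\<subseteq>C. finite D \<and> card D = n"
    proof (cases "finite C")
      case True
      then show ?thesis using False obtain_subset_with_card_n[of n C] by (metis not_less)
    next
      case False
      then show ?thesis using infinite_arbitrarily_large by blast
    qed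
    then obtain D where D: "D \<subseteq> C" "finite D" "card D = n" by blast
    then show ?thesis
      unfolding independent_in_def
      using C(1) cpoly.independent_mono[OF C(2) D(1)] by (intro exI[of _ D]) auto
  qed
qed

lemma subspace_kernel:
  assumes "cpoly.subspace V" "linear_form f"
  shows "cpoly.subspace {F \<in> V. f F = 0}"
proof (rule cpoly.subspaceI)
  have "f (cpoly_scale 0 0) = 0 * f 0" using assms(2) unfolding linear_form_def by blast
  then show "0 \<in> {F \<in> V. f F = 0}" using cpoly.subspace_0[OF assms(1)] by simp
qed (use assms in \<open>auto simp: linear_form_def intro: cpoly.subspace_add cpoly.subspace_scale\<close>)

lemma independent_in_kernels:
  assumes "finite I" "\<And>i. i \<in> I \<Longrightarrow> linear_form (f i)" "cpoly.subspace V" "independent_in V (n + card I)"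
  shows "independent_in {F \<in> V. \<forall>i\<in>I. f i F = 0} n"
  using assms
proof (induction I arbitrary: V rule: finite_induct)
  case empty
  then show ?case by simp
next
  case (insert i I)
  have "independent_in {F \<in> V. f i F = 0} (n + card I)"
    by (rule independent_in_kernel) (use insert in auto)
  then have "independent_in {F \<in> {F \<in> V. f i F = 0}. \<forall>i\<in>I. f i F = 0} n"
    by (intro insert.IH subspace_kernel) (use insert.prems in auto)
  then show ?case by (rule independent_in_mono) auto
qed

lemma dim_eqI:
  assumes "independent_in V n" "\<not> independent_in V (Suc n)"
  shows "cpoly.dim V = n"
proof -
  obtain B where B: "B \<subseteq> V" "finite B" "\<not> cpoly.dependent B" "card B = n"
    using assms(1) unfolding independent_in_def by blast
  have "F \<in> cpoly.span B" if "F \<in> V" for F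
  proof (rule ccontr)
    assume h: "F \<notin> cpoly.span B"
    then have "F \<notin> B" using cpoly.span_base by blast
    then have "independent_in V (Suc n)"
      unfolding independent_in_def using B that cpoly.independent_insertI[OF h B(3)]
      by (intro exI[of _ "insert F B"]) auto
    then show False using assms(2) by simp
  qed
  then show ?thesis using cpoly.dim_unique[of B V n] B by blast
qed

section \<open>Semicontinuity\<close>

definition quadric_point :: "complex \<times> complex \<Rightarrow> complex ^ 4" where
  "quadric_point q = (\<chi> i. if i = 1 then 1 else if i = 2 then fst q else if i = 3 then snd q else fst q * snd q)"

lemma quadric_point_nth [simp]:
  "quadric_point q $ 1 = 1" "quadric_point q $ 2 = fst q" "quadric_point q $ 3 = snd q"
  "quadric_point q $ 4 = fst q * snd q"
  by (simp_all add: quadric_point_def)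

lemma quadric_point_nonzero: "quadric_point q \<noteq> 0"
proof
  assume "quadric_point q = 0"
  then have "quadric_point q $ 1 = 0" by simp
  then show False by simp
qed

definition exponent_triple :: "(4 \<Rightarrow>\<^sub>0 nat) \<Rightarrow> nat \<times> nat \<times> nat" where
  "exponent_triple \<alpha> = (lk \<alpha> 2 + lk \<alpha> 4, lk \<alpha> 3 + lk \<alpha> 4, lk \<alpha> 4)"

definition triple_exponent :: "nat \<Rightarrow> nat \<times> nat \<times> nat \<Rightarrow> (4 \<Rightarrow>\<^sub>0 nat)" where
  "triple_exponent d = (\<lambda>(x, y, k). vec4 [d + k - x - y, x - k, y - k, k])"

lemma exponent_triple_inverse:
  "\<alpha> \<in> exponents d \<Longrightarrow> triple_exponent d (exponent_triple \<alpha>) = \<alpha>"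
  by (rule poly_mapping_4_eqI)
    (auto simp: triple_exponent_def exponent_triple_def exponents_def total_degree_4)

lemma triple_exponent_inverse:
  "t \<in> restricted_exponents d \<Longrightarrow> exponent_triple (triple_exponent d t) = t"
  by (auto simp: triple_exponent_def exponent_triple_def restricted_exponents_def)

lemma triple_exponent_mem: "t \<in> restricted_exponents d \<Longrightarrow> triple_exponent d t \<in> exponents d"
  by (auto simp: triple_exponent_def exponents_def total_degree_4 restricted_exponents_def)

lemma exponent_triple_mem: "\<alpha> \<in> exponents d \<Longrightarrow> exponent_triple \<alpha> \<in> restricted_exponents d"
  by (auto simp: exponent_triple_def exponents_def total_degree_4 restricted_exponents_def)

lemma sum_restricted_exponents:
  "(\<Sum>t\<in>restricted_exponents d. g (triple_exponent d t) t) = (\<Sum>\<alpha>\<in>exponents d. g \<alpha> (exponent_triple \<alpha>))"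
  by (rule sum.reindex_bij_witness[where i = exponent_triple and j = "triple_exponent d"])
    (auto simp: exponent_triple_inverse triple_exponent_inverse triple_exponent_mem exponent_triple_mem)

lemma prod_4: "prod f (UNIV :: 4 set) = f 1 * f 2 * f 3 * f 4"
  unfolding UNIV_4 by (simp add: ac_simps)

lemma monom_at_quadric_point: "monom_at \<alpha> (($) (quadric_point q)) = weight3 q (exponent_triple \<alpha>)"
  by (simp add: monom_at_def prod_4 weight3_def exponent_triple_def torus_weight_def power_add power_mult_distrib)

definition affine_exponent :: "((4 \<Rightarrow>\<^sub>0 nat) \<Rightarrow> complex) set" where
  "affine_exponent = {l. \<exists>a b. \<forall>\<alpha>. l \<alpha> = (\<Sum>v\<in>UNIV. a v * of_nat (lk \<alpha> v)) + b}"

lemma affine_exponent_shift: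
  assumes "l \<in> affine_exponent"
  shows "(\<lambda>\<alpha>. l (\<alpha> + Poly_Mapping.single v 1)) \<in> affine_exponent"
proof -
  obtain a b where l: "\<And>\<alpha>. l \<alpha> = (\<Sum>v\<in>UNIV. a v * of_nat (lk \<alpha> v)) + b"
    using assms by (auto simp: affine_exponent_def)
  have "(\<Sum>w\<in>UNIV. a w * of_nat (lk (\<alpha> + Poly_Mapping.single v 1) w)) = (\<Sum>w\<in>UNIV. a w * of_nat (lk \<alpha> w)) + a v" for \<alpha>
  proof -
    have "(\<Sum>w\<in>UNIV. a w * of_nat (lk (\<alpha> + Poly_Mapping.single v 1) w)) =
      (\<Sum>w\<in>UNIV. a w * of_nat (lk \<alpha> w) + (if w = v then a w else 0))"
      by (rule sum.cong) (auto simp: lookup_add lookup_single algebra_simps)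
    then show ?thesis by (simp add: sum.distrib)
  qed
  then have "l (\<alpha> + Poly_Mapping.single v 1) = (\<Sum>w\<in>UNIV. a w * of_nat (lk \<alpha> w)) + (a v + b)" for \<alpha>
    by (simp add: l)
  then show ?thesis unfolding affine_exponent_def by blast
qed

text \<open>A factor \<open>lk \<alpha> v\<close> in the test function acts as the differential
  operator \<open>x v\<close> times the partial derivative in direction \<open>v\<close>; the rest
  of the test function is shifted by one unit in \<open>v\<close>.\<close>

lemma cpoly_pair_mult_coordinate:
  "cpoly_pair (\<lambda>\<alpha>. of_nat (lk \<alpha> v) * (monom_at \<alpha> x * g \<alpha>)) F =
     x v * cpoly_pair (\<lambda>\<beta>. monom_at \<beta> x * g (\<beta> + Poly_Mapping.single v 1)) (cpoly_pderiv v F)"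
proof -
  let ?e = "Poly_Mapping.single v (1::nat)"
  have "lk F \<alpha> * (of_nat (lk \<alpha> v) * (monom_at \<alpha> x * g \<alpha>)) =
      x v * (of_nat (lk \<alpha> v) * lk F \<alpha> * (monom_at (\<alpha> - ?e) x * g (\<alpha> - ?e + ?e)))" for \<alpha>
  proof (cases "lk \<alpha> v = 0")
    case False
    have e: "\<alpha> - ?e + ?e = \<alpha>"
      by (rule poly_mapping_eqI) (use False in \<open>auto simp: lookup_add lookup_minus lookup_single when_def\<close>)
    have "monom_at ?e x = x v"
      by (simp add: monom_at_def lookup_single when_def prod.delta if_distrib[of "\<lambda>n. _ ^ n"] cong: if_cong)
    then have "monom_at \<alpha> x = x v * monom_at (\<alpha> - ?e) x"
      using monom_at_add[of "\<alpha> - ?e" ?e x] by (simp only: e mult.commute)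
    then show ?thesis by (simp only: e mult_ac)
  qed simp
  then show ?thesis
    unfolding cpoly_pderiv_def cpoly_pair_sum cpoly_pair_single sum_distrib_left
    by (simp only: cpoly_pair_def)
qed

text \<open>An affine function of the exponents acts as a combination of the identity and the
  operators \<open>x v\<close> times a partial derivative, so fewer than \<open>m\<close> such
  factors give a differential operator of order below \<open>m\<close>.\<close>

lemma mult_ge_annihilates:
  assumes "mult_ge (int m) F x" "set ls \<subseteq> affine_exponent" "length ls < m"
  shows "cpoly_pair (\<lambda>\<alpha>. monom_at \<alpha> (($) x) * (\<Prod>l\<leftarrow>ls. l \<alpha>)) F = 0"
  using assms
proof (induction m arbitrary: F ls)
  case 0
  then show ?case by simp
next
  case (Suc m)
  note mg = Suc.prems(1)[unfolded mult_ge_Suc]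
  show ?case
  proof (cases ls)
    case Nil
    then show ?thesis using mg by (simp add: cpoly_eval_pair)
  next
    case (Cons l ls')
    obtain a b where l: "\<And>\<alpha>. l \<alpha> = (\<Sum>v\<in>UNIV. a v * of_nat (lk \<alpha> v)) + b"
      using Suc.prems(2) Cons by (auto simp: affine_exponent_def)
    let ?X = "($) x"
    let ?g = "\<lambda>\<alpha>. \<Prod>l\<leftarrow>ls'. l \<alpha>"
    have mg': "mult_ge (int m) F x" using Suc.prems(1) by (auto simp: mult_ge_def)
    have 0: "cpoly_pair (\<lambda>\<alpha>. monom_at \<alpha> ?X * ?g \<alpha>) F = 0"
      by (rule Suc.IH[OF mg']) (use Suc.prems Cons in auto)
    have v: "cpoly_pair (\<lambda>\<alpha>. of_nat (lk \<alpha> v) * (monom_at \<alpha> ?X * ?g \<alpha>)) F = 0" for v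
    proof -
      let ?sh = "\<lambda>l \<alpha>. l (\<alpha> + Poly_Mapping.single v 1)"
      have "cpoly_pair (\<lambda>\<beta>. monom_at \<beta> ?X * (\<Prod>l\<leftarrow>map ?sh ls'. l \<beta>)) (cpoly_pderiv v F) = 0"
        by (rule Suc.IH) (use mg Suc.prems Cons affine_exponent_shift in auto)
      then show ?thesis unfolding cpoly_pair_mult_coordinate by (simp add: o_def)
    qed
    have "cpoly_pair (\<lambda>\<alpha>. monom_at \<alpha> ?X * (\<Prod>l\<leftarrow>ls. l \<alpha>)) F =
      (\<Sum>v\<in>UNIV. a v * cpoly_pair (\<lambda>\<alpha>. of_nat (lk \<alpha> v) * (monom_at \<alpha> ?X * ?g \<alpha>)) F) +
      b * cpoly_pair (\<lambda>\<alpha>. monom_at \<alpha> ?X * ?g \<alpha>) F"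
      unfolding cpoly_pair_def sum_distrib_left
      by (subst sum.swap) (simp add: Cons l sum.distrib[symmetric] sum_distrib_left sum_distrib_right algebra_simps)
    then show ?thesis by (simp only: 0 v) simp
  qed
qed

lemma mult_ge_vanishes_on:
  assumes "homogeneous (int d) F" "\<And>i. mult_ge (int m) F (quadric_point (P i))"
  shows "vanishes_on d m P (\<lambda>t. lk F (triple_exponent d t))"
  unfolding vanishes_on_def annihilates_def
proof (intro allI impI)
  fix i ls assume ls: "set ls \<subseteq> affine3 \<and> length ls < m"
  have keys: "Poly_Mapping.keys F \<subseteq> exponents d"
    using assms(1) by (auto simp: homogeneous_iff in_keys_iff exponents_def)
  let ?ls = "map (\<lambda>l \<alpha>. l (exponent_triple \<alpha>)) ls"
  have "set ?ls \<subseteq> affine_exponent"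
  proof
    fix l' assume "l' \<in> set ?ls"
    then obtain l where l: "l \<in> affine3" "l' = (\<lambda>\<alpha>. l (exponent_triple \<alpha>))" using ls by auto
    obtain a b c e where "\<And>x y k. l (x, y, k) = a * of_nat x + b * of_nat y + c * of_nat k + e"
      using l(1) by (auto simp: affine3_def)
    then show "l' \<in> affine_exponent"
      unfolding affine_exponent_def
      by (intro CollectI exI[of _ "\<lambda>v. if v = 2 then a else if v = 3 then b else if v = 4 then a + b + c else 0"] exI[of _ e] allI)
        (simp add: l(2) exponent_triple_def sum_4 algebra_simps)
  qed
  from mult_ge_annihilates[OF assms(2) this, of i]
  have "cpoly_pair (\<lambda>\<alpha>. monom_at \<alpha> (($) (quadric_point (P i))) * (\<Prod>l\<leftarrow>?ls. l \<alpha>)) F = 0"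
    using ls by simp
  then have "(\<Sum>\<alpha>\<in>exponents d. lk F \<alpha> * (weight3 (P i) (exponent_triple \<alpha>) * (\<Prod>l\<leftarrow>ls. l (exponent_triple \<alpha>)))) = 0"
    unfolding cpoly_pair_superset[OF finite_exponents keys] by (simp add: monom_at_quadric_point o_def)
  then show "(\<Sum>t\<in>restricted_exponents d. lk F (triple_exponent d t) * weight3 (P i) t * (\<Prod>l\<leftarrow>ls. l t)) = 0"
    using sum_restricted_exponents[of "\<lambda>\<alpha> t. lk F \<alpha> * weight3 (P i) t * (\<Prod>l\<leftarrow>ls. l t)" d]
    by (simp add: mult.assoc)
qed

text \<open>The graded class to which elimination is applied: closed sets of nine-tuples are cut out
  by multihomogeneous polynomials, so the product of pivots has to stay multihomogeneous.\<close>

definition multidegree :: "(9 \<Rightarrow>\<^sub>0 nat) \<Rightarrow> (points \<Rightarrow> complex) set" where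
  "multidegree e = {g. \<exists>\<Phi>. (\<forall>\<beta>\<in>Poly_Mapping.keys \<Phi>. \<forall>i. (\<Sum>k\<in>UNIV. lk \<beta> (i, k)) = lk e i) \<and>
     g = (\<lambda>p. cpoly_eval \<Phi> (\<lambda>(i, k). p i $ k))}"

lemma multidegree_mult:
  assumes "f \<in> multidegree e" "g \<in> multidegree e'"
  shows "(\<lambda>p. f p * g p) \<in> multidegree (e + e')"
proof -
  obtain \<Phi> where \<Phi>: "\<And>\<beta> i. \<beta> \<in> Poly_Mapping.keys \<Phi> \<Longrightarrow> (\<Sum>k\<in>UNIV. lk \<beta> (i, k)) = lk e i"
    "f = (\<lambda>p. cpoly_eval \<Phi> (\<lambda>(i, k). p i $ k))"
    using assms(1) by (auto simp: multidegree_def)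
  obtain \<Psi> where \<Psi>: "\<And>\<beta> i. \<beta> \<in> Poly_Mapping.keys \<Psi> \<Longrightarrow> (\<Sum>k\<in>UNIV. lk \<beta> (i, k)) = lk e' i"
    "g = (\<lambda>p. cpoly_eval \<Psi> (\<lambda>(i, k). p i $ k))"
    using assms(2) by (auto simp: multidegree_def)
  have "\<forall>\<beta>\<in>Poly_Mapping.keys (\<Phi> * \<Psi>). \<forall>i. (\<Sum>k\<in>UNIV. lk \<beta> (i, k)) = lk (e + e') i"
  proof (intro ballI allI)
    fix \<beta> i assume "\<beta> \<in> Poly_Mapping.keys (\<Phi> * \<Psi>)"
    then obtain a b where "\<beta> = a + b" "a \<in> Poly_Mapping.keys \<Phi>" "b \<in> Poly_Mapping.keys \<Psi>"
      using keys_mult[of \<Phi> \<Psi>] by auto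
    then show "(\<Sum>k\<in>UNIV. lk \<beta> (i, k)) = lk (e + e') i"
      using \<Phi>(1)[of a i] \<Psi>(1)[of b i] by (simp add: lookup_add sum.distrib)
  qed
  moreover have "(\<lambda>p. f p * g p) = (\<lambda>p. cpoly_eval (\<Phi> * \<Psi>) (\<lambda>(i, k). p i $ k))"
    by (simp add: \<Phi>(2) \<Psi>(2) cpoly_eval_mult)
  ultimately show ?thesis unfolding multidegree_def by blast
qed

lemma multidegree_diff:
  assumes "f \<in> multidegree e" "g \<in> multidegree e"
  shows "(\<lambda>p. f p - g p) \<in> multidegree e"
proof -
  obtain \<Phi> where \<Phi>: "\<And>\<beta> i. \<beta> \<in> Poly_Mapping.keys \<Phi> \<Longrightarrow> (\<Sum>k\<in>UNIV. lk \<beta> (i, k)) = lk e i"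
    "f = (\<lambda>p. cpoly_eval \<Phi> (\<lambda>(i, k). p i $ k))"
    using assms(1) by (auto simp: multidegree_def)
  obtain \<Psi> where \<Psi>: "\<And>\<beta> i. \<beta> \<in> Poly_Mapping.keys \<Psi> \<Longrightarrow> (\<Sum>k\<in>UNIV. lk \<beta> (i, k)) = lk e i"
    "g = (\<lambda>p. cpoly_eval \<Psi> (\<lambda>(i, k). p i $ k))"
    using assms(2) by (auto simp: multidegree_def)
  let ?\<Theta> = "\<Phi> + cpoly_scale (- 1) \<Psi>"
  have "\<beta> \<in> Poly_Mapping.keys \<Phi> \<or> \<beta> \<in> Poly_Mapping.keys \<Psi>" if "\<beta> \<in> Poly_Mapping.keys ?\<Theta>" for \<beta>
    using that by (auto simp: in_keys_iff lookup_add lookup_minus)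
  then have "\<forall>\<beta>\<in>Poly_Mapping.keys ?\<Theta>. \<forall>i. (\<Sum>k\<in>UNIV. lk \<beta> (i, k)) = lk e i"
    using \<Phi>(1) \<Psi>(1) by blast
  moreover have "(\<lambda>p. f p - g p) = (\<lambda>p. cpoly_eval ?\<Theta> (\<lambda>(i, k). p i $ k))"
    by (simp only: \<Phi>(2) \<Psi>(2) cpoly_eval_add cpoly_eval_scale) simp
  ultimately show ?thesis unfolding multidegree_def by blast
qed

lemma multidegree_const: "(\<lambda>p. c) \<in> multidegree 0"
proof -
  have "(\<lambda>p :: points. c) = (\<lambda>p. cpoly_eval (Poly_Mapping.single 0 c) (\<lambda>(i, k). p i $ k))"
    by (simp add: cpoly_eval_single monom_at_def)
  moreover have "\<forall>\<beta>\<in>Poly_Mapping.keys (Poly_Mapping.single 0 c :: (9 \<times> 4) cpoly). \<forall>i. (\<Sum>k\<in>UNIV. lk \<beta> (i, k)) = lk 0 i"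
    by (auto split: if_splits)
  ultimately show ?thesis unfolding multidegree_def by blast
qed

definition at_point :: "9 \<Rightarrow> (4 \<Rightarrow>\<^sub>0 nat) \<Rightarrow> (9 \<times> 4 \<Rightarrow>\<^sub>0 nat)" where
  "at_point i \<beta> = (\<Sum>k\<in>UNIV. Poly_Mapping.single (i, k) (lk \<beta> k))"

lemma lookup_at_point: "lk (at_point i \<beta>) (j, k) = (if j = i then lk \<beta> k else 0)"
  by (simp add: at_point_def lookup_sum lookup_single when_def)

lemma multidegree_monom:
  assumes "total_degree \<beta> = n \<or> c = 0"
  shows "(\<lambda>p. c * monom_at \<beta> (($) (p i))) \<in> multidegree (Poly_Mapping.single i n)"
proof -
  have "monom_at (at_point i \<beta>) (\<lambda>(i, k). p i $ k) = monom_at \<beta> (($) (p i))" for p :: points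
  proof -
    have "monom_at (at_point i \<beta>) (\<lambda>(i, k). p i $ k) =
        (\<Prod>j\<in>UNIV. \<Prod>k\<in>UNIV. p j $ k ^ (if j = i then lk \<beta> k else 0))"
      by (simp add: monom_at_def prod.cartesian_product lookup_at_point case_prod_beta flip: UNIV_Times_UNIV)
        (rule prod.cong, auto simp: lookup_at_point)
    also have "\<dots> = (\<Prod>j\<in>UNIV. if j = i then \<Prod>k\<in>UNIV. p j $ k ^ lk \<beta> k else 1)"
      by (rule prod.cong) auto
    finally show ?thesis by (simp add: monom_at_def)
  qed
  then have "(\<lambda>p. c * monom_at \<beta> (($) (p i))) =
      (\<lambda>p. cpoly_eval (Poly_Mapping.single (at_point i \<beta>) c) (\<lambda>(i, k). p i $ k))"
    by (simp add: cpoly_eval_single)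
  moreover have "\<forall>\<beta>'\<in>Poly_Mapping.keys (Poly_Mapping.single (at_point i \<beta>) c). \<forall>j.
      (\<Sum>k\<in>UNIV. lk \<beta>' (j, k)) = lk (Poly_Mapping.single i n) j"
    using assms by (auto simp: lookup_at_point lookup_single total_degree_def when_def)
  ultimately show ?thesis unfolding multidegree_def by blast
qed

text \<open>The alternative \<open>c = 0\<close> covers the derivatives that kill the monomial, for
  which degrees cannot be counted.\<close>

lemma fold_pderiv_single:
  "\<exists>\<beta> c. fold cpoly_pderiv vs (Poly_Mapping.single \<alpha> a) = Poly_Mapping.single \<beta> c \<and>
     (total_degree \<beta> + length vs = total_degree \<alpha> \<or> c = 0)"
proof (induction vs arbitrary: \<alpha> a)
  case (Cons v vs)
  let ?\<alpha> = "\<alpha> - Poly_Mapping.single v 1" and ?a = "of_nat (lk \<alpha> v) * a"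
  obtain \<beta> c where IH: "fold cpoly_pderiv vs (Poly_Mapping.single ?\<alpha> ?a) = Poly_Mapping.single \<beta> c"
    "total_degree \<beta> + length vs = total_degree ?\<alpha> \<or> c = 0"
    using Cons.IH by blast
  show ?case
  proof (cases "lk \<alpha> v = 0")
    case True
    then show ?thesis by (intro exI[of _ 0] exI[of _ 0]) (simp add: pderiv_single)
  next
    case False
    have "?\<alpha> + Poly_Mapping.single v 1 = \<alpha>"
      by (rule poly_mapping_eqI) (use False in \<open>auto simp: lookup_add lookup_minus lookup_single when_def\<close>)
    then have "total_degree \<alpha> = total_degree ?\<alpha> + 1"
      by (metis total_degree_add total_degree_single)
    then show ?thesis using IH by (intro exI[of _ \<beta>] exI[of _ c]) (auto simp: pderiv_single)
  qed
qed auto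

lemma subspace_linear_system: "cpoly.subspace (linear_system d m p)"
  by (rule cpoly.subspaceI)
    (auto simp: linear_system_def homogeneous_add homogeneous_scale mult_ge_add mult_ge_scale)

lemma form_as_sum:
  assumes "homogeneous (int d) (F :: 4 cpoly)"
  shows "F = (\<Sum>\<alpha>\<in>exponents d. Poly_Mapping.single \<alpha> (lk F \<alpha>))"
proof (rule poly_mapping_eqI)
  fix \<beta>
  have "lk F \<beta> = 0" if "\<beta> \<notin> exponents d" using assms that by (auto simp: homogeneous_iff exponents_def)
  then show "lk F \<beta> = lk (\<Sum>\<alpha>\<in>exponents d. Poly_Mapping.single \<alpha> (lk F \<alpha>)) \<beta>"
    by (auto simp: lookup_sum lookup_single when_def finite_exponents)
qed

lemma single_scale: "Poly_Mapping.single \<alpha> a = cpoly_scale a (Poly_Mapping.single \<alpha> 1)"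
  by (rule poly_mapping_eqI) (simp add: lookup_single when_def)

text \<open>The derivative conditions, completed by the \<open>n\<close> functionals of
  \<open>bounded_by\<close>, have trivial kernel at the points on the quadric, hence wherever
  \<open>G\<close> is nonzero. There \<open>n + 1\<close> independent forms would leave a nonzero
  form satisfying all of them.\<close>

lemma bounded_by_generic:
  assumes "bounded_by d m (P :: 9 \<Rightarrow> complex \<times> complex) n"
  shows "\<exists>e. \<exists>G\<in>multidegree e. G (\<lambda>i. quadric_point (P i)) \<noteq> 0 \<and>
    (\<forall>p. G p \<noteq> 0 \<longrightarrow> \<not> independent_in (linear_system (int d) (\<lambda>_. int m) p) (Suc n))"
proof -
  obtain \<Lambda> where \<Lambda>: "\<And>c. vanishes_on d m P c \<Longrightarrow>
     (\<forall>j<n. (\<Sum>t\<in>restricted_exponents d. c t * \<Lambda> j t) = 0) \<Longrightarrow> \<forall>t\<in>restricted_exponents d. c t = 0"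
    using assms unfolding bounded_by_def by blast
  define R :: "(9 \<times> 4 list + nat) set" where
    "R = {Inl (i, vs) |i vs. length vs < m} \<union> {Inr j |j. j < n}"
  \<comment> \<open>Rows of type \<open>Inl\<close> are the derivatives at the points; rows of type
    \<open>Inr\<close> are the functionals, which do not vary with \<open>p\<close> and so have
    multidegree 0.\<close>
  define M :: "(9 \<times> 4 list + nat) \<Rightarrow> (4 \<Rightarrow>\<^sub>0 nat) \<Rightarrow> points \<Rightarrow> complex" where
    "M = (\<lambda>r \<alpha> p. case r of Inl (i, vs) \<Rightarrow> cpoly_eval (fold cpoly_pderiv vs (Poly_Mapping.single \<alpha> 1)) (($) (p i))
       | Inr j \<Rightarrow> \<Lambda> j (exponent_triple \<alpha>))"
  define deg :: "(9 \<times> 4 list + nat) \<Rightarrow> (9 \<Rightarrow>\<^sub>0 nat)" where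
    "deg = (\<lambda>r. case r of Inl (i, vs) \<Rightarrow> Poly_Mapping.single i (d - length vs) | Inr j \<Rightarrow> 0)"
  have eval: "cpoly_eval (fold cpoly_pderiv vs F) x =
      (\<Sum>\<alpha>\<in>exponents d. cpoly_eval (fold cpoly_pderiv vs (Poly_Mapping.single \<alpha> 1)) x * lk F \<alpha>)"
    if "homogeneous (int d) F" for F :: "4 cpoly" and vs x
    by (subst form_as_sum[OF that])
      (simp add: fold_pderiv_sum cpoly_eval_sum single_scale[of _ "lk F _"] fold_pderiv_scale cpoly_eval_scale mult.commute)
  have "\<exists>e. \<exists>G\<in>multidegree e. G (\<lambda>i. quadric_point (P i)) \<noteq> 0 \<and> (\<forall>p f. G p \<noteq> 0 \<longrightarrow>
     (\<forall>r\<in>R. (\<Sum>s\<in>exponents d. M r s p * f s) = 0) \<longrightarrow> (\<forall>s\<in>exponents d. f s = 0))"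
  proof (rule injective_open[where C = multidegree and M = M and deg = deg and deg_one = 0,
        OF finite_exponents multidegree_mult multidegree_diff multidegree_const])
    fix r and \<alpha> :: "4 \<Rightarrow>\<^sub>0 nat" assume r: "r \<in> R" and \<alpha>: "\<alpha> \<in> exponents d"
    show "M r \<alpha> \<in> multidegree (deg r)"
    proof (cases r)
      case (Inl a)
      obtain i vs where a: "a = (i, vs)" by (cases a)
      obtain \<beta> c where fold: "fold cpoly_pderiv vs (Poly_Mapping.single \<alpha> (1::complex)) = Poly_Mapping.single \<beta> c"
        and "total_degree \<beta> + length vs = total_degree \<alpha> \<or> c = 0"
        using fold_pderiv_single[of vs \<alpha> 1] by blast
      then have "total_degree \<beta> = d - length vs \<or> c = 0"
        using \<alpha> by (auto simp: exponents_def)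
      from multidegree_monom[OF this, of i] show ?thesis
        by (simp add: M_def deg_def Inl a cpoly_eval_single fold)
    next
      case (Inr j)
      then show ?thesis by (simp add: M_def deg_def multidegree_const)
    qed
  next
    fix f assume f: "\<And>r. r \<in> R \<Longrightarrow> (\<Sum>s\<in>exponents d. M r s (\<lambda>i. quadric_point (P i)) * f s) = 0"
    define F where "F = (\<Sum>\<alpha>\<in>exponents d. Poly_Mapping.single \<alpha> (f \<alpha>))"
    have lkF: "lk F \<beta> = (if \<beta> \<in> exponents d then f \<beta> else 0)" for \<beta>
      by (simp add: F_def lookup_sum lookup_single when_def finite_exponents)
    have hom: "homogeneous (int d) F"
      by (auto simp: homogeneous_iff lkF exponents_def)
    have "mult_ge (int m) F (quadric_point (P i))" for i
      unfolding mult_ge_def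
    proof (intro allI impI)
      fix vs :: "4 list" assume vs: "int (length vs) < int m"
      have "(\<Sum>\<alpha>\<in>exponents d. M (Inl (i, vs)) \<alpha> (\<lambda>i. quadric_point (P i)) * f \<alpha>) = 0"
        by (rule f) (use vs in \<open>auto simp: R_def\<close>)
      then show "cpoly_eval (fold cpoly_pderiv vs F) (($) (quadric_point (P i))) = 0"
        unfolding eval[OF hom] by (simp add: M_def lkF)
    qed
    then have van: "vanishes_on d m P (\<lambda>t. lk F (triple_exponent d t))"
      by (rule mult_ge_vanishes_on[OF hom])
    have "\<forall>t\<in>restricted_exponents d. lk F (triple_exponent d t) = 0"
    proof (rule \<Lambda>[OF van], intro allI impI)
      fix j assume "j < n"
      then have "(\<Sum>\<alpha>\<in>exponents d. M (Inr j) \<alpha> (\<lambda>i. quadric_point (P i)) * f \<alpha>) = 0"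
        by (intro f) (auto simp: R_def)
      then show "(\<Sum>t\<in>restricted_exponents d. lk F (triple_exponent d t) * \<Lambda> j t) = 0"
        unfolding sum_restricted_exponents[of "\<lambda>\<alpha> t. lk F \<alpha> * \<Lambda> j t"] by (simp add: M_def lkF mult.commute)
    qed
    then show "\<forall>\<alpha>\<in>exponents d. f \<alpha> = 0"
      by (metis exponent_triple_inverse exponent_triple_mem lkF)
  qed
  then obtain e G where G: "G \<in> multidegree e" "G (\<lambda>i. quadric_point (P i)) \<noteq> 0"
    "\<And>p f. G p \<noteq> 0 \<Longrightarrow> \<forall>r\<in>R. (\<Sum>s\<in>exponents d. M r s p * f s) = 0 \<Longrightarrow> \<forall>s\<in>exponents d. f s = 0"
    by blast
  have "\<not> independent_in (linear_system (int d) (\<lambda>_. int m) p) (Suc n)" if p: "G p \<noteq> 0" for p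
  proof
    let ?\<phi> = "\<lambda>j F. \<Sum>\<alpha>\<in>exponents d. \<Lambda> j (exponent_triple \<alpha>) * lk F \<alpha>"
    assume "independent_in (linear_system (int d) (\<lambda>_. int m) p) (Suc n)"
    then have "independent_in {F \<in> linear_system (int d) (\<lambda>_. int m) p. \<forall>j\<in>{..<n}. ?\<phi> j F = 0} 1"
      by (intro independent_in_kernels subspace_linear_system)
        (auto simp: linear_form_def lookup_add algebra_simps sum.distrib sum_distrib_left)
    then obtain B where B: "B \<subseteq> {F \<in> linear_system (int d) (\<lambda>_. int m) p. \<forall>j\<in>{..<n}. ?\<phi> j F = 0}"
      "cpoly.independent B" "card B = 1"
      unfolding independent_in_def by blast
    then obtain F where F: "B = {F}" using card_1_singletonE by blast
    then have "F \<noteq> 0" using B(2) cpoly.dependent_zero by blast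
    have mem: "homogeneous (int d) F" "\<And>i. mult_ge (int m) F (p i)" "\<And>j. j < n \<Longrightarrow> ?\<phi> j F = 0"
      using B(1) F by (auto simp: linear_system_def)
    have "\<forall>\<alpha>\<in>exponents d. lk F \<alpha> = 0"
    proof (rule G(3)[OF p], rule ballI)
      fix r assume "r \<in> R"
      then show "(\<Sum>s\<in>exponents d. M r s p * lk F s) = 0"
        using mem(2,3) by (auto simp: R_def M_def eval[OF mem(1), symmetric] mult_ge_def)
    qed
    then have "F = 0" by (subst form_as_sum[OF mem(1)]) simp
    then show False using \<open>F \<noteq> 0\<close> by simp
  qed
  then show ?thesis using G(1,2) by blast
qed

text \<open>The product of the polynomials for the single triples serves all of them; the open set
  is nonempty because it contains the special tuple on the quadric.\<close>

lemma bounded_by_in_general_position: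
  fixes P :: "9 \<Rightarrow> complex \<times> complex"
  assumes "finite T" "\<And>d m n. (d, m, n) \<in> T \<Longrightarrow> bounded_by d m P n"
  shows "in_general_position (\<lambda>p. \<forall>(d, m, n)\<in>T. \<not> independent_in (linear_system (int d) (\<lambda>_. int m) p) (Suc n))"
proof -
  have "\<exists>e. \<exists>G\<in>multidegree e. G (\<lambda>i. quadric_point (P i)) \<noteq> 0 \<and>
    (\<forall>p. G p \<noteq> 0 \<longrightarrow> (\<forall>(d, m, n)\<in>T. \<not> independent_in (linear_system (int d) (\<lambda>_. int m) p) (Suc n)))"
    using assms
  proof (induction T rule: finite_induct)
    case empty
    show ?case by (rule exI[of _ 0], rule bexI[OF _ multidegree_const[of 1]]) simp
  next
    case (insert t T)
    obtain d m n where t: "t = (d, m, n)" by (cases t)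
    have "\<And>d m n. (d, m, n) \<in> T \<Longrightarrow> bounded_by d m P n" using insert.prems by blast
    from insert.IH[OF this]
    obtain e G where G: "G \<in> multidegree e" "G (\<lambda>i. quadric_point (P i)) \<noteq> 0"
      "\<And>p. G p \<noteq> 0 \<Longrightarrow> \<forall>(d, m, n)\<in>T. \<not> independent_in (linear_system (int d) (\<lambda>_. int m) p) (Suc n)"
      by blast
    obtain e' G' where G': "G' \<in> multidegree e'" "G' (\<lambda>i. quadric_point (P i)) \<noteq> 0"
      "\<And>p. G' p \<noteq> 0 \<Longrightarrow> \<not> independent_in (linear_system (int d) (\<lambda>_. int m) p) (Suc n)"
      using bounded_by_generic[of d m P n] insert.prems t by blast
    show ?case
    proof (rule exI[of _ "e + e'"], rule bexI[OF _ multidegree_mult[OF G(1) G'(1)]], intro conjI allI impI)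
      show "G (\<lambda>i. quadric_point (P i)) * G' (\<lambda>i. quadric_point (P i)) \<noteq> 0" using G(2) G'(2) by simp
      fix p assume "G p * G' p \<noteq> 0"
      then have "G p \<noteq> 0" "G' p \<noteq> 0" by auto
      then show "\<forall>(d, m, n)\<in>insert t T. \<not> independent_in (linear_system (int d) (\<lambda>_. int m) p) (Suc n)"
        using G(3)[of p] G'(3)[of p] t by auto
    qed
  qed
  then obtain e G where G: "G \<in> multidegree e" "G (\<lambda>i. quadric_point (P i)) \<noteq> 0"
    "\<And>p. G p \<noteq> 0 \<Longrightarrow> \<forall>(d, m, n)\<in>T. \<not> independent_in (linear_system (int d) (\<lambda>_. int m) p) (Suc n)"
    by blast
  obtain \<Phi> where \<Phi>: "\<forall>\<beta>\<in>Poly_Mapping.keys \<Phi>. \<forall>i. (\<Sum>k\<in>UNIV. lk \<beta> (i, k)) = lk e i"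
    "G = (\<lambda>p. cpoly_eval \<Phi> (\<lambda>(i, k). p i $ k))"
    using G(1) unfolding multidegree_def by blast
  define U where "U = {p. (\<forall>i. p i \<noteq> 0) \<and> (\<exists>F\<in>{\<Phi>}. cpoly_eval F (\<lambda>(i, k). p i $ k) \<noteq> 0)}"
  have "multihomogeneous \<Phi>" unfolding multihomogeneous_def using \<Phi>(1) by blast
  then have "zariski_open U" unfolding zariski_open_def U_def by (intro exI[of _ "{\<Phi>}"]) simp
  moreover have "(\<lambda>i. quadric_point (P i)) \<in> U" using G(2) \<Phi>(2) by (simp add: quadric_point_nonzero U_def)
  moreover have "\<forall>(d, m, n)\<in>T. \<not> independent_in (linear_system (int d) (\<lambda>_. int m) p) (Suc n)" if "p \<in> U" for p
    using G(3)[of p] that \<Phi>(2) by (simp add: U_def)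
  ultimately show ?thesis unfolding in_general_position_def by (intro exI[of _ U]) auto
qed

lemma in_general_position_mono:
  "in_general_position A \<Longrightarrow> (\<And>p. A p \<Longrightarrow> B p) \<Longrightarrow> in_general_position B"
  unfolding in_general_position_def by blast

definition restricted_dim :: "nat \<Rightarrow> nat" where
  "restricted_dim m = (m + 1) * (8 - m) div 2"

text \<open>The same points serve all multiplicities up to \<open>n\<close>, because each induction
  step passes to the residual system at unchanged points. The induction starts with one form of
  degree 0 and four forms of degree 1.\<close>

lemma exists_points:
  "\<exists>P :: 9 \<Rightarrow> complex \<times> complex. (\<forall>m\<le>n. bounded_by (2 * m) m P 1) \<and>
     (\<forall>m\<le>n. bounded_by (2 * m + 1) m P (\<Sum>j\<le>m. restricted_dim j))"
proof -
  have "\<forall>m. \<exists>N. m \<ge> 1 \<longrightarrow> N \<subseteq> square (2 * m + 1) \<and> card N \<le> restricted_dim m \<and>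
      tileable m 9 (square (2 * m + 1) - N)"
    using tileable_odd_square_minus unfolding restricted_dim_def by metis
  then obtain N where N: "\<And>m. m \<ge> 1 \<Longrightarrow> N m \<subseteq> square (2 * m + 1)"
    "\<And>m. m \<ge> 1 \<Longrightarrow> card (N m) \<le> restricted_dim m"
    "\<And>m. m \<ge> 1 \<Longrightarrow> tileable m 9 (square (2 * m + 1) - N m)" by metis
  define S where "S = (\<lambda>(m, odd). if odd then square (2 * m + 1) - N m else square (2 * m))"
  have "\<exists>P :: 9 \<Rightarrow> complex \<times> complex. (\<forall>i. fst (P i) \<noteq> 0 \<and> snd (P i) \<noteq> 0) \<and>
    (\<forall>j\<in>{1..n} \<times> UNIV. imposes_independent (fst j) (range P) (S j))"
  proof (rule common_independent_points)
    fix j :: "nat \<times> bool" assume j: "j \<in> {1..n} \<times> UNIV"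
    obtain m b where jmb: "j = (m, b)" by (cases j)
    show "finite (S j)" by (simp add: jmb S_def)
    have "tileable m 9 (S j)" using N(3)[of m] tileable_even_square[of m] j by (auto simp: jmb S_def)
    then show "\<exists>P :: 9 \<Rightarrow> complex \<times> complex. imposes_independent (fst j) (range P) (S j)"
      using tileable_imposes_independent_nine[OF \<open>finite (S j)\<close>] by (simp add: jmb)
  qed simp
  then obtain P :: "9 \<Rightarrow> complex \<times> complex" where P: "\<And>i. fst (P i) \<noteq> 0 \<and> snd (P i) \<noteq> 0"
    "\<And>m b. 1 \<le> m \<Longrightarrow> m \<le> n \<Longrightarrow> imposes_independent m (range P) (S (m, b))" by fastforce
  have "bounded_by (2 * m) m P 1" if "m \<le> n" for m
    using that
  proof (induction m)
    case 0
    have "restricted_exponents 0 \<subseteq> {(0, 0, 0)}" by (auto simp: restricted_exponents_def)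
    then have "card (restricted_exponents 0) \<le> 1" using card_mono[of "{(0, 0, 0)}" "restricted_exponents 0"] by simp
    then show ?case by (simp add: bounded_by_card)
  next
    case (Suc m)
    \<comment> \<open>In even degree the restricted system is zero, so no lattice point is omitted
      and the bound stays 1.\<close>
    have "bounded_by (2 * m + 2) (Suc m) P (1 + 0)"
      by (rule bounded_by_step[where N = "{}"]) (use Suc P(1) P(2)[of "Suc m" False] in \<open>auto simp: S_def\<close>)
    then show ?case by simp
  qed
  moreover have "bounded_by (2 * m + 1) m P (\<Sum>j\<le>m. restricted_dim j)" if "m \<le> n" for m
    using that
  proof (induction m)
    case 0
    have "restricted_exponents 1 \<subseteq> {(0, 0, 0), (1, 0, 0), (0, 1, 0), (1, 1, 1)}"
      by (auto simp: restricted_exponents_def)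
    then have "card (restricted_exponents 1) \<le> card {(0, 0, 0), (1, 0, 0), (0, 1, 0), (1, 1, 1 :: nat) :: nat \<times> nat \<times> nat}"
      by (intro card_mono) auto
    then show ?case by (intro bounded_by_card) (simp add: restricted_dim_def)
  next
    case (Suc m)
    have "bounded_by (2 * m + 1 + 2) (Suc m) P ((\<Sum>j\<le>m. restricted_dim j) + restricted_dim (Suc m))"
    proof (rule bounded_by_step[where N = "N (Suc m)"])
      show "N (Suc m) \<subseteq> square (2 * m + 1 + 2)" using N(1)[of "Suc m"] by (simp add: numeral_eq_Suc)
      show "imposes_independent (Suc m) (range P) (square (2 * m + 1 + 2) - N (Suc m))"
        using P(2)[of "Suc m" True] Suc.prems by (simp add: S_def numeral_eq_Suc)
    qed (use Suc P(1) N(2) in auto)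
    then show ?case by (simp add: numeral_eq_Suc)
  qed
  ultimately show ?thesis by blast
qed

text \<open>The summands vanish from 8 on; up to 7 the closed form is chi of the system of degree
  \<open>2 * m + 1\<close>.\<close>

lemma sum_restricted_dim:
  "(\<Sum>j\<le>m. restricted_dim j) = (if m \<ge> 7 then 60 else (m + 1) * (m + 2) * (12 - m) div 6)"
proof (induction m)
  case (Suc m)
  show ?case
  proof (cases "m \<ge> 7")
    case True
    then show ?thesis using Suc by (simp add: restricted_dim_def)
  next
    case False
    then have "m \<in> {0, 1, 2, 3, 4, 5, 6}" by auto
    then show ?thesis using Suc by (auto simp: restricted_dim_def)
  qed
qed (simp add: restricted_dim_def)

section \<open>Lower bounds and exact dimensions\<close>

lemma independent_forms:
  "independent_in {F :: 4 cpoly. homogeneous (int d) F} ((d + 3) choose 3)"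
proof -
  let ?f = "\<lambda>\<alpha>. Poly_Mapping.single \<alpha> (1 :: complex)"
  let ?E = "exponents d :: (4 \<Rightarrow>\<^sub>0 nat) set"
  have inj: "inj_on ?f ?E" by (auto simp: inj_on_def) (metis keys_single the_elem_eq one_neq_zero)
  have "cpoly.independent (?f ` ?E)"
  proof (rule cpoly.independent_if_scalars_zero)
    fix u F assume s: "(\<Sum>F\<in>?f ` ?E. cpoly_scale (u F) F) = 0" and F: "F \<in> ?f ` ?E"
    obtain \<alpha> where \<alpha>: "\<alpha> \<in> ?E" "F = ?f \<alpha>" using F by auto
    have "0 = lk (\<Sum>F\<in>?f ` ?E. cpoly_scale (u F) F) \<alpha>" using s by simp
    also have "\<dots> = (\<Sum>\<beta>\<in>?E. u (?f \<beta>) * lk (?f \<beta>) \<alpha>)"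
      by (simp add: sum.reindex[OF inj] lookup_sum)
    also have "\<dots> = (\<Sum>\<beta>\<in>?E. if \<beta> = \<alpha> then u (?f \<beta>) else 0)"
      by (rule sum.cong) (auto simp: lookup_single when_def)
    also have "\<dots> = u F" using \<alpha> finite_exponents by simp
    finally show "u F = 0" by simp
  qed (simp add: finite_exponents)
  moreover have "?f ` ?E \<subseteq> {F. homogeneous (int d) F}"
    by (auto simp: homogeneous_iff lookup_single when_def exponents_def split: if_splits)
  moreover have "card (?f ` ?E) = (d + 3) choose 3"
    using card_image[OF inj] card_exponents[of d] by simp
  ultimately show ?thesis
    unfolding independent_in_def by (intro exI[of _ "?f ` ?E"]) (simp add: finite_exponents)
qed

lemma linear_form_partial: "linear_form (\<lambda>F. cpoly_eval (fold cpoly_pderiv vs F) x)"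
  by (simp add: linear_form_def fold_pderiv_add fold_pderiv_scale cpoly_eval_add cpoly_eval_scale)

text \<open>Counting conditions: by Euler's identity only the derivatives of order exactly
  \<open>m - 1\<close> have to vanish, and there are \<open>(m + 2) choose 3\<close> of them at each
  point.\<close>

lemma independent_linear_system:
  assumes "m \<le> d" "k + 9 * ((m + 2) choose 3) \<le> (d + 3) choose 3"
  shows "independent_in (linear_system (int d) (\<lambda>_. int m) p) k"
proof (cases m)
  case 0
  have "{F. homogeneous (int d) F} \<subseteq> linear_system (int d) (\<lambda>_. int m) p"
    by (auto simp: linear_system_def 0 mult_ge_nonpos)
  then show ?thesis
    using independent_in_le[OF independent_forms, of k d] assms(2) independent_in_mono by auto
next
  case (Suc n)
  \<comment> \<open>One ordering of the variables is chosen for each exponent vector, so that equal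
    derivatives are counted once.\<close>
  define w :: "(4 \<Rightarrow>\<^sub>0 nat) \<Rightarrow> 4 list" where "w = (\<lambda>\<gamma>. SOME vs. exponent_of vs = \<gamma>)"
  define I :: "(9 \<times> (4 \<Rightarrow>\<^sub>0 nat)) set" where "I = UNIV \<times> exponents n"
  define f where "f = (\<lambda>(i, \<gamma>) F. cpoly_eval (fold cpoly_pderiv (w \<gamma>) F) (($) (p i)))"
  have "m + 2 = n + 3" using Suc by simp
  then have cardI: "card I = 9 * ((m + 2) choose 3)"
    by (simp only: I_def card_cartesian_product card_exponents) simp
  have sub: "cpoly.subspace {F :: 4 cpoly. homogeneous (int d) F}"
    by (rule cpoly.subspaceI) (auto simp: homogeneous_add homogeneous_scale)
  have "independent_in {F \<in> {F. homogeneous (int d) F}. \<forall>i\<in>I. f i F = 0} k"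
  proof (rule independent_in_kernels[OF _ _ sub])
    show "finite I" by (simp add: I_def finite_exponents)
    show "linear_form (f i)" for i by (cases i) (simp add: f_def linear_form_partial)
    show "independent_in {F :: 4 cpoly. homogeneous (int d) F} (k + card I)"
      by (rule independent_in_le[OF independent_forms]) (use assms(2) cardI in simp)
  qed
  moreover have "F \<in> linear_system (int d) (\<lambda>_. int m) p"
    if F: "homogeneous (int d) F" "\<forall>i\<in>I. f i F = 0" for F
    unfolding linear_system_def mem_Collect_eq
  proof (intro conjI allI)
    fix i
    show "mult_ge (int m) F (p i)"
      unfolding Suc
    proof (rule mult_ge_of_top_order[OF F(1)])
      show "n \<le> d" using assms(1) Suc by simp
      fix vs :: "4 list" assume vs: "length vs = n"
      have "exponent_of (w (exponent_of vs)) = exponent_of vs"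
        unfolding w_def by (rule someI) simp
      then have "fold cpoly_pderiv vs F = fold cpoly_pderiv (w (exponent_of vs)) F"
        using fold_pderiv_cong by metis
      moreover have "(i, exponent_of vs) \<in> I"
        using exponent_of_in_exponents[of vs] vs by (simp add: I_def)
      ultimately show "cpoly_eval (fold cpoly_pderiv vs F) (($) (p i)) = 0"
        using F(2) by (auto simp: f_def)
    qed
  qed (rule F(1))
  ultimately show ?thesis by (elim independent_in_mono) auto
qed

lemma independent_in_multiply:
  fixes Q :: "4 cpoly"
  assumes "Q \<noteq> 0" "\<And>F. F \<in> V \<Longrightarrow> Q * F \<in> W" "independent_in V n"
  shows "independent_in W n"
proof -
  obtain B where B: "B \<subseteq> V" "finite B" "cpoly.independent B" "card B = n"
    using assms(3) unfolding independent_in_def by blast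
  let ?f = "\<lambda>F. Q * F"
  have inj: "inj_on ?f A" for A using assms(1) by (auto simp: inj_on_def)
  have scale: "Q * cpoly_scale c F = cpoly_scale c (Q * F)" for c F
    unfolding cpoly_scale_def mult_map_scale_conv_mult by (simp add: ac_simps)
  have "cpoly.independent (?f ` B)"
  proof (rule cpoly.independent_if_scalars_zero)
    fix u F assume s: "(\<Sum>F\<in>?f ` B. cpoly_scale (u F) F) = 0" and F: "F \<in> ?f ` B"
    obtain b where b: "b \<in> B" "F = Q * b" using F by auto
    have "Q * (\<Sum>b\<in>B. cpoly_scale (u (Q * b)) b) = 0"
      using s by (simp add: sum.reindex[OF inj] sum_distrib_left scale)
    then have "(\<Sum>b\<in>B. cpoly_scale (u (Q * b)) b) = 0" using assms(1) by simp
    from cpoly.independentD[OF B(3,2) order.refl this b(1)] show "u F = 0" by (simp add: b(2))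
  qed (simp add: B(2))
  moreover have "card (?f ` B) = n" using card_image[OF inj] B(4) by simp
  moreover have "?f ` B \<subseteq> W" using B(1) assms(2) by blast
  ultimately show ?thesis
    unfolding independent_in_def using B(2) by (intro exI[of _ "?f ` B"]) simp
qed

text \<open>Ten coefficients against nine conditions, for any nine points.\<close>

lemma exists_quadric: "\<exists>Q. Q \<noteq> 0 \<and> Q \<in> linear_system 2 (\<lambda>_. 1) p"
proof -
  have "independent_in (linear_system (int 2) (\<lambda>_. int 1) p) 1"
    by (rule independent_linear_system) (simp_all add: numeral_eq_Suc)
  then obtain B where "B \<subseteq> linear_system 2 (\<lambda>_. 1) p" "cpoly.independent B" "card B = 1"
    unfolding independent_in_def by auto
  then show ?thesis using cpoly.dependent_zero card_1_singletonE
    by (metis insert_subset singletonI)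
qed

lemma six_times_choose_three: "6 * ((n + 2) choose 3) = n * (n + 1) * (n + 2)"
proof (induction n)
  case (Suc n)
  have "2 * ((n + 2) choose 2) = (n + 2) * (n + 1)" by (simp add: choose_two)
  moreover have "(Suc n + 2) choose 3 = ((n + 2) choose 2) + ((n + 2) choose 3)"
    by (simp add: numeral_3_eq_3 numeral_2_eq_2)
  ultimately show ?case using Suc by (simp add: algebra_simps)
qed simp

lemma small_choose_three: "4 choose 3 = (4 :: nat)" "Suc (Suc 0) choose 3 = 0"
  by (simp_all add: numeral_eq_Suc)

text \<open>Multiplication by powers of the quadric carries a lower bound to larger multiplicities,
  where counting conditions eventually becomes too weak.\<close>

lemma independent_linear_system_add:
  assumes "independent_in (linear_system (int d) (\<lambda>_. int m) p) n"
  shows "independent_in (linear_system (int (d + 2 * k)) (\<lambda>_. int (m + k)) p) n"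
proof (induction k)
  case 0
  then show ?case using assms by simp
next
  case (Suc k)
  obtain Q where Q: "Q \<noteq> 0" "Q \<in> linear_system 2 (\<lambda>_. 1) p" using exists_quadric by blast
  show ?case
  proof (rule independent_in_multiply[OF Q(1) _ Suc])
    fix F assume "F \<in> linear_system (int (d + 2 * k)) (\<lambda>_. int (m + k)) p"
    then show "Q * F \<in> linear_system (int (d + 2 * Suc k)) (\<lambda>_. int (m + Suc k)) p"
      using Q(2) homogeneous_mult[of 2 Q "int (d + 2 * k)" F] mult_ge_mult[of 1 Q _ "m + k" F]
      by (simp add: linear_system_def algebra_simps)
  qed
qed

lemma dim_even:
  assumes "\<not> independent_in (linear_system (int (2 * m)) (\<lambda>_. int m) p) (Suc 1)"
  shows "cpoly.dim (linear_system (int (2 * m)) (\<lambda>_. int m) p) = 1"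
proof (rule dim_eqI[OF _ assms])
  have "independent_in (linear_system (int 0) (\<lambda>_. int 0) p) 1"
    by (rule independent_linear_system) (simp_all add: numeral_eq_Suc)
  from independent_linear_system_add[OF this, of m]
  show "independent_in (linear_system (int (2 * m)) (\<lambda>_. int m) p) 1" by simp
qed

lemma dim_odd:
  assumes "\<not> independent_in (linear_system (int (2 * m + 1)) (\<lambda>_. int m) p) (Suc (\<Sum>j\<le>m. restricted_dim j))"
  shows "cpoly.dim (linear_system (int (2 * m + 1)) (\<lambda>_. int m) p) =
     (if m \<ge> 7 then 60 else (m + 1) * (m + 2) * (12 - m) div 6)"
proof (rule dim_eqI)
  show "\<not> independent_in (linear_system (int (2 * m + 1)) (\<lambda>_. int m) p)
     (Suc (if m \<ge> 7 then 60 else (m + 1) * (m + 2) * (12 - m) div 6))"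
    using assms unfolding sum_restricted_dim .
  show "independent_in (linear_system (int (2 * m + 1)) (\<lambda>_. int m) p)
     (if m \<ge> 7 then 60 else (m + 1) * (m + 2) * (12 - m) div 6)"
  proof (cases "m \<ge> 7")
    case True
    \<comment> \<open>Multiplicity 7 is the last one with positive q; counting conditions there
      gives 816 - 9 * 84 = 60.\<close>
    have "independent_in (linear_system (int 15) (\<lambda>_. int 7) p) 60"
      by (rule independent_linear_system)
        (use six_times_choose_three[of 7] six_times_choose_three[of 16] in simp_all)
    from independent_linear_system_add[OF this, of "m - 7"]
    have "independent_in (linear_system (int (15 + 2 * (m - 7))) (\<lambda>_. int (7 + (m - 7))) p) 60" .
    moreover have "15 + 2 * (m - 7) = 2 * m + 1" "7 + (m - 7) = m" using True by auto
    ultimately show ?thesis using True by (simp only: if_True)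
  next
    case False
    then have "m \<in> {0, 1, 2, 3, 4, 5, 6}" by auto
    then show ?thesis
      using six_times_choose_three[of m] six_times_choose_three[of "2 * m + 2"]
      by (intro independent_linear_system) (auto simp: small_choose_three)
  qed
qed

lemma unique_quadric:
  assumes "\<not> independent_in (linear_system 2 (\<lambda>_. 1) p) (Suc 1)"
  shows "\<exists>Q. Q \<noteq> 0 \<and> linear_system 2 (\<lambda>_. 1) p = cpoly.span {Q}"
proof -
  obtain Q where Q: "Q \<noteq> 0" "Q \<in> linear_system 2 (\<lambda>_. 1) p" using exists_quadric by blast
  have "F \<in> cpoly.span {Q}" if "F \<in> linear_system 2 (\<lambda>_. 1) p" for F
  proof (rule ccontr)
    assume h: "F \<notin> cpoly.span {Q}"
    have "cpoly.independent {Q}" using Q(1) by simp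
    then have "cpoly.independent {F, Q}" by (rule cpoly.independent_insertI[OF h])
    moreover have "F \<noteq> Q" using h cpoly.span_base[of Q "{Q}"] by auto
    ultimately have "independent_in (linear_system 2 (\<lambda>_. 1) p) (Suc 1)"
      unfolding independent_in_def using Q(2) that by (intro exI[of _ "{F, Q}"]) auto
    then show False using assms by simp
  qed
  moreover have "cpoly.span {Q} \<subseteq> linear_system 2 (\<lambda>_. 1) p"
    by (rule cpoly.span_minimal) (use Q(2) subspace_linear_system in auto)
  ultimately show ?thesis using Q(1) by blast
qed

section \<open>The sign of q and the expected dimension\<close>

lemma q_system_even: "q_system (2 * int m) (\<lambda>_. int m) > 0 \<longleftrightarrow> m = 0"
proof -
  have "q_system (2 * int m) (\<lambda>_. int m) = (2 * int m + 1) ^ 2 - 9 * int ((m + 1) choose 2)"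
    by (simp add: q_system_def nat_add_distrib)
  moreover have "2 * int ((m + 1) choose 2) = (int m + 1) * int m"
  proof -
    have "2 * ((m + 1) choose 2) = (m + 1) * m" by (simp add: choose_two)
    then show ?thesis by (metis of_nat_1 of_nat_add of_nat_mult of_nat_numeral)
  qed
  ultimately have "2 * q_system (2 * int m) (\<lambda>_. int m) = 2 - (int m + 1) * int m"
    by (simp add: power2_eq_square algebra_simps)
  moreover have "(int m + 1) * int m \<ge> 2" if "m \<noteq> 0"
    using mult_mono[of 2 "int m + 1" 1 "int m"] that by simp
  ultimately show ?thesis by (cases "m = 0") force+
qed

lemma q_system_odd: "q_system (2 * int m + 1) (\<lambda>_. int m) > 0 \<longleftrightarrow> m \<le> 7"
proof -
  have "q_system (2 * int m + 1) (\<lambda>_. int m) = (2 * int m + 2) ^ 2 - 9 * int ((m + 1) choose 2)"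
    by (simp add: q_system_def nat_add_distrib)
  moreover have "2 * int ((m + 1) choose 2) = (int m + 1) * int m"
  proof -
    have "2 * ((m + 1) choose 2) = (m + 1) * m" by (simp add: choose_two)
    then show ?thesis by (metis of_nat_1 of_nat_add of_nat_mult of_nat_numeral)
  qed
  ultimately have "2 * q_system (2 * int m + 1) (\<lambda>_. int m) = (int m + 1) * (8 - int m)"
    by (simp add: power2_eq_square algebra_simps)
  moreover have "(int m + 1) * (8 - int m) > 0 \<longleftrightarrow> m \<le> 7"
    by (auto simp: zero_less_mult_iff)
  ultimately show ?thesis by linarith
qed

text \<open>With \<open>2 * m <= d\<close> no pair of points has \<open>m i + m j - d >= 2\<close>,
  so lines contribute no correction.\<close>

lemma linear_expected_dim_homogeneous:
  assumes "2 * m \<le> d"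
  shows "linear_expected_dim (int d) (\<lambda>_. int m) =
    max 0 (int ((d + 3) choose 3) - 9 * int ((m + 2) choose 3))"
proof -
  have empty: "{(i :: 9, j :: 9). i < j \<and> int m + int m - int d \<ge> 2} = {}" using assms by auto
  show ?thesis
    unfolding linear_expected_dim_def chi_system_def empty by (simp add: nat_add_distrib)
qed

theorem corollary4p13:
  fixes m d :: nat
  assumes "d \<le> 2 * m + 1"
  defines "D \<equiv> int d" and "M \<equiv> (\<lambda>i :: 9. int m)"
  shows "in_general_position (\<lambda>p.
    (\<exists>Q. Q \<noteq> 0 \<and> linear_system 2 (\<lambda>i. 1) p = cpoly.span {Q}) \<and>
    (cremona_reduced D M \<longrightarrow>
      (q_system D M \<le> 0 \<longrightarrow>
         cpoly.dim (linear_system D M p) = cpoly.dim (residual_system D M p)) \<and>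
      (q_system D M > 0 \<longrightarrow> linearly_nonspecial D M p)))"
proof -
  let ?K = "\<lambda>m. \<Sum>j\<le>m. restricted_dim j"
  \<comment> \<open>The range up to \<open>m + 1\<close> ensures that multiplicity 1, which yields
    uniqueness of the quadric, is covered even when \<open>m = 0\<close>.\<close>
  obtain P :: "9 \<Rightarrow> complex \<times> complex" where P:
    "\<And>k. k \<le> m + 1 \<Longrightarrow> bounded_by (2 * k) k P 1"
    "\<And>k. k \<le> m + 1 \<Longrightarrow> bounded_by (2 * k + 1) k P (?K k)"
    using exists_points[of "m + 1"] by blast
  \<comment> \<open>The systems whose dimensions are needed: quadrics, and for both parities of
    \<open>d\<close> the system and its residual system. For \<open>m = 0\<close> the truncated
    \<open>m - 1\<close> repeats entries.\<close>
  define T where "T = {(2 * 1, 1, 1), (2 * m, m, 1), (2 * (m - 1), m - 1, 1),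
    (2 * m + 1, m, ?K m), (2 * (m - 1) + 1, m - 1, ?K (m - 1))}"
  have "in_general_position (\<lambda>p. \<forall>(d, m, n)\<in>T. \<not> independent_in (linear_system (int d) (\<lambda>_. int m) p) (Suc n))"
    by (rule bounded_by_in_general_position[where P = P])
      (use P(1)[of 1] P(1)[of m] P(1)[of "m - 1"] P(2)[of m] P(2)[of "m - 1"] in \<open>auto simp: T_def\<close>)
  then show ?thesis
  proof (rule in_general_position_mono)
    fix p assume "\<forall>(d, m, n)\<in>T. \<not> independent_in (linear_system (int d) (\<lambda>_. int m) p) (Suc n)"
    then have ub: "\<not> independent_in (linear_system (int (2 * 1)) (\<lambda>_. int 1) p) (Suc 1)"
      "\<not> independent_in (linear_system (int (2 * m)) (\<lambda>_. int m) p) (Suc 1)"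
      "\<not> independent_in (linear_system (int (2 * (m - 1))) (\<lambda>_. int (m - 1)) p) (Suc 1)"
      "\<not> independent_in (linear_system (int (2 * m + 1)) (\<lambda>_. int m) p) (Suc (?K m))"
      "\<not> independent_in (linear_system (int (2 * (m - 1) + 1)) (\<lambda>_. int (m - 1)) p) (Suc (?K (m - 1)))"
      unfolding T_def by blast+
    note dims = dim_even[OF ub(2)] dim_even[OF ub(3)] dim_odd[OF ub(4)] dim_odd[OF ub(5)]
    have "\<exists>Q. Q \<noteq> 0 \<and> linear_system 2 (\<lambda>i. 1) p = cpoly.span {Q}"
      using unique_quadric ub(1) by simp
    moreover have "(q_system D M \<le> 0 \<longrightarrow>
         cpoly.dim (linear_system D M p) = cpoly.dim (residual_system D M p)) \<and>
      (q_system D M > 0 \<longrightarrow> linearly_nonspecial D M p)" if red: "cremona_reduced D M"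
    proof -
      have "2 * m \<le> d" using red by (simp add: cremona_reduced_def D_def M_def)
      then consider (even) "d = 2 * m" | (odd) "d = 2 * m + 1" using assms(1) by linarith
      then show ?thesis
      proof cases
        case even
        have D: "D = int (2 * m)" "D = 2 * int m" by (simp_all add: D_def even)
        show ?thesis
        proof (cases "m = 0")
          case True
          then have "linearly_nonspecial D M p"
            using dims(1) linear_expected_dim_homogeneous[of m d]
            by (simp add: linearly_nonspecial_def D_def M_def even numeral_eq_Suc)
          moreover have "q_system D M > 0" using q_system_even[of m] True by (simp add: D(2) M_def)
          ultimately show ?thesis by simp
        next
          case False
          have "residual_system D M p = linear_system (int (2 * (m - 1))) (\<lambda>_. int (m - 1)) p"
            using False by (simp add: residual_system_def D(2) M_def of_nat_diff algebra_simps)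
          then have "cpoly.dim (linear_system D M p) = cpoly.dim (residual_system D M p)"
            using dims(1,2) by (simp only: D(1) M_def)
          moreover have "\<not> q_system D M > 0" using q_system_even[of m] False by (simp add: D(2) M_def)
          ultimately show ?thesis by simp
        qed
      next
        case odd
        have D: "D = int (2 * m + 1)" "D = 2 * int m + 1" by (simp_all add: D_def odd)
        show ?thesis
        proof (cases "m \<le> 7")
          case True
          then have m: "m \<in> {0, 1, 2, 3, 4, 5, 6, 7}" by auto
          have "int (if m \<ge> 7 then 60 else (m + 1) * (m + 2) * (12 - m) div 6) =
             max 0 (int ((2 * m + 1 + 3) choose 3) - 9 * int ((m + 2) choose 3))"
            using m six_times_choose_three[of m] six_times_choose_three[of "2 * m + 2"]
            by (auto simp: small_choose_three)
          then have "linearly_nonspecial D M p"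
            using dims(3) linear_expected_dim_homogeneous[of m "2 * m + 1"]
            by (simp only: linearly_nonspecial_def D(1) M_def)
          moreover have "q_system D M > 0" using q_system_odd[of m] True by (simp add: D(2) M_def)
          ultimately show ?thesis by simp
        next
          \<comment> \<open>Here \<open>m - 1\<close> is still at least 7, so the system and its
            residual system both have dimension 60.\<close>
          case False
          have "residual_system D M p = linear_system (int (2 * (m - 1) + 1)) (\<lambda>_. int (m - 1)) p"
            using False by (simp add: residual_system_def D(2) M_def of_nat_diff algebra_simps)
          moreover have "cpoly.dim (linear_system D M p) = 60"
            using dims(3) False by (simp only: D(1) M_def) simp
          moreover have "cpoly.dim (linear_system (int (2 * (m - 1) + 1)) (\<lambda>_. int (m - 1)) p) = 60"
            using dims(4) False by simp
          moreover have "\<not> q_system D M > 0" using q_system_odd[of m] False by (simp add: D(2) M_def)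
          ultimately show ?thesis by simp
        qed
      qed
    qed
    ultimately show "(\<exists>Q. Q \<noteq> 0 \<and> linear_system 2 (\<lambda>i. 1) p = cpoly.span {Q}) \<and>
      (cremona_reduced D M \<longrightarrow>
        (q_system D M \<le> 0 \<longrightarrow>
           cpoly.dim (linear_system D M p) = cpoly.dim (residual_system D M p)) \<and>
        (q_system D M > 0 \<longrightarrow> linearly_nonspecial D M p))"
      by blast
  qed
qed

end
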